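(* Let $\mathcal{C}$ be a finitary $2$-category and $\mathbf{M}$ a finitary $2$-representation of $\mathcal{C}$. Let $\mathcal{Q}$ and $\mathcal{R}$ be two complete filtrations of $\mathrm{Ind}(\mathbf{M})/_{\sim}$. Let $\mathbf{L}_1,\mathbf{L}_2,\dots,\mathbf{L}_k$ be the sequence of simple transitive subquotients of $\mathbf{M}$ associated to $\mathcal{Q}$ and $\mathbf{L}'_1,\mathbf{L}'_2,\dots,\mathbf{L}'_l$ the sequence of simple transitive subquotients of $\mathbf{M}$ associated to $\mathcal{R}$. Then $k=l$ and there is a bijection $\sigma:\{1,2,\dots,k\}\to\{1,2,\dots,k\}$ such that $\mathbf{L}_i$ and $\mathbf{L}'_{\sigma(i)}$ are equivalent for all $i\in\{1,2,\dots,k\}$.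
   Context: Let $\Bbbk$ be an algebraically closed field. $2$-categories are strict. An additive $\Bbbk$-linear category is finitary if it is idempotent split, has finitely many isomorphism classes of indecomposable objects and finite dimensional morphism spaces. $\mathfrak{A}^f_{\Bbbk}$ is the $2$-category of finitary additive $\Bbbk$-linear categories, additive $\Bbbk$-linear functors and natural transformations. A finitary $2$-category $\mathcal{C}$ (over $\Bbbk$) is a $2$-category with finitely many objects such that each $\mathcal{C}(\mathtt{i},\mathtt{j})$ is in $\mathfrak{A}^f_{\Bbbk}$, horizontal composition is additive and $\Bbbk$-linear, and each identity $1$-morphism $\mathbf{1}_{\mathtt{i}}$ is indecomposable. A finitary $2$-representation $\mathbf{M}$ of $\mathcal{C}$ is a strict $2$-functor $\mathcal{C}\to\mathfrak{A}^f_{\Bbbk}$ (additive and $\Bbbk$-linear on the categories $\mathcal{C}(\mathtt{i},\mathtt{j})$); write $\mathrm{F}\,X$ for $\mathbf{M}(\mathrm{F})\,X$. A $2$-natural transformation $\Phi:\mathbf{M}\to\mathbf{N}$ consists of functors $\Phi_{\mathtt{i}}:\mathbf{M}(\mathtt{i})\to\mathbf{N}(\mathtt{i})$ together with isomorphisms $\Phi_{\mathtt{j}}\circ\mathbf{M}(\mathrm{F})\cong\mathbf{N}(\mathrm{F})\circ\Phi_{\mathtt{i}}$, natural in $\mathrm{F}\in\mathcal{C}(\mathtt{i},\mathtt{j})$ and compatible with composition; $\mathbf{M}$ and $\mathbf{N}$ are equivalent if there is such $\Phi$ with every $\Phi_{\mathtt{i}}$ an equivalence. Transitivity. $\mathbf{M}$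 is transitive if it is non-zero and, for every $\mathtt{i}$ and every non-zero $X\in\mathbf{M}(\mathtt{i})$, every object of every $\mathbf{M}(\mathtt{j})$ lies in the additive closure of the objects $\mathrm{F}\,X$, $\mathrm{F}\in\mathcal{C}(\mathtt{i},\mathtt{j})$. An ideal $\mathbf{I}$ of $\mathbf{M}$ is a collection of categorical ideals $\mathbf{I}(\mathtt{i})$ of $\mathbf{M}(\mathtt{i})$ such that $\mathbf{M}(\mathrm{F})(\eta)\in\mathbf{I}$ for all $\eta\in\mathbf{I}$ and all $1$-morphisms $\mathrm{F}$ (whenever defined). A transitive $\mathbf{M}$ has a unique maximal ideal $\mathbf{I}$ containing no identity morphism except that of the zero object; the quotient $\underline{\mathbf{M}}:=\mathbf{M}/\mathbf{I}$ is its simple transitive quotient, and $\mathbf{M}$ is simple transitive if $\mathbf{I}=0$. Action preorder. $\mathrm{Ind}(\mathbf{M})$ is the set of isomorphism classes of indecomposable objects in all $\mathbf{M}(\mathtt{i})$. Put $X\geq Y$ if $X$ is isomorphic to a direct summand of $\mathrm{F}\,Y$ for some $1$-morphism $\mathrm{F}$; $X\sim Y$ means $X\geq Y$ and $Y\geq X$. Then $\geq$ induces a partial order on $\mathrm{Ind}(\mathbf{M})/_{\sim}$. A coideal is a subset $Q$ such that $q\in Q$ and $q'\geq q$ imply $q'\in Q$. Subquotients. For a coideal $Q$, $\mathbf{M}_Q(\mathtt{i})$ is the additive closure in $\mathbf{M}(\mathtt{i})$ of the indecomposables whose class is in $Q$; $\mathbf{M}_Q$ is a $2$-representation by restriction.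 For coideals $Q\subset R$, $\mathbf{M}_{R/Q}(\mathtt{i})$ is the quotient of $\mathbf{M}_R(\mathtt{i})$ by the ideal generated by the identities of objects of $\mathbf{M}_Q(\mathtt{i})$; $\mathbf{M}_{R/Q}$ is the induced $2$-representation, which is transitive if $|R\setminus Q|=1$. A complete filtration is a chain of coideals $\varnothing=Q_0\subsetneq Q_1\subsetneq\dots\subsetneq Q_k=\mathrm{Ind}(\mathbf{M})/_{\sim}$ with $|Q_i\setminus Q_{i-1}|=1$ for all $i$. Its associated sequence of simple transitive subquotients is $\underline{\mathbf{M}}_{Q_1},\underline{\mathbf{M}}_{Q_2/Q_1},\dots,\underline{\mathbf{M}}_{Q_k/Q_{k-1}}$, where $\underline{\mathbf{M}}_{Q_i/Q_{i-1}}$ is the simple transitive quotient of $\mathbf{M}_{Q_i/Q_{i-1}}$. *)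

theory Defs
  imports "HOL-Computational_Algebra.Polynomial"
begin

section \<open>Linear categories\<close>

text \<open>
  A small category enriched in vector spaces over a field: \<open>cmp g f\<close>, written
  \<open>g \<cdot> f\<close>, is the composite of first \<open>f\<close> and then \<open>g\<close>. Only the values on objects in \<open>Ob\<close>
  and on morphisms between them are meaningful.
\<close>

record ('o, 'm, 'k) lincat =
  Ob :: "'o set"
  hom :: "'o \<Rightarrow> 'o \<Rightarrow> 'm set"
  idm :: "'o \<Rightarrow> 'm"
  cmp :: "'m \<Rightarrow> 'm \<Rightarrow> 'm"  (infixl "\<cdot>\<index>" 70)
  plus_mor :: "'m \<Rightarrow> 'm \<Rightarrow> 'm"  (infixl "\<boxplus>\<index>" 65)
  zero_mor :: "'o \<Rightarrow> 'o \<Rightarrow> 'm"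
  scale_mor :: "'k \<Rightarrow> 'm \<Rightarrow> 'm"  (infixr "\<odot>\<index>" 75)

definition arrows :: "('o, 'm, 'k) lincat \<Rightarrow> 'm set" where
  "arrows A = (\<Union>X\<in>Ob A. \<Union>Y\<in>Ob A. hom A X Y)"

locale linear_category =
  fixes A :: "('o, 'm, 'k::field) lincat" (structure)
  assumes hom_disjoint:
      "\<lbrakk>X \<in> Ob A; Y \<in> Ob A; X' \<in> Ob A; Y' \<in> Ob A; f \<in> hom A X Y; f \<in> hom A X' Y'\<rbrakk>
        \<Longrightarrow> X = X' \<and> Y = Y'"
    and idm_in_hom: "X \<in> Ob A \<Longrightarrow> idm A X \<in> hom A X X"
    and cmp_in_hom:
      "\<lbrakk>X \<in> Ob A; Y \<in> Ob A; Z \<in> Ob A; f \<in> hom A X Y; g \<in> hom A Y Z\<rbrakk> \<Longrightarrow> g \<cdot> f \<in> hom A X Z"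
    and cmp_assoc:
      "\<lbrakk>W \<in> Ob A; X \<in> Ob A; Y \<in> Ob A; Z \<in> Ob A; f \<in> hom A W X; g \<in> hom A X Y; h \<in> hom A Y Z\<rbrakk>
        \<Longrightarrow> (h \<cdot> g) \<cdot> f = h \<cdot> (g \<cdot> f)"
    and cmp_idm_left: "\<lbrakk>X \<in> Ob A; Y \<in> Ob A; f \<in> hom A X Y\<rbrakk> \<Longrightarrow> idm A Y \<cdot> f = f"
    and cmp_idm_right: "\<lbrakk>X \<in> Ob A; Y \<in> Ob A; f \<in> hom A X Y\<rbrakk> \<Longrightarrow> f \<cdot> idm A X = f"
    and zero_in_hom: "\<lbrakk>X \<in> Ob A; Y \<in> Ob A\<rbrakk> \<Longrightarrow> zero_mor A X Y \<in> hom A X Y"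
    and plus_in_hom:
      "\<lbrakk>X \<in> Ob A; Y \<in> Ob A; f \<in> hom A X Y; g \<in> hom A X Y\<rbrakk> \<Longrightarrow> f \<boxplus> g \<in> hom A X Y"
    and plus_assoc:
      "\<lbrakk>X \<in> Ob A; Y \<in> Ob A; f \<in> hom A X Y; g \<in> hom A X Y; h \<in> hom A X Y\<rbrakk>
        \<Longrightarrow> (f \<boxplus> g) \<boxplus> h = f \<boxplus> (g \<boxplus> h)"
    and plus_commute:
      "\<lbrakk>X \<in> Ob A; Y \<in> Ob A; f \<in> hom A X Y; g \<in> hom A X Y\<rbrakk> \<Longrightarrow> f \<boxplus> g = g \<boxplus> f"
    and plus_zero: "\<lbrakk>X \<in> Ob A; Y \<in> Ob A; f \<in> hom A X Y\<rbrakk> \<Longrightarrow> f \<boxplus> zero_mor A X Y = f"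
    and plus_inverse:
      "\<lbrakk>X \<in> Ob A; Y \<in> Ob A; f \<in> hom A X Y\<rbrakk> \<Longrightarrow> \<exists>g\<in>hom A X Y. f \<boxplus> g = zero_mor A X Y"
    and scale_in_hom: "\<lbrakk>X \<in> Ob A; Y \<in> Ob A; f \<in> hom A X Y\<rbrakk> \<Longrightarrow> c \<odot> f \<in> hom A X Y"
    and scale_plus:
      "\<lbrakk>X \<in> Ob A; Y \<in> Ob A; f \<in> hom A X Y; g \<in> hom A X Y\<rbrakk>
        \<Longrightarrow> c \<odot> (f \<boxplus> g) = c \<odot> f \<boxplus> c \<odot> g"
    and plus_scale:
      "\<lbrakk>X \<in> Ob A; Y \<in> Ob A; f \<in> hom A X Y\<rbrakk> \<Longrightarrow> (c + d) \<odot> f = c \<odot> f \<boxplus> d \<odot> f"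
    and scale_scale:
      "\<lbrakk>X \<in> Ob A; Y \<in> Ob A; f \<in> hom A X Y\<rbrakk> \<Longrightarrow> c \<odot> (d \<odot> f) = (c * d) \<odot> f"
    and scale_one: "\<lbrakk>X \<in> Ob A; Y \<in> Ob A; f \<in> hom A X Y\<rbrakk> \<Longrightarrow> 1 \<odot> f = f"
    and cmp_plus_left:
      "\<lbrakk>X \<in> Ob A; Y \<in> Ob A; Z \<in> Ob A; f \<in> hom A X Y; g \<in> hom A Y Z; g' \<in> hom A Y Z\<rbrakk>
        \<Longrightarrow> (g \<boxplus> g') \<cdot> f = (g \<cdot> f) \<boxplus> (g' \<cdot> f)"
    and cmp_plus_right:
      "\<lbrakk>X \<in> Ob A; Y \<in> Ob A; Z \<in> Ob A; f \<in> hom A X Y; f' \<in> hom A X Y; g \<in> hom A Y Z\<rbrakk>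
        \<Longrightarrow> g \<cdot> (f \<boxplus> f') = (g \<cdot> f) \<boxplus> (g \<cdot> f')"
    and cmp_scale_left:
      "\<lbrakk>X \<in> Ob A; Y \<in> Ob A; Z \<in> Ob A; f \<in> hom A X Y; g \<in> hom A Y Z\<rbrakk>
        \<Longrightarrow> (c \<odot> g) \<cdot> f = c \<odot> (g \<cdot> f)"
    and cmp_scale_right:
      "\<lbrakk>X \<in> Ob A; Y \<in> Ob A; Z \<in> Ob A; f \<in> hom A X Y; g \<in> hom A Y Z\<rbrakk>
        \<Longrightarrow> g \<cdot> (c \<odot> f) = c \<odot> (g \<cdot> f)"

definition zero_object :: "('o, 'm, 'k) lincat \<Rightarrow> 'o \<Rightarrow> bool" where
  "zero_object A Z \<longleftrightarrow>
    Z \<in> Ob A \<and> (\<forall>X\<in>Ob A. (\<exists>!f. f \<in> hom A X Z) \<and> (\<exists>!f. f \<in> hom A Z X))"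

definition is_iso :: "('o, 'm, 'k) lincat \<Rightarrow> 'o \<Rightarrow> 'o \<Rightarrow> 'm \<Rightarrow> bool" where
  "is_iso A X Y f \<longleftrightarrow>
    f \<in> hom A X Y \<and> (\<exists>g\<in>hom A Y X. g \<cdot>\<^bsub>A\<^esub> f = idm A X \<and> f \<cdot>\<^bsub>A\<^esub> g = idm A Y)"

definition isomorphic :: "('o, 'm, 'k) lincat \<Rightarrow> 'o \<Rightarrow> 'o \<Rightarrow> bool" where
  "isomorphic A X Y \<longleftrightarrow> X \<in> Ob A \<and> Y \<in> Ob A \<and> (\<exists>f. is_iso A X Y f)"

text \<open>\<open>biproduct A W X Y\<close>: the object \<open>W\<close> is a direct sum of \<open>X\<close> and \<open>Y\<close>.\<close>

definition biproduct :: "('o, 'm, 'k) lincat \<Rightarrow> 'o \<Rightarrow> 'o \<Rightarrow> 'o \<Rightarrow> bool" where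
  "biproduct A W X Y \<longleftrightarrow> W \<in> Ob A \<and> X \<in> Ob A \<and> Y \<in> Ob A \<and>
    (\<exists>i1\<in>hom A X W. \<exists>i2\<in>hom A Y W. \<exists>p1\<in>hom A W X. \<exists>p2\<in>hom A W Y.
      p1 \<cdot>\<^bsub>A\<^esub> i1 = idm A X \<and> p2 \<cdot>\<^bsub>A\<^esub> i2 = idm A Y \<and>
      p1 \<cdot>\<^bsub>A\<^esub> i2 = zero_mor A Y X \<and> p2 \<cdot>\<^bsub>A\<^esub> i1 = zero_mor A X Y \<and>
      (i1 \<cdot>\<^bsub>A\<^esub> p1) \<boxplus>\<^bsub>A\<^esub> (i2 \<cdot>\<^bsub>A\<^esub> p2) = idm A W)"

text \<open>
  Since \<open>biproduct\<close> leaves the injections and projections free, the next predicate already says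
  that \<open>X\<close> is isomorphic to a direct summand of \<open>W\<close>.
\<close>

definition direct_summand :: "('o, 'm, 'k) lincat \<Rightarrow> 'o \<Rightarrow> 'o \<Rightarrow> bool" where
  "direct_summand A X W \<longleftrightarrow> (\<exists>Y. biproduct A W X Y)"

primrec finite_direct_sum :: "('o, 'm, 'k) lincat \<Rightarrow> 'o \<Rightarrow> 'o list \<Rightarrow> bool" where
  "finite_direct_sum A W [] \<longleftrightarrow> zero_object A W"
| "finite_direct_sum A W (X # Xs) \<longleftrightarrow> (\<exists>V. biproduct A W X V \<and> finite_direct_sum A V Xs)"

definition additive_closure :: "('o, 'm, 'k) lincat \<Rightarrow> 'o set \<Rightarrow> 'o set" where
  "additive_closure A S =
    {X. \<exists>W Xs. set Xs \<subseteq> S \<and> finite_direct_sum A W Xs \<and> direct_summand A X W}"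

definition indecomposable :: "('o, 'm, 'k) lincat \<Rightarrow> 'o \<Rightarrow> bool" where
  "indecomposable A X \<longleftrightarrow> X \<in> Ob A \<and> \<not> zero_object A X \<and>
    (\<forall>Y Z. biproduct A X Y Z \<longrightarrow> zero_object A Y \<or> zero_object A Z)"

definition indec_iso_rel :: "('o, 'm, 'k) lincat \<Rightarrow> ('o \<times> 'o) set" where
  "indec_iso_rel A = {(X, Y). indecomposable A X \<and> indecomposable A Y \<and> isomorphic A X Y}"

locale finitary_category = linear_category +
  assumes zero_object_exists: "\<exists>Z. zero_object A Z"
    and biproduct_exists: "\<lbrakk>X \<in> Ob A; Y \<in> Ob A\<rbrakk> \<Longrightarrow> \<exists>W. biproduct A W X Y"
    and idempotents_split:
      "\<lbrakk>X \<in> Ob A; e \<in> hom A X X; e \<cdot> e = e\<rbrakk>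
        \<Longrightarrow> \<exists>Y\<in>Ob A. \<exists>r\<in>hom A X Y. \<exists>s\<in>hom A Y X. s \<cdot> r = e \<and> r \<cdot> s = idm A Y"
    and finitely_many_indecomposables:
      "finite ({X. indecomposable A X} // indec_iso_rel A)"
    and hom_finite_dim:
      "\<lbrakk>X \<in> Ob A; Y \<in> Ob A\<rbrakk>
        \<Longrightarrow> \<exists>bs. set bs \<subseteq> hom A X Y \<and>
              (\<forall>f\<in>hom A X Y. \<exists>c. f = foldr (\<lambda>b g. c b \<odot> b \<boxplus> g) bs (zero_mor A X Y))"

text \<open>
  Functors are given by their object and morphism maps. Preservation of direct sums is automatic
  for a functor that is linear on morphism spaces.
\<close>

definition linear_functor ::
  "('o, 'm, 'k) lincat \<Rightarrow> ('p, 'n, 'k) lincat \<Rightarrow> ('o \<Rightarrow> 'p) \<Rightarrow> ('m \<Rightarrow> 'n) \<Rightarrow> bool" where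
  "linear_functor A B Fo Fm \<longleftrightarrow>
    (\<forall>X\<in>Ob A. Fo X \<in> Ob B) \<and>
    (\<forall>X\<in>Ob A. \<forall>Y\<in>Ob A. \<forall>f\<in>hom A X Y. Fm f \<in> hom B (Fo X) (Fo Y)) \<and>
    (\<forall>X\<in>Ob A. Fm (idm A X) = idm B (Fo X)) \<and>
    (\<forall>X\<in>Ob A. \<forall>Y\<in>Ob A. \<forall>Z\<in>Ob A. \<forall>f\<in>hom A X Y. \<forall>g\<in>hom A Y Z.
      Fm (g \<cdot>\<^bsub>A\<^esub> f) = Fm g \<cdot>\<^bsub>B\<^esub> Fm f) \<and>
    (\<forall>X\<in>Ob A. \<forall>Y\<in>Ob A. \<forall>f\<in>hom A X Y. \<forall>g\<in>hom A X Y.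
      Fm (f \<boxplus>\<^bsub>A\<^esub> g) = Fm f \<boxplus>\<^bsub>B\<^esub> Fm g) \<and>
    (\<forall>X\<in>Ob A. \<forall>Y\<in>Ob A. \<forall>f\<in>hom A X Y. \<forall>c. Fm (c \<odot>\<^bsub>A\<^esub> f) = c \<odot>\<^bsub>B\<^esub> Fm f)"

definition nat_transformation ::
  "('o, 'm, 'k) lincat \<Rightarrow> ('p, 'n, 'k) lincat \<Rightarrow> ('o \<Rightarrow> 'p) \<Rightarrow> ('m \<Rightarrow> 'n) \<Rightarrow>
    ('o \<Rightarrow> 'p) \<Rightarrow> ('m \<Rightarrow> 'n) \<Rightarrow> ('o \<Rightarrow> 'n) \<Rightarrow> bool" where
  "nat_transformation A B Fo Fm Go Gm t \<longleftrightarrow>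
    (\<forall>X\<in>Ob A. t X \<in> hom B (Fo X) (Go X)) \<and>
    (\<forall>X\<in>Ob A. \<forall>Y\<in>Ob A. \<forall>f\<in>hom A X Y. t Y \<cdot>\<^bsub>B\<^esub> Fm f = Gm f \<cdot>\<^bsub>B\<^esub> t X)"

definition nat_isomorphism ::
  "('o, 'm, 'k) lincat \<Rightarrow> ('p, 'n, 'k) lincat \<Rightarrow> ('o \<Rightarrow> 'p) \<Rightarrow> ('m \<Rightarrow> 'n) \<Rightarrow>
    ('o \<Rightarrow> 'p) \<Rightarrow> ('m \<Rightarrow> 'n) \<Rightarrow> ('o \<Rightarrow> 'n) \<Rightarrow> bool" where
  "nat_isomorphism A B Fo Fm Go Gm t \<longleftrightarrow>
    nat_transformation A B Fo Fm Go Gm t \<and> (\<forall>X\<in>Ob A. is_iso B (Fo X) (Go X) (t X))"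

definition category_equivalence ::
  "('o, 'm, 'k) lincat \<Rightarrow> ('p, 'n, 'k) lincat \<Rightarrow> ('o \<Rightarrow> 'p) \<Rightarrow> ('m \<Rightarrow> 'n) \<Rightarrow> bool" where
  "category_equivalence A B Fo Fm \<longleftrightarrow>
    linear_functor A B Fo Fm \<and>
    (\<exists>Go Gm s t. linear_functor B A Go Gm \<and>
      nat_isomorphism A A (Go \<circ> Fo) (Gm \<circ> Fm) id id s \<and>
      nat_isomorphism B B (Fo \<circ> Go) (Fm \<circ> Gm) id id t)"

definition cat_ideal :: "('o, 'm, 'k) lincat \<Rightarrow> 'm set \<Rightarrow> bool" where
  "cat_ideal A I \<longleftrightarrow>
    I \<subseteq> arrows A \<and>
    (\<forall>X\<in>Ob A. \<forall>Y\<in>Ob A. zero_mor A X Y \<in> I) \<and>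
    (\<forall>X\<in>Ob A. \<forall>Y\<in>Ob A. \<forall>f\<in>hom A X Y \<inter> I. \<forall>g\<in>hom A X Y \<inter> I. f \<boxplus>\<^bsub>A\<^esub> g \<in> I) \<and>
    (\<forall>f\<in>I. \<forall>c. c \<odot>\<^bsub>A\<^esub> f \<in> I) \<and>
    (\<forall>X\<in>Ob A. \<forall>Y\<in>Ob A. \<forall>Z\<in>Ob A. \<forall>f\<in>hom A X Y. \<forall>g\<in>hom A Y Z.
      f \<in> I \<or> g \<in> I \<longrightarrow> g \<cdot>\<^bsub>A\<^esub> f \<in> I)"

definition generated_ideal :: "('o, 'm, 'k) lincat \<Rightarrow> 'm set \<Rightarrow> 'm set" where
  "generated_ideal A S = \<Inter>{I. cat_ideal A I \<and> S \<subseteq> I}"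

text \<open>The residue class \<open>f + I\<close> of a morphism, taken inside the morphism space that contains \<open>f\<close>.\<close>

definition coset :: "('o, 'm, 'k) lincat \<Rightarrow> 'm set \<Rightarrow> 'm \<Rightarrow> 'm set" where
  "coset A I f = {g. \<exists>X\<in>Ob A. \<exists>Y\<in>Ob A. f \<in> hom A X Y \<and> (\<exists>h\<in>hom A X Y \<inter> I. g = f \<boxplus>\<^bsub>A\<^esub> h)}"

text \<open>
  Morphisms of the quotient category are residue classes. The unions below run over representatives
  of the arguments; all of them give the same class.
\<close>

definition quotient_cat :: "('o, 'm, 'k) lincat \<Rightarrow> 'm set \<Rightarrow> ('o, 'm set, 'k) lincat" where
  "quotient_cat A I = \<lparr>
    Ob = Ob A,
    hom = (\<lambda>X Y. coset A I ` hom A X Y),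
    idm = (\<lambda>X. coset A I (idm A X)),
    cmp = (\<lambda>S T. \<Union>g\<in>S. \<Union>f\<in>T. coset A I (g \<cdot>\<^bsub>A\<^esub> f)),
    plus_mor = (\<lambda>S T. \<Union>f\<in>S. \<Union>g\<in>T. coset A I (f \<boxplus>\<^bsub>A\<^esub> g)),
    zero_mor = (\<lambda>X Y. coset A I (zero_mor A X Y)),
    scale_mor = (\<lambda>c S. \<Union>f\<in>S. coset A I (c \<odot>\<^bsub>A\<^esub> f)) \<rparr>"

definition full_subcat :: "('o, 'm, 'k) lincat \<Rightarrow> 'o set \<Rightarrow> ('o, 'm, 'k) lincat" where
  "full_subcat A S = A\<lparr>Ob := Ob A \<inter> S\<rparr>"


section \<open>Finitary 2-categories\<close>

text \<open>
  \<open>Hom i j\<close> is the category of 1-morphisms from \<open>i\<close> to \<open>j\<close> (its objects) and of 2-morphisms between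
  them (its morphisms, with vertical composition \<open>cmp\<close>). The composite of 1-morphisms
  \<open>F : i \<rightarrow> j\<close> and \<open>G : j \<rightarrow> k\<close> is \<open>comp1 G F\<close>, and \<open>hcomp b a\<close> is the horizontal composite of the
  corresponding 2-morphisms.
\<close>

record ('i, 'f, 'a, 'k) two_cat =
  Obj :: "'i set"
  Hom :: "'i \<Rightarrow> 'i \<Rightarrow> ('f, 'a, 'k) lincat"
  Id1 :: "'i \<Rightarrow> 'f"
  comp1 :: "'f \<Rightarrow> 'f \<Rightarrow> 'f"
  hcomp :: "'a \<Rightarrow> 'a \<Rightarrow> 'a"

definition mor1 :: "('i, 'f, 'a, 'k) two_cat \<Rightarrow> 'i \<Rightarrow> 'i \<Rightarrow> 'f set" where
  "mor1 C i j = Ob (Hom C i j)"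

definition mor2 :: "('i, 'f, 'a, 'k) two_cat \<Rightarrow> 'i \<Rightarrow> 'i \<Rightarrow> 'f \<Rightarrow> 'f \<Rightarrow> 'a set" where
  "mor2 C i j F G = hom (Hom C i j) F G"

locale finitary_2category =
  fixes C :: "('i, 'f, 'a, 'k::field) two_cat"
  assumes finite_Obj: "finite (Obj C)"
    and finitary_Hom: "\<lbrakk>i \<in> Obj C; j \<in> Obj C\<rbrakk> \<Longrightarrow> finitary_category (Hom C i j)"
    and mor1_disjoint:
      "\<lbrakk>i \<in> Obj C; j \<in> Obj C; i' \<in> Obj C; j' \<in> Obj C; F \<in> mor1 C i j; F \<in> mor1 C i' j'\<rbrakk>
        \<Longrightarrow> i = i' \<and> j = j'"
    and mor2_disjoint:
      "\<lbrakk>i \<in> Obj C; j \<in> Obj C; i' \<in> Obj C; j' \<in> Obj C;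
        a \<in> arrows (Hom C i j); a \<in> arrows (Hom C i' j')\<rbrakk> \<Longrightarrow> i = i' \<and> j = j'"
    and Id1_in: "i \<in> Obj C \<Longrightarrow> Id1 C i \<in> mor1 C i i"
    and Id1_indecomposable: "i \<in> Obj C \<Longrightarrow> indecomposable (Hom C i i) (Id1 C i)"
    and comp1_in:
      "\<lbrakk>i \<in> Obj C; j \<in> Obj C; k \<in> Obj C; F \<in> mor1 C i j; G \<in> mor1 C j k\<rbrakk>
        \<Longrightarrow> comp1 C G F \<in> mor1 C i k"
    and comp1_assoc:
      "\<lbrakk>i \<in> Obj C; j \<in> Obj C; k \<in> Obj C; l \<in> Obj C;
        F \<in> mor1 C i j; G \<in> mor1 C j k; H \<in> mor1 C k l\<rbrakk>
        \<Longrightarrow> comp1 C (comp1 C H G) F = comp1 C H (comp1 C G F)"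
    and comp1_Id1_left:
      "\<lbrakk>i \<in> Obj C; j \<in> Obj C; F \<in> mor1 C i j\<rbrakk> \<Longrightarrow> comp1 C (Id1 C j) F = F"
    and comp1_Id1_right:
      "\<lbrakk>i \<in> Obj C; j \<in> Obj C; F \<in> mor1 C i j\<rbrakk> \<Longrightarrow> comp1 C F (Id1 C i) = F"
    and hcomp_in:
      "\<lbrakk>i \<in> Obj C; j \<in> Obj C; k \<in> Obj C;
        F \<in> mor1 C i j; F' \<in> mor1 C i j; G \<in> mor1 C j k; G' \<in> mor1 C j k;
        a \<in> mor2 C i j F F'; b \<in> mor2 C j k G G'\<rbrakk>
        \<Longrightarrow> hcomp C b a \<in> mor2 C i k (comp1 C G F) (comp1 C G' F')"
    and hcomp_idm:
      "\<lbrakk>i \<in> Obj C; j \<in> Obj C; k \<in> Obj C; F \<in> mor1 C i j; G \<in> mor1 C j k\<rbrakk>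
        \<Longrightarrow> hcomp C (idm (Hom C j k) G) (idm (Hom C i j) F) = idm (Hom C i k) (comp1 C G F)"
    and interchange:
      "\<lbrakk>i \<in> Obj C; j \<in> Obj C; k \<in> Obj C;
        F \<in> mor1 C i j; F' \<in> mor1 C i j; F'' \<in> mor1 C i j;
        G \<in> mor1 C j k; G' \<in> mor1 C j k; G'' \<in> mor1 C j k;
        a \<in> mor2 C i j F F'; a' \<in> mor2 C i j F' F'';
        b \<in> mor2 C j k G G'; b' \<in> mor2 C j k G' G''\<rbrakk>
        \<Longrightarrow> hcomp C (b' \<cdot>\<^bsub>Hom C j k\<^esub> b) (a' \<cdot>\<^bsub>Hom C i j\<^esub> a)
              = hcomp C b' a' \<cdot>\<^bsub>Hom C i k\<^esub> hcomp C b a"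
    and hcomp_assoc:
      "\<lbrakk>i \<in> Obj C; j \<in> Obj C; k \<in> Obj C; l \<in> Obj C;
        a \<in> arrows (Hom C i j); b \<in> arrows (Hom C j k); d \<in> arrows (Hom C k l)\<rbrakk>
        \<Longrightarrow> hcomp C (hcomp C d b) a = hcomp C d (hcomp C b a)"
    and hcomp_Id1_left:
      "\<lbrakk>i \<in> Obj C; j \<in> Obj C; a \<in> arrows (Hom C i j)\<rbrakk>
        \<Longrightarrow> hcomp C (idm (Hom C j j) (Id1 C j)) a = a"
    and hcomp_Id1_right:
      "\<lbrakk>i \<in> Obj C; j \<in> Obj C; a \<in> arrows (Hom C i j)\<rbrakk>
        \<Longrightarrow> hcomp C a (idm (Hom C i i) (Id1 C i)) = a"
    and hcomp_plus_left:
      "\<lbrakk>i \<in> Obj C; j \<in> Obj C; k \<in> Obj C;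
        F \<in> mor1 C i j; F' \<in> mor1 C i j; G \<in> mor1 C j k; G' \<in> mor1 C j k;
        a \<in> mor2 C i j F F'; b \<in> mor2 C j k G G'; b' \<in> mor2 C j k G G'\<rbrakk>
        \<Longrightarrow> hcomp C (b \<boxplus>\<^bsub>Hom C j k\<^esub> b') a = hcomp C b a \<boxplus>\<^bsub>Hom C i k\<^esub> hcomp C b' a"
    and hcomp_plus_right:
      "\<lbrakk>i \<in> Obj C; j \<in> Obj C; k \<in> Obj C;
        F \<in> mor1 C i j; F' \<in> mor1 C i j; G \<in> mor1 C j k; G' \<in> mor1 C j k;
        a \<in> mor2 C i j F F'; a' \<in> mor2 C i j F F'; b \<in> mor2 C j k G G'\<rbrakk>
        \<Longrightarrow> hcomp C b (a \<boxplus>\<^bsub>Hom C i j\<^esub> a') = hcomp C b a \<boxplus>\<^bsub>Hom C i k\<^esub> hcomp C b a'"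
    and hcomp_scale_left:
      "\<lbrakk>i \<in> Obj C; j \<in> Obj C; k \<in> Obj C;
        a \<in> arrows (Hom C i j); b \<in> arrows (Hom C j k)\<rbrakk>
        \<Longrightarrow> hcomp C (c \<odot>\<^bsub>Hom C j k\<^esub> b) a = c \<odot>\<^bsub>Hom C i k\<^esub> hcomp C b a"
    and hcomp_scale_right:
      "\<lbrakk>i \<in> Obj C; j \<in> Obj C; k \<in> Obj C;
        a \<in> arrows (Hom C i j); b \<in> arrows (Hom C j k)\<rbrakk>
        \<Longrightarrow> hcomp C b (c \<odot>\<^bsub>Hom C i j\<^esub> a) = c \<odot>\<^bsub>Hom C i k\<^esub> hcomp C b a"


section \<open>Finitary 2-representations\<close>

text \<open>
  \<open>rcat M i\<close> is the category \<open>M(i)\<close>; \<open>robj M F\<close> and \<open>rmor M F\<close> are the object and morphism maps of the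
  functor \<open>M(F)\<close>; \<open>rnat M a X\<close> is the component at \<open>X\<close> of the natural transformation \<open>M(a)\<close>.
\<close>

record ('i, 'f, 'a, 'o, 'm, 'k) two_rep =
  rcat :: "'i \<Rightarrow> ('o, 'm, 'k) lincat"
  robj :: "'f \<Rightarrow> 'o \<Rightarrow> 'o"
  rmor :: "'f \<Rightarrow> 'm \<Rightarrow> 'm"
  rnat :: "'a \<Rightarrow> 'o \<Rightarrow> 'm"

locale finitary_2representation = finitary_2category C
  for C :: "('i, 'f, 'a, 'k::field) two_cat" +
  fixes M :: "('i, 'f, 'a, 'o, 'm, 'k) two_rep"
  assumes finitary_rcat: "i \<in> Obj C \<Longrightarrow> finitary_category (rcat M i)"
    and functor_rep:
      "\<lbrakk>i \<in> Obj C; j \<in> Obj C; F \<in> mor1 C i j\<rbrakk>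
        \<Longrightarrow> linear_functor (rcat M i) (rcat M j) (robj M F) (rmor M F)"
    and nat_rep:
      "\<lbrakk>i \<in> Obj C; j \<in> Obj C; F \<in> mor1 C i j; G \<in> mor1 C i j; a \<in> mor2 C i j F G\<rbrakk>
        \<Longrightarrow> nat_transformation (rcat M i) (rcat M j)
              (robj M F) (rmor M F) (robj M G) (rmor M G) (rnat M a)"
    and robj_Id1: "\<lbrakk>i \<in> Obj C; X \<in> Ob (rcat M i)\<rbrakk> \<Longrightarrow> robj M (Id1 C i) X = X"
    and rmor_Id1: "\<lbrakk>i \<in> Obj C; f \<in> arrows (rcat M i)\<rbrakk> \<Longrightarrow> rmor M (Id1 C i) f = f"
    and robj_comp1:
      "\<lbrakk>i \<in> Obj C; j \<in> Obj C; k \<in> Obj C; F \<in> mor1 C i j; G \<in> mor1 C j k; X \<in> Ob (rcat M i)\<rbrakk>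
        \<Longrightarrow> robj M (comp1 C G F) X = robj M G (robj M F X)"
    and rmor_comp1:
      "\<lbrakk>i \<in> Obj C; j \<in> Obj C; k \<in> Obj C; F \<in> mor1 C i j; G \<in> mor1 C j k; f \<in> arrows (rcat M i)\<rbrakk>
        \<Longrightarrow> rmor M (comp1 C G F) f = rmor M G (rmor M F f)"
    and rnat_idm:
      "\<lbrakk>i \<in> Obj C; j \<in> Obj C; F \<in> mor1 C i j; X \<in> Ob (rcat M i)\<rbrakk>
        \<Longrightarrow> rnat M (idm (Hom C i j) F) X = idm (rcat M j) (robj M F X)"
    and rnat_cmp:
      "\<lbrakk>i \<in> Obj C; j \<in> Obj C; F \<in> mor1 C i j; G \<in> mor1 C i j; H \<in> mor1 C i j;
        a \<in> mor2 C i j F G; b \<in> mor2 C i j G H; X \<in> Ob (rcat M i)\<rbrakk>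
        \<Longrightarrow> rnat M (b \<cdot>\<^bsub>Hom C i j\<^esub> a) X = rnat M b X \<cdot>\<^bsub>rcat M j\<^esub> rnat M a X"
    and rnat_hcomp:
      "\<lbrakk>i \<in> Obj C; j \<in> Obj C; k \<in> Obj C;
        F \<in> mor1 C i j; F' \<in> mor1 C i j; G \<in> mor1 C j k; G' \<in> mor1 C j k;
        a \<in> mor2 C i j F F'; b \<in> mor2 C j k G G'; X \<in> Ob (rcat M i)\<rbrakk>
        \<Longrightarrow> rnat M (hcomp C b a) X
              = rnat M b (robj M F' X) \<cdot>\<^bsub>rcat M k\<^esub> rmor M G (rnat M a X)"
    and rnat_plus:
      "\<lbrakk>i \<in> Obj C; j \<in> Obj C; F \<in> mor1 C i j; G \<in> mor1 C i j;
        a \<in> mor2 C i j F G; b \<in> mor2 C i j F G; X \<in> Ob (rcat M i)\<rbrakk>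
        \<Longrightarrow> rnat M (a \<boxplus>\<^bsub>Hom C i j\<^esub> b) X = rnat M a X \<boxplus>\<^bsub>rcat M j\<^esub> rnat M b X"
    and rnat_scale:
      "\<lbrakk>i \<in> Obj C; j \<in> Obj C; F \<in> mor1 C i j; G \<in> mor1 C i j;
        a \<in> mor2 C i j F G; X \<in> Ob (rcat M i)\<rbrakk>
        \<Longrightarrow> rnat M (c \<odot>\<^bsub>Hom C i j\<^esub> a) X = c \<odot>\<^bsub>rcat M j\<^esub> rnat M a X"

text \<open>
  A 2-natural transformation consists of functors \<open>Po i\<close>, \<open>Pm i\<close> and of isomorphisms
  \<open>e F X : \<Phi>\<^sub>j (M(F) X) \<rightarrow> N(F) (\<Phi>\<^sub>i X)\<close>. Compatibility with \<open>Id1 i = comp1 (Id1 i) (Id1 i)\<close> forces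
  the components at \<open>Id1 i\<close> to be identities, so no separate unit condition is needed.
\<close>

definition two_nat_transformation ::
  "('i, 'f, 'a, 'k) two_cat \<Rightarrow> ('i, 'f, 'a, 'o, 'm, 'k) two_rep \<Rightarrow> ('i, 'f, 'a, 'p, 'n, 'k) two_rep \<Rightarrow>
    ('i \<Rightarrow> 'o \<Rightarrow> 'p) \<Rightarrow> ('i \<Rightarrow> 'm \<Rightarrow> 'n) \<Rightarrow> ('f \<Rightarrow> 'o \<Rightarrow> 'n) \<Rightarrow> bool" where
  "two_nat_transformation C M N Po Pm e \<longleftrightarrow>
    (\<forall>i\<in>Obj C. linear_functor (rcat M i) (rcat N i) (Po i) (Pm i)) \<and>
    (\<forall>i\<in>Obj C. \<forall>j\<in>Obj C. \<forall>F\<in>mor1 C i j.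
      nat_isomorphism (rcat M i) (rcat N j)
        (Po j \<circ> robj M F) (Pm j \<circ> rmor M F) (robj N F \<circ> Po i) (rmor N F \<circ> Pm i) (e F)) \<and>
    (\<forall>i\<in>Obj C. \<forall>j\<in>Obj C. \<forall>F\<in>mor1 C i j. \<forall>G\<in>mor1 C i j. \<forall>a\<in>mor2 C i j F G.
      \<forall>X\<in>Ob (rcat M i).
        rnat N a (Po i X) \<cdot>\<^bsub>rcat N j\<^esub> e F X = e G X \<cdot>\<^bsub>rcat N j\<^esub> Pm j (rnat M a X)) \<and>
    (\<forall>i\<in>Obj C. \<forall>j\<in>Obj C. \<forall>k\<in>Obj C. \<forall>F\<in>mor1 C i j. \<forall>G\<in>mor1 C j k. \<forall>X\<in>Ob (rcat M i).
        e (comp1 C G F) X = rmor N G (e F X) \<cdot>\<^bsub>rcat N k\<^esub> e G (robj M F X))"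

definition equivalent_2rep ::
  "('i, 'f, 'a, 'k) two_cat \<Rightarrow> ('i, 'f, 'a, 'o, 'm, 'k) two_rep \<Rightarrow> ('i, 'f, 'a, 'p, 'n, 'k) two_rep \<Rightarrow>
    bool" where
  "equivalent_2rep C M N \<longleftrightarrow>
    (\<exists>Po Pm e. two_nat_transformation C M N Po Pm e \<and>
      (\<forall>i\<in>Obj C. category_equivalence (rcat M i) (rcat N i) (Po i) (Pm i)))"


section \<open>Ideals, quotients and simple transitive quotients\<close>

text \<open>
  Families of ideals are normalised to be empty outside \<open>Obj C\<close>, so that two of them are equal
  precisely if they agree on the objects of the 2-category.
\<close>

definition rep_ideal ::
  "('i, 'f, 'a, 'k) two_cat \<Rightarrow> ('i, 'f, 'a, 'o, 'm, 'k) two_rep \<Rightarrow> ('i \<Rightarrow> 'm set) \<Rightarrow> bool" where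
  "rep_ideal C M I \<longleftrightarrow>
    (\<forall>i. i \<notin> Obj C \<longrightarrow> I i = {}) \<and>
    (\<forall>i\<in>Obj C. cat_ideal (rcat M i) (I i)) \<and>
    (\<forall>i\<in>Obj C. \<forall>j\<in>Obj C. \<forall>F\<in>mor1 C i j. \<forall>f\<in>I i. rmor M F f \<in> I j)"

definition identity_free ::
  "('i, 'f, 'a, 'k) two_cat \<Rightarrow> ('i, 'f, 'a, 'o, 'm, 'k) two_rep \<Rightarrow> ('i \<Rightarrow> 'm set) \<Rightarrow> bool" where
  "identity_free C M I \<longleftrightarrow>
    (\<forall>i\<in>Obj C. \<forall>X\<in>Ob (rcat M i). idm (rcat M i) X \<in> I i \<longrightarrow> zero_object (rcat M i) X)"

definition maximal_ideal ::
  "('i, 'f, 'a, 'k) two_cat \<Rightarrow> ('i, 'f, 'a, 'o, 'm, 'k) two_rep \<Rightarrow> 'i \<Rightarrow> 'm set" where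
  "maximal_ideal C M =
    (THE I. rep_ideal C M I \<and> identity_free C M I \<and>
      (\<forall>J. rep_ideal C M J \<and> identity_free C M J \<and> (\<forall>i\<in>Obj C. I i \<subseteq> J i) \<longrightarrow> J = I))"

definition tgt1 :: "('i, 'f, 'a, 'k) two_cat \<Rightarrow> 'f \<Rightarrow> 'i" where
  "tgt1 C F = (THE j. j \<in> Obj C \<and> (\<exists>i\<in>Obj C. F \<in> mor1 C i j))"

definition tgt2 :: "('i, 'f, 'a, 'k) two_cat \<Rightarrow> 'a \<Rightarrow> 'i" where
  "tgt2 C a = (THE j. j \<in> Obj C \<and> (\<exists>i\<in>Obj C. a \<in> arrows (Hom C i j)))"

definition quotient_rep ::
  "('i, 'f, 'a, 'k) two_cat \<Rightarrow> ('i, 'f, 'a, 'o, 'm, 'k) two_rep \<Rightarrow> ('i \<Rightarrow> 'm set) \<Rightarrow>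
    ('i, 'f, 'a, 'o, 'm set, 'k) two_rep" where
  "quotient_rep C M I = \<lparr>
    rcat = (\<lambda>i. quotient_cat (rcat M i) (I i)),
    robj = robj M,
    rmor = (\<lambda>F S. \<Union>f\<in>S. coset (rcat M (tgt1 C F)) (I (tgt1 C F)) (rmor M F f)),
    rnat = (\<lambda>a X. coset (rcat M (tgt2 C a)) (I (tgt2 C a)) (rnat M a X)) \<rparr>"

definition simple_transitive_quotient ::
  "('i, 'f, 'a, 'k) two_cat \<Rightarrow> ('i, 'f, 'a, 'o, 'm, 'k) two_rep \<Rightarrow>
    ('i, 'f, 'a, 'o, 'm set, 'k) two_rep" where
  "simple_transitive_quotient C M = quotient_rep C M (maximal_ideal C M)"


section \<open>The action preorder, coideals and subquotients\<close>

definition indec_objects ::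
  "('i, 'f, 'a, 'k) two_cat \<Rightarrow> ('i, 'f, 'a, 'o, 'm, 'k) two_rep \<Rightarrow> ('i \<times> 'o) set" where
  "indec_objects C M = {(i, X). i \<in> Obj C \<and> indecomposable (rcat M i) X}"

definition iso_rel ::
  "('i, 'f, 'a, 'k) two_cat \<Rightarrow> ('i, 'f, 'a, 'o, 'm, 'k) two_rep \<Rightarrow> (('i \<times> 'o) \<times> ('i \<times> 'o)) set" where
  "iso_rel C M = {((i, X), (j, Y)).
    (i, X) \<in> indec_objects C M \<and> (j, Y) \<in> indec_objects C M \<and> i = j \<and> isomorphic (rcat M i) X Y}"

definition Ind ::
  "('i, 'f, 'a, 'k) two_cat \<Rightarrow> ('i, 'f, 'a, 'o, 'm, 'k) two_rep \<Rightarrow> ('i \<times> 'o) set set" where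
  "Ind C M = indec_objects C M // iso_rel C M"

text \<open>\<open>action_ge C M x y\<close> is the relation \<open>x \<ge> y\<close> on isomorphism classes of indecomposables.\<close>

definition action_ge ::
  "('i, 'f, 'a, 'k) two_cat \<Rightarrow> ('i, 'f, 'a, 'o, 'm, 'k) two_rep \<Rightarrow> ('i \<times> 'o) set \<Rightarrow> ('i \<times> 'o) set \<Rightarrow>
    bool" where
  "action_ge C M x y \<longleftrightarrow>
    (\<exists>(i, X)\<in>x. \<exists>(j, Y)\<in>y. \<exists>F\<in>mor1 C j i. direct_summand (rcat M i) X (robj M F Y))"

definition action_equiv ::
  "('i, 'f, 'a, 'k) two_cat \<Rightarrow> ('i, 'f, 'a, 'o, 'm, 'k) two_rep \<Rightarrow>
    (('i \<times> 'o) set \<times> ('i \<times> 'o) set) set" where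
  "action_equiv C M =
    {(x, y). x \<in> Ind C M \<and> y \<in> Ind C M \<and> action_ge C M x y \<and> action_ge C M y x}"

definition Ind_classes ::
  "('i, 'f, 'a, 'k) two_cat \<Rightarrow> ('i, 'f, 'a, 'o, 'm, 'k) two_rep \<Rightarrow> ('i \<times> 'o) set set set" where
  "Ind_classes C M = Ind C M // action_equiv C M"

definition class_ge ::
  "('i, 'f, 'a, 'k) two_cat \<Rightarrow> ('i, 'f, 'a, 'o, 'm, 'k) two_rep \<Rightarrow>
    ('i \<times> 'o) set set \<Rightarrow> ('i \<times> 'o) set set \<Rightarrow> bool" where
  "class_ge C M p q \<longleftrightarrow> (\<exists>x\<in>p. \<exists>y\<in>q. action_ge C M x y)"

definition coideal ::
  "('i, 'f, 'a, 'k) two_cat \<Rightarrow> ('i, 'f, 'a, 'o, 'm, 'k) two_rep \<Rightarrow> ('i \<times> 'o) set set set \<Rightarrow> bool" where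
  "coideal C M Q \<longleftrightarrow>
    Q \<subseteq> Ind_classes C M \<and> (\<forall>q\<in>Q. \<forall>q'\<in>Ind_classes C M. class_ge C M q' q \<longrightarrow> q' \<in> Q)"

definition sub_rep ::
  "('i, 'f, 'a, 'o, 'm, 'k) two_rep \<Rightarrow> ('i \<times> 'o) set set set \<Rightarrow> ('i, 'f, 'a, 'o, 'm, 'k) two_rep" where
  "sub_rep M Q = M\<lparr>rcat := \<lambda>i.
    full_subcat (rcat M i) (additive_closure (rcat M i) {X. (i, X) \<in> \<Union>(\<Union>Q)})\<rparr>"

text \<open>\<open>subquotient C M R Q\<close> is \<open>M\<^bsub>R/Q\<^esub>\<close>, for coideals \<open>Q \<subseteq> R\<close>.\<close>

definition subquotient ::
  "('i, 'f, 'a, 'k) two_cat \<Rightarrow> ('i, 'f, 'a, 'o, 'm, 'k) two_rep \<Rightarrow>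
    ('i \<times> 'o) set set set \<Rightarrow> ('i \<times> 'o) set set set \<Rightarrow> ('i, 'f, 'a, 'o, 'm set, 'k) two_rep" where
  "subquotient C M R Q = quotient_rep C (sub_rep M R)
    (\<lambda>i. generated_ideal (rcat (sub_rep M R) i) (idm (rcat M i) ` Ob (rcat (sub_rep M Q) i)))"

text \<open>The chain \<open>Q 0 \<subset> Q 1 \<subset> \<dots> \<subset> Q k\<close>; values of \<open>Q\<close> beyond \<open>k\<close> are irrelevant.\<close>

definition complete_filtration ::
  "('i, 'f, 'a, 'k) two_cat \<Rightarrow> ('i, 'f, 'a, 'o, 'm, 'k) two_rep \<Rightarrow> nat \<Rightarrow>
    (nat \<Rightarrow> ('i \<times> 'o) set set set) \<Rightarrow> bool" where
  "complete_filtration C M k Q \<longleftrightarrow>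
    Q 0 = {} \<and> Q k = Ind_classes C M \<and>
    (\<forall>i\<le>k. coideal C M (Q i)) \<and>
    (\<forall>i\<in>{1..k}. Q (i - 1) \<subset> Q i \<and> card (Q i - Q (i - 1)) = 1)"

text \<open>
  The \<open>i\<close>-th simple transitive subquotient, for \<open>i \<ge> 1\<close>. For \<open>i = 1\<close> the ideal that is factored out
  of \<open>M\<^bsub>Q 1\<^esub>\<close> is generated by identities of zero objects, hence zero.
\<close>

definition simple_transitive_subquotient ::
  "('i, 'f, 'a, 'k) two_cat \<Rightarrow> ('i, 'f, 'a, 'o, 'm, 'k) two_rep \<Rightarrow>
    (nat \<Rightarrow> ('i \<times> 'o) set set set) \<Rightarrow> nat \<Rightarrow> ('i, 'f, 'a, 'o, 'm set set, 'k) two_rep" where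
  "simple_transitive_subquotient C M Q i =
    simple_transitive_quotient C (subquotient C M (Q i) (Q (i - 1)))"

end

theory Submission
  imports Defs
begin

text \<open>
  The steps of a complete filtration run through the classes of the action preorder, each class
  occurring once (\<open>complete_filtration_enumerates\<close>). Two filtrations therefore have the same length,
  and the theorem follows if, for coideals \<open>Q \<subseteq> P\<close> with \<open>P - Q = {p}\<close>, the simple transitive quotient
  of \<open>M\<^bsub>P/Q\<^esub>\<close> depends up to equivalence on \<open>p\<close> alone (\<open>equivalent_simple_transitive_quotients\<close>).

  To this end the ideal that is factored out is described without reference to \<open>P\<close> and \<open>Q\<close>. Let \<open>I\<close>
  (\<open>class_ideal p\<close>) consist of the morphisms \<open>f : X \<rightarrow> Y\<close> of \<open>M\<close> such that no composite
  \<open>Z \<rightarrow> F X \<rightarrow> F Y \<rightarrow> Z\<close> with middle arrow \<open>F f\<close> is an isomorphism, where \<open>F\<close> is a 1-morphism and \<open>Z\<close> an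
  indecomposable object in the class \<open>p\<close>. Endomorphism rings of indecomposable objects are local
  (\<open>indecomposable_sum_iso\<close>), so \<open>I\<close> is closed under sums, and it is an ideal of \<open>M\<close>. The identity of
  an object \<open>X\<close> of \<open>M\<^bsub>P\<^esub>\<close> belongs to \<open>I\<close> exactly if \<open>X\<close> lies in \<open>M\<^bsub>Q\<^esub>\<close>
  (\<open>idm_class_ideal_objects\<close>). Hence \<open>I\<close> contains the ideal \<open>G\<close> with \<open>M\<^bsub>P/Q\<^esub> = M\<^bsub>P\<^esub>/G\<close>, and \<open>I/G\<close>
  contains no identity of a nonzero object. On the other hand, an ideal of \<open>M\<^bsub>P/Q\<^esub>\<close> that contains a
  morphism outside \<open>I/G\<close> contains the identity of an indecomposable object in \<open>p\<close>. So \<open>I/G\<close> is the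
  maximal ideal (\<open>maximal_ideal_N\<close>), and by the third isomorphism theorem the simple transitive
  quotient is the full subrepresentation of \<open>M/I\<close> on the objects of \<open>M\<^bsub>P\<^esub>\<close> (\<open>full_2embedding_L\<close>).

  In \<open>M/I\<close> the indecomposable objects of \<open>M\<^bsub>Q\<^esub>\<close> become zero. An object of \<open>M\<^bsub>P\<^esub>\<close> is thus isomorphic in
  \<open>M/I\<close> to the sum of its indecomposable summands in \<open>p\<close> (\<open>isomorphic_to_sum_of_class\<close>), which is also
  an object of \<open>M\<^bsub>P'\<^esub>\<close> for every other step \<open>Q' \<subseteq> P'\<close> that adds \<open>p\<close>. The two simple transitive
  quotients are full subrepresentations of \<open>M/I\<close> with the same essential image, and such are
  equivalent (\<open>equivalent_full_subrepresentations\<close>).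

  All this rests on two facts about a finitary category. Every object is a finite direct sum of
  indecomposable objects (\<open>finite_direct_sum_indecomposables\<close>), and an indecomposable summand of a
  direct sum is a summand of one of the terms (\<open>indecomposable_retract_biproduct\<close>). They show that
  the objects of \<open>M\<^bsub>Q\<^esub>\<close> are those whose indecomposable summands all lie in \<open>Q\<close> (\<open>objects_iff\<close>).
\<close>

section \<open>Calculating in linear categories\<close>

text \<open>
  Morphism spaces of distinct pairs of objects are disjoint, so a morphism has one source and one
  target, and the axioms can be restated with equations between ends as their side conditions.
\<close>

definition src :: "('o, 'm, 'k) lincat \<Rightarrow> 'm \<Rightarrow> 'o" where
  "src A f = (THE X. X \<in> Ob A \<and> (\<exists>Y\<in>Ob A. f \<in> hom A X Y))"

definition tgt :: "('o, 'm, 'k) lincat \<Rightarrow> 'm \<Rightarrow> 'o" where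
  "tgt A f = (THE Y. Y \<in> Ob A \<and> (\<exists>X\<in>Ob A. f \<in> hom A X Y))"

context linear_category
begin

lemma homD:
  assumes "X \<in> Ob A" "Y \<in> Ob A" "f \<in> hom A X Y"
  shows "f \<in> arrows A" "src A f = X" "tgt A f = Y"
proof -
  show "f \<in> arrows A" using assms by (auto simp: arrows_def)
  show "src A f = X" unfolding src_def
    by (rule the_equality) (use assms hom_disjoint in blast)+
  show "tgt A f = Y" unfolding tgt_def
    by (rule the_equality) (use assms hom_disjoint in blast)+
qed

lemma arr_src_tgt:
  assumes "f \<in> arrows A"
  shows src_in_Ob [simp]: "src A f \<in> Ob A" and tgt_in_Ob [simp]: "tgt A f \<in> Ob A"
    and "f \<in> hom A (src A f) (tgt A f)"
  using assms homD by (fastforce simp: arrows_def)+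

text \<open>
  As a rewrite rule this trades membership in a morphism space for three conditions on the
  morphism alone. The side conditions of the rules below then contain no unknown object, and the
  simplifier can discharge them.
\<close>

lemma hom_iff [simp]:
  "X \<in> Ob A \<Longrightarrow> Y \<in> Ob A \<Longrightarrow> f \<in> hom A X Y \<longleftrightarrow> f \<in> arrows A \<and> src A f = X \<and> tgt A f = Y"
  using homD arr_src_tgt by metis

lemma idm_arr [simp]:
  assumes "X \<in> Ob A"
  shows "idm A X \<in> arrows A" "src A (idm A X) = X" "tgt A (idm A X) = X"
  using idm_in_hom[OF assms] assms by auto

lemma zero_arr [simp]:
  assumes "X \<in> Ob A" "Y \<in> Ob A"
  shows "zero_mor A X Y \<in> arrows A" "src A (zero_mor A X Y) = X" "tgt A (zero_mor A X Y) = Y"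
  using zero_in_hom[OF assms] assms by auto

lemma cmp_arr [simp]:
  assumes "f \<in> arrows A" "g \<in> arrows A" "src A g = tgt A f"
  shows "g \<cdot> f \<in> arrows A" "src A (g \<cdot> f) = src A f" "tgt A (g \<cdot> f) = tgt A g"
  using cmp_in_hom[of "src A f" "tgt A f" "tgt A g" f g] assms by auto

lemma plus_arr [simp]:
  assumes "f \<in> arrows A" "g \<in> arrows A" "src A f = src A g" "tgt A f = tgt A g"
  shows "f \<boxplus> g \<in> arrows A" "src A (f \<boxplus> g) = src A g" "tgt A (f \<boxplus> g) = tgt A g"
  using plus_in_hom[of "src A f" "tgt A f" f g] assms by auto

lemma scale_arr [simp]:
  assumes "f \<in> arrows A"
  shows "c \<odot> f \<in> arrows A" "src A (c \<odot> f) = src A f" "tgt A (c \<odot> f) = tgt A f"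
  using scale_in_hom[of "src A f" "tgt A f" f c] assms by auto

lemma assoc [simp]:
  "f \<in> arrows A \<Longrightarrow> g \<in> arrows A \<Longrightarrow> h \<in> arrows A \<Longrightarrow> src A g = tgt A f \<Longrightarrow> src A h = tgt A g
    \<Longrightarrow> (h \<cdot> g) \<cdot> f = h \<cdot> (g \<cdot> f)"
  using cmp_assoc[of "src A f" "tgt A f" "tgt A g" "tgt A h" f g h] by simp

lemma idm_left [simp]: "f \<in> arrows A \<Longrightarrow> tgt A f = Y \<Longrightarrow> idm A Y \<cdot> f = f"
  using cmp_idm_left[of "src A f" Y f] by auto

lemma idm_right [simp]: "f \<in> arrows A \<Longrightarrow> src A f = X \<Longrightarrow> f \<cdot> idm A X = f"
  using cmp_idm_right[of X "tgt A f" f] by auto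

lemma plus_assoc' [simp]:
  "f \<in> arrows A \<Longrightarrow> g \<in> arrows A \<Longrightarrow> h \<in> arrows A \<Longrightarrow> src A f = src A g \<Longrightarrow> tgt A f = tgt A g
    \<Longrightarrow> src A g = src A h \<Longrightarrow> tgt A g = tgt A h \<Longrightarrow> (f \<boxplus> g) \<boxplus> h = f \<boxplus> (g \<boxplus> h)"
  using plus_assoc[of "src A f" "tgt A f" f g h] by simp

lemma plus_comm:
  "f \<in> arrows A \<Longrightarrow> g \<in> arrows A \<Longrightarrow> src A f = src A g \<Longrightarrow> tgt A f = tgt A g
    \<Longrightarrow> f \<boxplus> g = g \<boxplus> f"
  using plus_commute[of "src A f" "tgt A f" f g] by simp

lemma plus_left_comm:
  assumes "f \<in> arrows A" "g \<in> arrows A" "h \<in> arrows A" "src A f = src A g" "tgt A f = tgt A g"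
    "src A g = src A h" "tgt A g = tgt A h"
  shows "f \<boxplus> (g \<boxplus> h) = g \<boxplus> (f \<boxplus> h)"
proof -
  have "f \<boxplus> (g \<boxplus> h) = (f \<boxplus> g) \<boxplus> h" using assms by simp
  also have "f \<boxplus> g = g \<boxplus> f" using assms by (simp add: plus_comm)
  finally show ?thesis using assms by simp
qed

lemma plus_zero_right [simp]:
  "f \<in> arrows A \<Longrightarrow> src A f = X \<Longrightarrow> tgt A f = Y \<Longrightarrow> f \<boxplus> zero_mor A X Y = f"
  using plus_zero[of X Y f] by auto

lemma plus_zero_left [simp]:
  "f \<in> arrows A \<Longrightarrow> src A f = X \<Longrightarrow> tgt A f = Y \<Longrightarrow> zero_mor A X Y \<boxplus> f = f"
  using plus_comm[of "zero_mor A X Y" f] by auto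

lemma plus_cancel_self:
  assumes "f \<in> arrows A" "f \<boxplus> f = f"
  shows "f = zero_mor A (src A f) (tgt A f)"
proof -
  obtain g where g: "g \<in> arrows A" "src A g = src A f" "tgt A g = tgt A f"
      "f \<boxplus> g = zero_mor A (src A f) (tgt A f)"
    using plus_inverse[of "src A f" "tgt A f" f] assms(1) by auto
  have "f \<boxplus> (f \<boxplus> g) = (f \<boxplus> f) \<boxplus> g" using assms(1) g(1-3) by simp
  then show ?thesis using g assms by simp
qed

lemma scale_plus' [simp]:
  "f \<in> arrows A \<Longrightarrow> g \<in> arrows A \<Longrightarrow> src A f = src A g \<Longrightarrow> tgt A f = tgt A g
    \<Longrightarrow> c \<odot> (f \<boxplus> g) = c \<odot> f \<boxplus> c \<odot> g"
  using scale_plus[of "src A f" "tgt A f" f g c] by simp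

lemma plus_scale': "f \<in> arrows A \<Longrightarrow> (c + d) \<odot> f = c \<odot> f \<boxplus> d \<odot> f"
  using plus_scale[of "src A f" "tgt A f" f c d] by simp

lemma scale_scale' [simp]: "f \<in> arrows A \<Longrightarrow> c \<odot> (d \<odot> f) = (c * d) \<odot> f"
  using scale_scale[of "src A f" "tgt A f" f c d] by simp

lemma scale_one' [simp]: "f \<in> arrows A \<Longrightarrow> 1 \<odot> f = f"
  using scale_one[of "src A f" "tgt A f" f] by simp

lemma scale_0 [simp]: "f \<in> arrows A \<Longrightarrow> 0 \<odot> f = zero_mor A (src A f) (tgt A f)"
  using plus_cancel_self[of "0 \<odot> f"] plus_scale'[of f 0 0] by simp

lemma scale_zero [simp]: "X \<in> Ob A \<Longrightarrow> Y \<in> Ob A \<Longrightarrow> c \<odot> zero_mor A X Y = zero_mor A X Y"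
  using scale_0[of "zero_mor A X Y"] scale_scale'[of "zero_mor A X Y" c 0] by simp

lemma plus_uminus [simp]:
  "f \<in> arrows A \<Longrightarrow> f \<boxplus> (-1) \<odot> f = zero_mor A (src A f) (tgt A f)"
  "f \<in> arrows A \<Longrightarrow> (-1) \<odot> f \<boxplus> f = zero_mor A (src A f) (tgt A f)"
  using plus_scale'[of f 1 "-1"] plus_scale'[of f "-1" 1] by simp_all

lemma plus_uminus_left [simp]:
  assumes "f \<in> arrows A" "g \<in> arrows A" "src A f = src A g" "tgt A f = tgt A g"
  shows "f \<boxplus> ((-1) \<odot> f \<boxplus> g) = g" "(-1) \<odot> f \<boxplus> (f \<boxplus> g) = g"
proof -
  have "f \<boxplus> ((-1) \<odot> f \<boxplus> g) = (f \<boxplus> (-1) \<odot> f) \<boxplus> g"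
       "(-1) \<odot> f \<boxplus> (f \<boxplus> g) = ((-1) \<odot> f \<boxplus> f) \<boxplus> g"
    using assms by (simp_all del: plus_uminus)
  then show "f \<boxplus> ((-1) \<odot> f \<boxplus> g) = g" "(-1) \<odot> f \<boxplus> (f \<boxplus> g) = g"
    using assms by simp_all
qed

lemma plus_uminus_around [simp]:
  assumes "f \<in> arrows A" "g \<in> arrows A" "src A f = src A g" "tgt A f = tgt A g"
  shows "f \<boxplus> (g \<boxplus> (-1) \<odot> f) = g" "(-1) \<odot> f \<boxplus> (g \<boxplus> f) = g"
proof -
  have "f \<boxplus> (g \<boxplus> (-1) \<odot> f) = g \<boxplus> (f \<boxplus> (-1) \<odot> f)"
    by (rule plus_left_comm) (use assms in simp_all)
  then show "f \<boxplus> (g \<boxplus> (-1) \<odot> f) = g" using assms by simp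
  have "(-1) \<odot> f \<boxplus> (g \<boxplus> f) = g \<boxplus> ((-1) \<odot> f \<boxplus> f)"
    by (rule plus_left_comm) (use assms in simp_all)
  then show "(-1) \<odot> f \<boxplus> (g \<boxplus> f) = g" using assms by simp
qed

lemma diff_zero_iff:
  assumes "f \<in> arrows A" "g \<in> arrows A" "src A f = src A g" "tgt A f = tgt A g"
  shows "f \<boxplus> (-1) \<odot> g = zero_mor A (src A g) (tgt A g) \<longleftrightarrow> f = g"
proof
  assume eq: "f \<boxplus> (-1) \<odot> g = zero_mor A (src A g) (tgt A g)"
  have "f = (f \<boxplus> (-1) \<odot> g) \<boxplus> g" using assms by simp
  then show "f = g" using assms eq by simp
qed (use assms in simp)

lemma cmp_plus_l [simp]:
  "f \<in> arrows A \<Longrightarrow> g \<in> arrows A \<Longrightarrow> g' \<in> arrows A \<Longrightarrow> src A g = src A g' \<Longrightarrow> tgt A g = tgt A g'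
    \<Longrightarrow> src A g' = tgt A f \<Longrightarrow> (g \<boxplus> g') \<cdot> f = (g \<cdot> f) \<boxplus> (g' \<cdot> f)"
  using cmp_plus_left[of "src A f" "tgt A f" "tgt A g" f g g'] by simp

lemma cmp_plus_r [simp]:
  "f \<in> arrows A \<Longrightarrow> f' \<in> arrows A \<Longrightarrow> g \<in> arrows A \<Longrightarrow> src A f = src A f' \<Longrightarrow> tgt A f = tgt A f'
    \<Longrightarrow> src A g = tgt A f' \<Longrightarrow> g \<cdot> (f \<boxplus> f') = (g \<cdot> f) \<boxplus> (g \<cdot> f')"
  using cmp_plus_right[of "src A f" "tgt A f" "tgt A g" f f' g] by simp

lemma cmp_scale_l [simp]:
  "f \<in> arrows A \<Longrightarrow> g \<in> arrows A \<Longrightarrow> src A g = tgt A f \<Longrightarrow> (c \<odot> g) \<cdot> f = c \<odot> (g \<cdot> f)"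
  using cmp_scale_left[of "src A f" "tgt A f" "tgt A g" f g c] by simp

lemma cmp_scale_r [simp]:
  "f \<in> arrows A \<Longrightarrow> g \<in> arrows A \<Longrightarrow> src A g = tgt A f \<Longrightarrow> g \<cdot> (c \<odot> f) = c \<odot> (g \<cdot> f)"
  using cmp_scale_right[of "src A f" "tgt A f" "tgt A g" f g c] by simp

lemma cmp_zero_left [simp]:
  assumes "f \<in> arrows A" "tgt A f = Y" "Z \<in> Ob A"
  shows "zero_mor A Y Z \<cdot> f = zero_mor A (src A f) Z"
proof -
  have Y: "Y \<in> Ob A" using assms by auto
  have "zero_mor A Y Z \<cdot> f = (0 \<odot> zero_mor A Y Z) \<cdot> f" using Y assms by simp
  also have "\<dots> = 0 \<odot> (zero_mor A Y Z \<cdot> f)" using Y assms by (simp del: scale_zero scale_0)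
  finally show ?thesis using Y assms by simp
qed

lemma cmp_zero_right [simp]:
  assumes "f \<in> arrows A" "src A f = Y" "X \<in> Ob A"
  shows "f \<cdot> zero_mor A X Y = zero_mor A X (tgt A f)"
proof -
  have Y: "Y \<in> Ob A" using assms by auto
  have "f \<cdot> zero_mor A X Y = f \<cdot> (0 \<odot> zero_mor A X Y)" using Y assms by simp
  also have "\<dots> = 0 \<odot> (f \<cdot> zero_mor A X Y)" using Y assms by (simp del: scale_zero scale_0)
  finally show ?thesis using Y assms by simp
qed

text \<open>
  A composite \<open>g \<cdot> f\<close> with a known value hides inside longer composites once these are bracketed to
  the right.
\<close>

lemma cmp_reassoc:
  "g \<cdot> f = k \<Longrightarrow> f \<in> arrows A \<Longrightarrow> g \<in> arrows A \<Longrightarrow> src A g = tgt A f \<Longrightarrow>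
    x \<in> arrows A \<Longrightarrow> tgt A x = src A f \<Longrightarrow> g \<cdot> (f \<cdot> x) = k \<cdot> x"
  by auto

lemma zero_object_iff: "zero_object A X \<longleftrightarrow> X \<in> Ob A \<and> idm A X = zero_mor A X X"
proof
  assume "zero_object A X"
  then show "X \<in> Ob A \<and> idm A X = zero_mor A X X"
    using idm_in_hom zero_in_hom unfolding zero_object_def by blast
next
  assume X: "X \<in> Ob A \<and> idm A X = zero_mor A X X"
  have "f = zero_mor A Y X" if "Y \<in> Ob A" "f \<in> hom A Y X" for f Y
    using idm_left[of f X] X that by simp
  moreover have "f = zero_mor A X Y" if "Y \<in> Ob A" "f \<in> hom A X Y" for f Y
    using idm_right[of f X] X that by simp
  ultimately show "zero_object A X"
    unfolding zero_object_def using X zero_in_hom by blast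
qed

lemma is_isoI:
  assumes "f \<in> arrows A" "g \<in> arrows A" "src A f = X" "tgt A f = Y" "src A g = Y" "tgt A g = X"
    "g \<cdot> f = idm A X" "f \<cdot> g = idm A Y"
  shows "is_iso A X Y f"
  using assms unfolding is_iso_def by auto

lemma is_isoE:
  assumes "is_iso A X Y f" "X \<in> Ob A" "Y \<in> Ob A"
  obtains g where "f \<in> arrows A" "src A f = X" "tgt A f = Y" "g \<in> arrows A" "src A g = Y"
    "tgt A g = X" "g \<cdot> f = idm A X" "f \<cdot> g = idm A Y"
  using assms unfolding is_iso_def by auto

lemma is_iso_cmp:
  assumes "is_iso A X Y f" "is_iso A Y Z g" "X \<in> Ob A" "Y \<in> Ob A" "Z \<in> Ob A"
  shows "is_iso A X Z (g \<cdot> f)"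
proof -
  obtain f' where f: "f \<in> arrows A" "src A f = X" "tgt A f = Y" "f' \<in> arrows A" "src A f' = Y"
    "tgt A f' = X" "f' \<cdot> f = idm A X" "f \<cdot> f' = idm A Y" using assms is_isoE by metis
  obtain g' where g: "g \<in> arrows A" "src A g = Y" "tgt A g = Z" "g' \<in> arrows A" "src A g' = Z"
    "tgt A g' = Y" "g' \<cdot> g = idm A Y" "g \<cdot> g' = idm A Z" using assms is_isoE by metis
  show ?thesis
    by (rule is_isoI[of _ "f' \<cdot> g'"])
      (use f g in \<open>auto simp: cmp_reassoc[OF g(7)] cmp_reassoc[OF f(8)]\<close>)
qed

lemma isomorphic_refl: "X \<in> Ob A \<Longrightarrow> isomorphic A X X"
  unfolding isomorphic_def using is_isoI[of "idm A X" "idm A X" X X] by auto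

lemma isomorphic_trans: "isomorphic A X Y \<Longrightarrow> isomorphic A Y Z \<Longrightarrow> isomorphic A X Z"
  unfolding isomorphic_def using is_iso_cmp by blast

end

section \<open>Linear functors\<close>

locale linear_functor_between =
  A: linear_category A + B: linear_category B
  for A :: "('o, 'm, 'k::field) lincat" and B :: "('p, 'n, 'k) lincat" +
  fixes Fo :: "'o \<Rightarrow> 'p" and Fm :: "'m \<Rightarrow> 'n"
  assumes is_functor: "linear_functor A B Fo Fm"
begin

lemma obj [simp]: "X \<in> Ob A \<Longrightarrow> Fo X \<in> Ob B"
  using is_functor unfolding linear_functor_def by blast

lemma arr [simp]:
  assumes "f \<in> arrows A"
  shows "Fm f \<in> arrows B" "src B (Fm f) = Fo (src A f)" "tgt B (Fm f) = Fo (tgt A f)"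
proof -
  have "Fm f \<in> hom B (Fo (src A f)) (Fo (tgt A f))"
    using is_functor A.arr_src_tgt[OF assms] unfolding linear_functor_def by blast
  then show "Fm f \<in> arrows B" "src B (Fm f) = Fo (src A f)" "tgt B (Fm f) = Fo (tgt A f)"
    using assms by auto
qed

lemma pres_idm [simp]: "X \<in> Ob A \<Longrightarrow> Fm (idm A X) = idm B (Fo X)"
  using is_functor unfolding linear_functor_def by blast

lemma pres_cmp [simp]:
  "f \<in> arrows A \<Longrightarrow> g \<in> arrows A \<Longrightarrow> src A g = tgt A f \<Longrightarrow> Fm (g \<cdot>\<^bsub>A\<^esub> f) = Fm g \<cdot>\<^bsub>B\<^esub> Fm f"
  using is_functor A.arr_src_tgt[of f] A.arr_src_tgt[of g] unfolding linear_functor_def by metis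

lemma pres_plus [simp]:
  "f \<in> arrows A \<Longrightarrow> g \<in> arrows A \<Longrightarrow> src A f = src A g \<Longrightarrow> tgt A f = tgt A g
    \<Longrightarrow> Fm (f \<boxplus>\<^bsub>A\<^esub> g) = Fm f \<boxplus>\<^bsub>B\<^esub> Fm g"
  using is_functor A.arr_src_tgt[of f] A.arr_src_tgt[of g] unfolding linear_functor_def by metis

lemma pres_scale [simp]: "f \<in> arrows A \<Longrightarrow> Fm (c \<odot>\<^bsub>A\<^esub> f) = c \<odot>\<^bsub>B\<^esub> Fm f"
  using is_functor A.arr_src_tgt[of f] unfolding linear_functor_def by metis

lemma pres_zero [simp]:
  "X \<in> Ob A \<Longrightarrow> Y \<in> Ob A \<Longrightarrow> Fm (zero_mor A X Y) = zero_mor B (Fo X) (Fo Y)"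
  using pres_scale[of "zero_mor A X Y" 0] by (simp del: pres_scale)

lemma pres_biproduct:
  assumes "biproduct A W X Y"
  shows "biproduct B (Fo W) (Fo X) (Fo Y)"
proof -
  obtain i1 i2 p1 p2 where W: "W \<in> Ob A" "X \<in> Ob A" "Y \<in> Ob A"
    and *: "i1 \<in> hom A X W" "i2 \<in> hom A Y W" "p1 \<in> hom A W X" "p2 \<in> hom A W Y"
      "p1 \<cdot>\<^bsub>A\<^esub> i1 = idm A X" "p2 \<cdot>\<^bsub>A\<^esub> i2 = idm A Y"
      "p1 \<cdot>\<^bsub>A\<^esub> i2 = zero_mor A Y X" "p2 \<cdot>\<^bsub>A\<^esub> i1 = zero_mor A X Y"
      "(i1 \<cdot>\<^bsub>A\<^esub> p1) \<boxplus>\<^bsub>A\<^esub> (i2 \<cdot>\<^bsub>A\<^esub> p2) = idm A W"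
    using assms unfolding biproduct_def by blast
  have "Fm p1 \<cdot>\<^bsub>B\<^esub> Fm i1 = Fm (p1 \<cdot>\<^bsub>A\<^esub> i1)" "Fm p2 \<cdot>\<^bsub>B\<^esub> Fm i2 = Fm (p2 \<cdot>\<^bsub>A\<^esub> i2)"
    "Fm p1 \<cdot>\<^bsub>B\<^esub> Fm i2 = Fm (p1 \<cdot>\<^bsub>A\<^esub> i2)" "Fm p2 \<cdot>\<^bsub>B\<^esub> Fm i1 = Fm (p2 \<cdot>\<^bsub>A\<^esub> i1)"
    "(Fm i1 \<cdot>\<^bsub>B\<^esub> Fm p1) \<boxplus>\<^bsub>B\<^esub> (Fm i2 \<cdot>\<^bsub>B\<^esub> Fm p2) = Fm ((i1 \<cdot>\<^bsub>A\<^esub> p1) \<boxplus>\<^bsub>A\<^esub> (i2 \<cdot>\<^bsub>A\<^esub> p2))"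
    using W *(1-4) by simp_all
  then show ?thesis
    unfolding biproduct_def using W *
    by (intro conjI bexI[of _ "Fm i1"] bexI[of _ "Fm i2"] bexI[of _ "Fm p1"] bexI[of _ "Fm p2"]) auto
qed

end

section \<open>Ideals and quotient categories\<close>

text \<open>
  The operations on residue classes are unions over all representatives. This evaluates such a
  union once the class of the result is known not to depend on the representatives.
\<close>

lemma UN_constant_on:
  assumes "s \<in> S" "\<And>x. x \<in> S \<Longrightarrow> h x = c"
  shows "(\<Union>x\<in>S. h x) = c"
  using assms by blast

locale category_with_ideal = linear_category +
  fixes I :: "'b set"
  assumes ideal: "cat_ideal A I"
begin

lemma ideal_arr: "f \<in> I \<Longrightarrow> f \<in> arrows A"
  using ideal unfolding cat_ideal_def by blast

lemma ideal_zero [simp]: "X \<in> Ob A \<Longrightarrow> Y \<in> Ob A \<Longrightarrow> zero_mor A X Y \<in> I"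
  using ideal unfolding cat_ideal_def by blast

lemma ideal_plus:
  assumes "f \<in> I" "g \<in> I" "src A f = src A g" "tgt A f = tgt A g"
  shows "f \<boxplus> g \<in> I"
proof -
  have "f \<in> hom A (src A g) (tgt A g) \<inter> I" "g \<in> hom A (src A g) (tgt A g) \<inter> I"
    "src A g \<in> Ob A" "tgt A g \<in> Ob A"
    using assms ideal_arr by auto
  then show ?thesis using ideal unfolding cat_ideal_def by blast
qed

lemma ideal_scale: "f \<in> I \<Longrightarrow> c \<odot> f \<in> I"
  using ideal unfolding cat_ideal_def by blast

lemma ideal_cmp:
  assumes "f \<in> arrows A" "g \<in> arrows A" "src A g = tgt A f" "f \<in> I \<or> g \<in> I"
  shows "g \<cdot> f \<in> I"
proof -
  have "src A f \<in> Ob A" "tgt A f \<in> Ob A" "tgt A g \<in> Ob A"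
    "f \<in> hom A (src A f) (tgt A f)" "g \<in> hom A (tgt A f) (tgt A g)"
    using assms by auto
  then show ?thesis using ideal assms(4) unfolding cat_ideal_def by blast
qed

lemma mem_coset_iff:
  assumes f: "f \<in> arrows A"
  shows "g \<in> coset A I f \<longleftrightarrow>
    g \<in> arrows A \<and> src A g = src A f \<and> tgt A g = tgt A f \<and> g \<boxplus> (-1) \<odot> f \<in> I"
proof
  assume "g \<in> coset A I f"
  then obtain h where h: "h \<in> I" "h \<in> arrows A" "src A h = src A f" "tgt A h = tgt A f" "g = f \<boxplus> h"
    unfolding coset_def by auto
  have "g = h \<boxplus> f" using f h plus_comm by metis
  then show "g \<in> arrows A \<and> src A g = src A f \<and> tgt A g = tgt A f \<and> g \<boxplus> (-1) \<odot> f \<in> I"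
    using f h by simp
next
  assume g: "g \<in> arrows A \<and> src A g = src A f \<and> tgt A g = tgt A f \<and> g \<boxplus> (-1) \<odot> f \<in> I"
  then have "g = f \<boxplus> (g \<boxplus> (-1) \<odot> f)" using f by simp
  then show "g \<in> coset A I f"
    unfolding coset_def using f g arr_src_tgt[OF f]
    by (intro CollectI bexI[of _ "src A f"] bexI[of _ "tgt A f"] conjI
        bexI[of _ "g \<boxplus> (-1) \<odot> f"]) auto
qed

lemma self_mem_coset: "f \<in> arrows A \<Longrightarrow> f \<in> coset A I f"
  by (simp add: mem_coset_iff)

lemma coset_eqI:
  assumes f: "f \<in> arrows A" and g: "g \<in> coset A I f"
  shows "coset A I g = coset A I f"
proof -
  have g': "g \<in> arrows A" "src A g = src A f" "tgt A g = tgt A f" "g \<boxplus> (-1) \<odot> f \<in> I"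
    using g f by (auto simp: mem_coset_iff)
  have "h \<boxplus> (-1) \<odot> f \<in> I \<longleftrightarrow> h \<boxplus> (-1) \<odot> g \<in> I"
    if h: "h \<in> arrows A" "src A h = src A f" "tgt A h = tgt A f" for h
  proof
    assume "h \<boxplus> (-1) \<odot> f \<in> I"
    then have "(h \<boxplus> (-1) \<odot> f) \<boxplus> (-1) \<odot> (g \<boxplus> (-1) \<odot> f) \<in> I"
      using ideal_plus[OF _ ideal_scale[OF g'(4), of "-1"]] f g'(1-3) h by (simp del: scale_plus' plus_assoc')
    moreover have "(h \<boxplus> (-1) \<odot> f) \<boxplus> (-1) \<odot> (g \<boxplus> (-1) \<odot> f) = h \<boxplus> (-1) \<odot> g"
      using f g' h by simp
    ultimately show "h \<boxplus> (-1) \<odot> g \<in> I" by metis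
  next
    assume "h \<boxplus> (-1) \<odot> g \<in> I"
    then have "(h \<boxplus> (-1) \<odot> g) \<boxplus> (g \<boxplus> (-1) \<odot> f) \<in> I"
      using ideal_plus[OF _ g'(4)] f g'(1-3) h by (simp del: plus_assoc')
    then show "h \<boxplus> (-1) \<odot> f \<in> I" using f g' h by simp
  qed
  then show ?thesis using f g' by (auto simp: mem_coset_iff)
qed

lemma coset_eq_iff:
  assumes "f \<in> arrows A" "g \<in> arrows A"
  shows "coset A I g = coset A I f \<longleftrightarrow> src A g = src A f \<and> tgt A g = tgt A f \<and> g \<boxplus> (-1) \<odot> f \<in> I"
  using coset_eqI[OF assms(1), of g] mem_coset_iff[OF assms(1), of g] self_mem_coset[OF assms(2)] assms
  by metis

lemma coset_eq_zero_iff: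
  assumes "f \<in> arrows A"
  shows "coset A I f = coset A I (zero_mor A (src A f) (tgt A f)) \<longleftrightarrow> f \<in> I"
  using assms by (simp add: coset_eq_iff)

abbreviation "AI \<equiv> quotient_cat A I"

lemma Ob_quotient [simp]: "Ob AI = Ob A"
  by (simp add: quotient_cat_def)

lemma idm_quotient: "idm AI X = coset A I (idm A X)"
  by (simp add: quotient_cat_def)

lemma zero_quotient: "zero_mor AI X Y = coset A I (zero_mor A X Y)"
  by (simp add: quotient_cat_def)

lemma cmp_quotient:
  assumes "f \<in> arrows A" "g \<in> arrows A" "src A g = tgt A f"
  shows "coset A I g \<cdot>\<^bsub>AI\<^esub> coset A I f = coset A I (g \<cdot> f)"
proof -
  have "coset A I (g' \<cdot> f') = coset A I (g \<cdot> f)"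
    if "g' \<in> coset A I g" "f' \<in> coset A I f" for f' g'
  proof -
    have *: "f' \<in> arrows A" "src A f' = src A f" "tgt A f' = tgt A f" "f' \<boxplus> (-1) \<odot> f \<in> I"
      "g' \<in> arrows A" "src A g' = src A g" "tgt A g' = tgt A g" "g' \<boxplus> (-1) \<odot> g \<in> I"
      using assms that by (auto simp: mem_coset_iff)
    have "g' \<cdot> f' \<boxplus> (-1) \<odot> (g \<cdot> f) = g' \<cdot> (f' \<boxplus> (-1) \<odot> f) \<boxplus> (g' \<boxplus> (-1) \<odot> g) \<cdot> f"
      using * assms by simp
    moreover have "g' \<cdot> (f' \<boxplus> (-1) \<odot> f) \<in> I" "(g' \<boxplus> (-1) \<odot> g) \<cdot> f \<in> I"
      by (rule ideal_cmp; use * assms in simp)+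
    then have "g' \<cdot> (f' \<boxplus> (-1) \<odot> f) \<boxplus> (g' \<boxplus> (-1) \<odot> g) \<cdot> f \<in> I"
      by (rule ideal_plus) (use * assms in \<open>simp_all del: cmp_plus_l cmp_plus_r\<close>)
    ultimately have "g' \<cdot> f' \<boxplus> (-1) \<odot> (g \<cdot> f) \<in> I" by (simp only:)
    then show ?thesis using * assms by (subst coset_eq_iff) auto
  qed
  then show ?thesis
    unfolding quotient_cat_def lincat.simps
    by (intro UN_constant_on[OF self_mem_coset] assms)
qed

lemma plus_quotient:
  assumes "f \<in> arrows A" "g \<in> arrows A" "src A f = src A g" "tgt A f = tgt A g"
  shows "coset A I f \<boxplus>\<^bsub>AI\<^esub> coset A I g = coset A I (f \<boxplus> g)"
proof -
  have "coset A I (f' \<boxplus> g') = coset A I (f \<boxplus> g)"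
    if "g' \<in> coset A I g" "f' \<in> coset A I f" for f' g'
  proof -
    have *: "f' \<in> arrows A" "src A f' = src A f" "tgt A f' = tgt A f" "f' \<boxplus> (-1) \<odot> f \<in> I"
      "g' \<in> arrows A" "src A g' = src A g" "tgt A g' = tgt A g" "g' \<boxplus> (-1) \<odot> g \<in> I"
      using assms that by (auto simp: mem_coset_iff)
    have "(f' \<boxplus> g') \<boxplus> (-1) \<odot> (f \<boxplus> g) = (f' \<boxplus> (-1) \<odot> f) \<boxplus> (g' \<boxplus> (-1) \<odot> g)"
      using * assms by (simp add: plus_left_comm[of g' "(-1) \<odot> f" "(-1) \<odot> g"])
    moreover have "(f' \<boxplus> (-1) \<odot> f) \<boxplus> (g' \<boxplus> (-1) \<odot> g) \<in> I"
      by (rule ideal_plus[OF *(4) *(8)]) (use * assms in simp_all)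
    ultimately have "(f' \<boxplus> g') \<boxplus> (-1) \<odot> (f \<boxplus> g) \<in> I" by (simp only:)
    then show ?thesis using * assms by (subst coset_eq_iff) auto
  qed
  then show ?thesis
    unfolding quotient_cat_def lincat.simps
    by (intro UN_constant_on[OF self_mem_coset] assms)
qed

lemma scale_quotient:
  assumes "f \<in> arrows A"
  shows "c \<odot>\<^bsub>AI\<^esub> coset A I f = coset A I (c \<odot> f)"
proof -
  have "coset A I (c \<odot> f') = coset A I (c \<odot> f)" if "f' \<in> coset A I f" for f'
  proof -
    have *: "f' \<in> arrows A" "src A f' = src A f" "tgt A f' = tgt A f" "f' \<boxplus> (-1) \<odot> f \<in> I"
      using assms that by (auto simp: mem_coset_iff)
    have "c \<odot> f' \<boxplus> (-1) \<odot> (c \<odot> f) = c \<odot> (f' \<boxplus> (-1) \<odot> f)" using * assms by simp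
    then have "c \<odot> f' \<boxplus> (-1) \<odot> (c \<odot> f) \<in> I" using ideal_scale[OF *(4), of c] by metis
    then show ?thesis using * assms by (subst coset_eq_iff) auto
  qed
  then show ?thesis
    unfolding quotient_cat_def lincat.simps
    by (intro UN_constant_on[OF self_mem_coset] assms)
qed

lemma hom_quotientE:
  assumes "S \<in> hom AI X Y" "X \<in> Ob A" "Y \<in> Ob A"
  obtains f where "S = coset A I f" "f \<in> arrows A" "src A f = X" "tgt A f = Y"
  using assms by (auto simp: quotient_cat_def)

lemma hom_quotientI:
  "f \<in> arrows A \<Longrightarrow> src A f = X \<Longrightarrow> tgt A f = Y \<Longrightarrow> coset A I f \<in> hom AI X Y"
  using arr_src_tgt(3)[of f] by (auto simp: quotient_cat_def)

lemma linear_quotient: "linear_category AI"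
proof
  fix X Y X' Y' f
  assume *: "X \<in> Ob AI" "Y \<in> Ob AI" "X' \<in> Ob AI" "Y' \<in> Ob AI" "f \<in> hom AI X Y" "f \<in> hom AI X' Y'"
  then obtain g where g: "f = coset A I g" "g \<in> arrows A" "src A g = X" "tgt A g = Y"
    using hom_quotientE[of f X Y] by auto
  obtain g' where g': "f = coset A I g'" "g' \<in> arrows A" "src A g' = X'" "tgt A g' = Y'"
    using hom_quotientE[of f X' Y'] * by auto
  show "X = X' \<and> Y = Y'" using g g' coset_eq_iff by metis
next
  fix X Y f assume "X \<in> Ob AI" "Y \<in> Ob AI" "f \<in> hom AI X Y"
  then obtain g where g: "f = coset A I g" "g \<in> arrows A" "src A g = X" "tgt A g = Y"
    using hom_quotientE[of f X Y] by auto
  then have "coset A I ((-1) \<odot> g) \<in> hom AI X Y" "f \<boxplus>\<^bsub>AI\<^esub> coset A I ((-1) \<odot> g) = zero_mor AI X Y"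
    by (auto simp: hom_quotientI plus_quotient zero_quotient)
  then show "\<exists>g\<in>hom AI X Y. f \<boxplus>\<^bsub>AI\<^esub> g = zero_mor AI X Y" by blast
next
  fix X Y f g assume "X \<in> Ob AI" "Y \<in> Ob AI" "f \<in> hom AI X Y" "g \<in> hom AI X Y"
  then show "f \<boxplus>\<^bsub>AI\<^esub> g = g \<boxplus>\<^bsub>AI\<^esub> f"
    unfolding Ob_quotient by (elim hom_quotientE) (auto simp: plus_quotient intro!: arg_cong[of _ _ "coset A I"] plus_comm)
qed (auto elim!: hom_quotientE simp: hom_quotientI plus_quotient zero_quotient cmp_quotient
    scale_quotient idm_quotient plus_scale')

lemma linear_coset: "linear_functor A AI id (coset A I)"
  unfolding linear_functor_def
  by (auto intro!: hom_quotientI simp: plus_quotient zero_quotient cmp_quotient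
    scale_quotient idm_quotient)

sublocale quotient: linear_functor_between A AI id "coset A I"
proof -
  interpret AI: linear_category AI by (rule linear_quotient)
  show "linear_functor_between A AI id (coset A I)"
    by unfold_locales (rule linear_coset)
qed

lemma arr_quotientE:
  assumes "S \<in> arrows AI"
  obtains f where "S = coset A I f" "f \<in> arrows A"
proof -
  obtain X Y where "X \<in> Ob A" "Y \<in> Ob A" "S \<in> hom AI X Y"
    using assms unfolding arrows_def by auto
  then show ?thesis using that by (elim hom_quotientE)
qed

text \<open>
  This is how objects are annihilated by passing to a quotient.
\<close>

lemma zero_object_quotient_iff:
  "X \<in> Ob A \<Longrightarrow> zero_object AI X \<longleftrightarrow> idm A X \<in> I"
  using coset_eq_zero_iff[of "idm A X"]
  unfolding quotient.B.zero_object_iff idm_quotient zero_quotient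
  by (simp del: quotient.pres_idm quotient.pres_zero)

end

lemma (in linear_category) cat_ideal_arrows: "cat_ideal A (arrows A)"
  unfolding cat_ideal_def by auto

lemma (in linear_category) cat_ideal_generated:
  assumes "S \<subseteq> arrows A"
  shows "cat_ideal A (generated_ideal A S)"
proof -
  have "generated_ideal A S \<subseteq> arrows A"
    unfolding generated_ideal_def using cat_ideal_arrows assms by blast
  moreover have "category_with_ideal A I" if "cat_ideal A I" for I
    by unfold_locales (rule that)
  note I = category_with_ideal.ideal_zero[OF this] category_with_ideal.ideal_plus[OF this]
    category_with_ideal.ideal_scale[OF this] category_with_ideal.ideal_cmp[OF this]
  have "zero_mor A X Y \<in> generated_ideal A S" if "X \<in> Ob A" "Y \<in> Ob A" for X Y
    unfolding generated_ideal_def using I(1) that by blast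
  moreover have "f \<boxplus> g \<in> generated_ideal A S"
    if "f \<in> generated_ideal A S" "g \<in> generated_ideal A S" "src A f = src A g" "tgt A f = tgt A g"
    for f g
    using that I(2) unfolding generated_ideal_def by blast
  moreover have "c \<odot> f \<in> generated_ideal A S" if "f \<in> generated_ideal A S" for f c
    using that I(3) unfolding generated_ideal_def by blast
  moreover have "g \<cdot> f \<in> generated_ideal A S"
    if "f \<in> generated_ideal A S \<or> g \<in> generated_ideal A S" "f \<in> arrows A" "g \<in> arrows A"
      "src A g = tgt A f" for f g
    using that I(4) unfolding generated_ideal_def by blast
  ultimately show ?thesis
    unfolding cat_ideal_def by auto
qed

lemma generated_ideal_mem: "f \<in> S \<Longrightarrow> f \<in> generated_ideal A S"
  unfolding generated_ideal_def by blast

lemma generated_ideal_least: "cat_ideal A I \<Longrightarrow> S \<subseteq> I \<Longrightarrow> generated_ideal A S \<subseteq> I"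
  unfolding generated_ideal_def by blast

section \<open>Full subcategories\<close>

lemma Ob_full_subcat [simp]: "Ob (full_subcat A S) = Ob A \<inter> S"
  and hom_full_subcat [simp]: "hom (full_subcat A S) = hom A"
  and idm_full_subcat [simp]: "idm (full_subcat A S) = idm A"
  and cmp_full_subcat [simp]: "cmp (full_subcat A S) = cmp A"
  and plus_full_subcat [simp]: "plus_mor (full_subcat A S) = plus_mor A"
  and zero_full_subcat [simp]: "zero_mor (full_subcat A S) = zero_mor A"
  and scale_full_subcat [simp]: "scale_mor (full_subcat A S) = scale_mor A"
  by (simp_all add: full_subcat_def)

context linear_category
begin

lemma linear_full_subcat: "linear_category (full_subcat A S)"
  by unfold_locales (auto simp: plus_scale' plus_inverse intro: plus_comm)

lemma arr_full_subcat:
  "f \<in> arrows (full_subcat A S) \<longleftrightarrow> f \<in> arrows A \<and> src A f \<in> S \<and> tgt A f \<in> S"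
proof
  assume "f \<in> arrows (full_subcat A S)"
  then show "f \<in> arrows A \<and> src A f \<in> S \<and> tgt A f \<in> S" unfolding arrows_def[of "full_subcat A S"] by auto
next
  assume "f \<in> arrows A \<and> src A f \<in> S \<and> tgt A f \<in> S"
  then have "f \<in> hom (full_subcat A S) (src A f) (tgt A f)"
    "src A f \<in> Ob (full_subcat A S)" "tgt A f \<in> Ob (full_subcat A S)" by auto
  then show "f \<in> arrows (full_subcat A S)" unfolding arrows_def by blast
qed

lemma src_tgt_full_subcat [simp]:
  assumes "f \<in> arrows (full_subcat A S)"
  shows "src (full_subcat A S) f = src A f" "tgt (full_subcat A S) f = tgt A f"
proof -
  interpret S: linear_category "full_subcat A S" by (rule linear_full_subcat)
  show "src (full_subcat A S) f = src A f" "tgt (full_subcat A S) f = tgt A f"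
    using S.homD[of "src A f" "tgt A f" f] assms by (auto simp: arr_full_subcat)
qed

end

section \<open>Retracts and direct sums\<close>

text \<open>
  Where idempotents split, the retracts of an object are its direct summands
  (\<open>direct_summand_iff_retract\<close>). Retracts make no mention of a complement and are therefore easily
  composed and recognised.
\<close>

definition retract :: "('o, 'm, 'k) lincat \<Rightarrow> 'o \<Rightarrow> 'o \<Rightarrow> bool" where
  "retract A X W \<longleftrightarrow> X \<in> Ob A \<and> W \<in> Ob A \<and>
    (\<exists>s\<in>arrows A. \<exists>r\<in>arrows A. src A s = X \<and> tgt A s = W \<and> src A r = W \<and> tgt A r = X \<and>
      r \<cdot>\<^bsub>A\<^esub> s = idm A X)"

context linear_category
begin

lemma retractI:
  assumes "s \<in> arrows A" "r \<in> arrows A" "src A s = X" "tgt A s = W" "src A r = W" "tgt A r = X"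
    "r \<cdot> s = idm A X"
  shows "retract A X W"
  using assms arr_src_tgt unfolding retract_def by blast

lemma retractE:
  assumes "retract A X W"
  obtains s r where "X \<in> Ob A" "W \<in> Ob A" "s \<in> arrows A" "r \<in> arrows A" "src A s = X" "tgt A s = W"
    "src A r = W" "tgt A r = X" "r \<cdot> s = idm A X"
  using assms unfolding retract_def by blast

lemma retract_refl: "X \<in> Ob A \<Longrightarrow> retract A X X"
  by (rule retractI[of "idm A X" "idm A X"]) auto

lemma retract_trans:
  assumes "retract A X Y" "retract A Y Z"
  shows "retract A X Z"
proof -
  obtain s r where 1: "X \<in> Ob A" "Y \<in> Ob A" "s \<in> arrows A" "r \<in> arrows A" "src A s = X"
    "tgt A s = Y" "src A r = Y" "tgt A r = X" "r \<cdot> s = idm A X" using assms retractE by metis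
  obtain s' r' where 2: "Y \<in> Ob A" "Z \<in> Ob A" "s' \<in> arrows A" "r' \<in> arrows A" "src A s' = Y"
    "tgt A s' = Z" "src A r' = Z" "tgt A r' = Y" "r' \<cdot> s' = idm A Y" using assms retractE by metis
  show ?thesis
    by (rule retractI[of "s' \<cdot> s" "r \<cdot> r'"]) (use 1 2 in \<open>auto simp: cmp_reassoc[OF 2(9)]\<close>)
qed

lemma biproductE:
  assumes "biproduct A W X Y"
  obtains i1 i2 p1 p2 where "W \<in> Ob A" "X \<in> Ob A" "Y \<in> Ob A"
    "i1 \<in> arrows A" "i2 \<in> arrows A" "p1 \<in> arrows A" "p2 \<in> arrows A"
    "src A i1 = X" "tgt A i1 = W" "src A i2 = Y" "tgt A i2 = W"
    "src A p1 = W" "tgt A p1 = X" "src A p2 = W" "tgt A p2 = Y"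
    "p1 \<cdot> i1 = idm A X" "p2 \<cdot> i2 = idm A Y" "p1 \<cdot> i2 = zero_mor A Y X" "p2 \<cdot> i1 = zero_mor A X Y"
    "(i1 \<cdot> p1) \<boxplus> (i2 \<cdot> p2) = idm A W"
proof -
  obtain i1 i2 p1 p2 where "W \<in> Ob A" "X \<in> Ob A" "Y \<in> Ob A"
    "i1 \<in> hom A X W" "i2 \<in> hom A Y W" "p1 \<in> hom A W X" "p2 \<in> hom A W Y"
    "p1 \<cdot> i1 = idm A X" "p2 \<cdot> i2 = idm A Y" "p1 \<cdot> i2 = zero_mor A Y X" "p2 \<cdot> i1 = zero_mor A X Y"
    "(i1 \<cdot> p1) \<boxplus> (i2 \<cdot> p2) = idm A W"
    using assms unfolding biproduct_def by blast
  then show ?thesis by (intro that[of i1 i2 p1 p2]) auto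
qed

lemma biproductI:
  assumes "i1 \<in> arrows A" "i2 \<in> arrows A" "p1 \<in> arrows A" "p2 \<in> arrows A"
    "src A i1 = X" "tgt A i1 = W" "src A i2 = Y" "tgt A i2 = W"
    "src A p1 = W" "tgt A p1 = X" "src A p2 = W" "tgt A p2 = Y"
    "p1 \<cdot> i1 = idm A X" "p2 \<cdot> i2 = idm A Y" "p1 \<cdot> i2 = zero_mor A Y X" "p2 \<cdot> i1 = zero_mor A X Y"
    "(i1 \<cdot> p1) \<boxplus> (i2 \<cdot> p2) = idm A W"
  shows "biproduct A W X Y"
proof -
  have "W \<in> Ob A" "X \<in> Ob A" "Y \<in> Ob A" using assms arr_src_tgt by blast+
  then show ?thesis unfolding biproduct_def using assms
    by (intro conjI bexI[of _ i1] bexI[of _ i2] bexI[of _ p1] bexI[of _ p2]) auto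
qed

lemma biproduct_retract:
  assumes "biproduct A W X Y"
  shows "retract A X W" "retract A Y W"
  using assms by (elim biproductE; blast intro: retractI)+

lemma zero_object_arrow:
  assumes "zero_object A Z" "f \<in> arrows A"
  shows "src A f = Z \<or> tgt A f = Z \<Longrightarrow> f = zero_mor A (src A f) (tgt A f)"
proof -
  have Z: "idm A Z = zero_mor A Z Z" "Z \<in> Ob A" using assms zero_object_iff by auto
  assume "src A f = Z \<or> tgt A f = Z"
  then show ?thesis
    using idm_left[of f Z] idm_right[of f Z] Z assms(2) by auto
qed

lemma biproduct_zero: "Z \<in> Ob A \<Longrightarrow> zero_object A V \<Longrightarrow> biproduct A Z Z V"
  by (rule biproductI[of "idm A Z" "zero_mor A V Z" "idm A Z" "zero_mor A Z V"])
    (auto simp: zero_object_iff)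

lemma zero_object_isomorphic:
  "zero_object A X \<Longrightarrow> zero_object A Y \<Longrightarrow> isomorphic A X Y"
  unfolding isomorphic_def zero_object_iff
  by (auto intro!: exI[of _ "zero_mor A X Y"] is_isoI[of _ "zero_mor A Y X"])

text \<open>
  A zero object has zero projections, so the two maps of the other summand are mutually inverse.
\<close>

lemma biproduct_zero_isomorphic:
  assumes "biproduct A W X Y" "zero_object A X"
  shows "isomorphic A W Y"
proof -
  obtain i1 i2 p1 p2 where *: "W \<in> Ob A" "X \<in> Ob A" "Y \<in> Ob A"
    "i1 \<in> arrows A" "i2 \<in> arrows A" "p1 \<in> arrows A" "p2 \<in> arrows A"
    "src A i1 = X" "tgt A i1 = W" "src A i2 = Y" "tgt A i2 = W"
    "src A p1 = W" "tgt A p1 = X" "src A p2 = W" "tgt A p2 = Y"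
    "p1 \<cdot> i1 = idm A X" "p2 \<cdot> i2 = idm A Y" "p1 \<cdot> i2 = zero_mor A Y X" "p2 \<cdot> i1 = zero_mor A X Y"
    "(i1 \<cdot> p1) \<boxplus> (i2 \<cdot> p2) = idm A W"
    using assms(1) by (rule biproductE)
  have "p1 = zero_mor A W X" using zero_object_arrow[OF assms(2), of p1] * by simp
  then have "i2 \<cdot> p2 = idm A W" using * by simp
  then show ?thesis using * is_isoI[of p2 i2 W Y] unfolding isomorphic_def by auto
qed

lemma biproduct_isomorphic:
  assumes W: "biproduct A W X Y" and W': "biproduct A W' X Y'" and "isomorphic A Y Y'"
  shows "isomorphic A W W'"
proof -
  obtain i1 i2 p1 p2 where *: "W \<in> Ob A" "X \<in> Ob A" "Y \<in> Ob A"
    "i1 \<in> arrows A" "i2 \<in> arrows A" "p1 \<in> arrows A" "p2 \<in> arrows A"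
    "src A i1 = X" "tgt A i1 = W" "src A i2 = Y" "tgt A i2 = W"
    "src A p1 = W" "tgt A p1 = X" "src A p2 = W" "tgt A p2 = Y"
    and p: "p1 \<cdot> i1 = idm A X" "p2 \<cdot> i2 = idm A Y" "p1 \<cdot> i2 = zero_mor A Y X" "p2 \<cdot> i1 = zero_mor A X Y"
    "(i1 \<cdot> p1) \<boxplus> (i2 \<cdot> p2) = idm A W"
    using assms(1) by (rule biproductE)
  obtain j1 j2 q1 q2 where **: "W' \<in> Ob A" "X \<in> Ob A" "Y' \<in> Ob A"
    "j1 \<in> arrows A" "j2 \<in> arrows A" "q1 \<in> arrows A" "q2 \<in> arrows A"
    "src A j1 = X" "tgt A j1 = W'" "src A j2 = Y'" "tgt A j2 = W'"
    "src A q1 = W'" "tgt A q1 = X" "src A q2 = W'" "tgt A q2 = Y'"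
    and q: "q1 \<cdot> j1 = idm A X" "q2 \<cdot> j2 = idm A Y'" "q1 \<cdot> j2 = zero_mor A Y' X" "q2 \<cdot> j1 = zero_mor A X Y'"
    "(j1 \<cdot> q1) \<boxplus> (j2 \<cdot> q2) = idm A W'"
    using assms(2) by (rule biproductE)
  obtain f where "is_iso A Y Y' f" using assms(3) unfolding isomorphic_def by blast
  then obtain g where f: "f \<in> arrows A" "src A f = Y" "tgt A f = Y'" "g \<in> arrows A" "src A g = Y'"
    "tgt A g = Y" and fg: "g \<cdot> f = idm A Y" "f \<cdot> g = idm A Y'" using is_isoE * ** by metis
  note re = p(1-4)[THEN cmp_reassoc] q(1-4)[THEN cmp_reassoc] fg[THEN cmp_reassoc]
  have "is_iso A W W' ((j1 \<cdot> p1) \<boxplus> (j2 \<cdot> (f \<cdot> p2)))"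
    by (rule is_isoI[of _ "(i1 \<cdot> q1) \<boxplus> (i2 \<cdot> (g \<cdot> q2))"]) (use * ** f p q in \<open>simp_all add: re\<close>)
  then show ?thesis using * ** unfolding isomorphic_def by blast
qed

lemma finite_direct_sum_Ob: "finite_direct_sum A W Xs \<Longrightarrow> W \<in> Ob A \<and> set Xs \<subseteq> Ob A"
proof (induction Xs arbitrary: W)
  case Nil then show ?case by (simp add: zero_object_iff)
next
  case (Cons X Xs)
  then obtain V where "biproduct A W X V" "finite_direct_sum A V Xs" by auto
  then show ?case using Cons.IH unfolding biproduct_def by auto
qed

lemma finite_direct_sum_retract: "finite_direct_sum A W Xs \<Longrightarrow> X \<in> set Xs \<Longrightarrow> retract A X W"
proof (induction Xs arbitrary: W)
  case (Cons Z Xs)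
  then obtain V where "biproduct A W Z V" "finite_direct_sum A V Xs" by auto
  then show ?case using Cons biproduct_retract retract_trans by (metis set_ConsD)
qed simp

end

lemma (in linear_functor_between) pres_zero_object: "zero_object A X \<Longrightarrow> zero_object B (Fo X)"
  using pres_idm[of X] by (simp add: A.zero_object_iff B.zero_object_iff)

section \<open>Finite-dimensionality\<close>

text \<open>
  By Gaussian elimination: a vector with nonzero entry at the new coordinate \<open>b\<close> serves as pivot and
  clears this coordinate from the other vectors, to which the induction hypothesis applies.
\<close>

lemma linear_dependency:
  fixes a :: "'j \<Rightarrow> 'b \<Rightarrow> 'k::field"
  assumes "finite B" "finite J" "card B < card J"
  shows "\<exists>c. (\<exists>j\<in>J. c j \<noteq> 0) \<and> (\<forall>b\<in>B. (\<Sum>j\<in>J. c j * a j b) = 0)"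
  using assms
proof (induction B arbitrary: J a rule: finite_induct)
  case empty
  then have "J \<noteq> {}" by auto
  then show ?case by (intro exI[of _ "\<lambda>_. 1"]) auto
next
  case (insert b B)
  show ?case
  proof (cases "\<forall>j\<in>J. a j b = 0")
    case True
    then show ?thesis using insert.IH[of J a] insert.prems insert.hyps by force
  next
    case False
    then obtain j0 where j0: "j0 \<in> J" "a j0 b \<noteq> 0" by blast
    let ?J = "J - {j0}"
    define a' where "a' = (\<lambda>j x. a j x - a j b / a j0 b * a j0 x)"
    have "card B < card ?J" using insert j0 by simp
    then obtain c where c: "\<exists>j\<in>?J. c j \<noteq> 0" "\<forall>x\<in>B. (\<Sum>j\<in>?J. c j * a' j x) = 0"
      using insert.IH[of ?J a'] insert.prems by auto
    define d where "d = (\<lambda>j. if j = j0 then - (\<Sum>j\<in>?J. c j * a j b / a j0 b) else c j)"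
    have "(\<Sum>j\<in>J. d j * a j x) = (\<Sum>j\<in>?J. c j * a' j x)" for x
    proof -
      have "(\<Sum>j\<in>J. d j * a j x) = d j0 * a j0 x + (\<Sum>j\<in>?J. d j * a j x)"
        using j0 insert.prems by (simp add: sum.remove)
      also have "(\<Sum>j\<in>?J. d j * a j x) = (\<Sum>j\<in>?J. c j * a j x)"
        by (rule sum.cong) (auto simp: d_def)
      also have "d j0 * a j0 x = - (\<Sum>j\<in>?J. c j * (a j b / a j0 b * a j0 x))"
        by (simp add: d_def sum_distrib_right mult.assoc)
      finally show ?thesis
        by (simp add: a'_def right_diff_distrib sum_subtractf)
    qed
    moreover have "(\<Sum>j\<in>?J. c j * a' j b) = 0" using j0 by (simp add: a'_def)
    moreover have "\<exists>j\<in>J. d j \<noteq> 0" using c(1) by (auto simp: d_def)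
    ultimately show ?thesis using c(2) by (intro exI[of _ d]) auto
  qed
qed

primrec mor_sum :: "('o, 'm, 'k) lincat \<Rightarrow> 'o \<Rightarrow> 'o \<Rightarrow> (nat \<Rightarrow> 'm) \<Rightarrow> nat \<Rightarrow> 'm" where
  "mor_sum A X Y x 0 = zero_mor A X Y"
| "mor_sum A X Y x (Suc n) = mor_sum A X Y x n \<boxplus>\<^bsub>A\<^esub> x n"

context linear_category
begin

lemma mor_sum_arr:
  assumes "X \<in> Ob A" "Y \<in> Ob A" "\<And>k. k < n \<Longrightarrow> x k \<in> hom A X Y"
  shows "mor_sum A X Y x n \<in> hom A X Y"
  using assms by (induction n) auto

text \<open>
  Coordinates with respect to a spanning list need be neither unique nor linear in the morphism. It
  is enough that the map \<open>L\<close> from coordinates to morphisms is linear: a relation between chosen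
  coordinate vectors is carried to a relation between the morphisms.
\<close>

lemma spanned_mor_sum_dependency:
  assumes X: "X \<in> Ob A" and Y: "Y \<in> Ob A" and bs: "set bs \<subseteq> hom A X Y"
    and span: "\<forall>f\<in>hom A X Y. \<exists>c. f = foldr (\<lambda>b g. c b \<odot> b \<boxplus> g) bs (zero_mor A X Y)"
    and x: "\<And>k. k \<le> length bs \<Longrightarrow> x k \<in> hom A X Y"
  shows "\<exists>c. (\<exists>k\<le>length bs. c k \<noteq> 0) \<and> mor_sum A X Y (\<lambda>k. c k \<odot> x k) (Suc (length bs)) = zero_mor A X Y"
proof -
  define L where "L = (\<lambda>c. foldr (\<lambda>b g. c b \<odot> b \<boxplus> g) bs (zero_mor A X Y))"
  have L_gen: "foldr (\<lambda>b g. c b \<odot> b \<boxplus> g) cs (zero_mor A X Y) \<in> hom A X Y" if "set cs \<subseteq> hom A X Y" for c cs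
    using that X Y by (induction cs) auto
  have L_add: "L (\<lambda>b. c b + d b) = L c \<boxplus> L d" for c d
    unfolding L_def using bs
  proof (induction bs)
    case (Cons b bs)
    then show ?case using X Y L_gen[of bs c] L_gen[of bs d]
      by (simp add: plus_scale' plus_left_comm[of "d b \<odot> b"])
  qed (use X Y in auto)
  have L_scale: "L (\<lambda>b. t * c b) = t \<odot> L c" for t c
    unfolding L_def using bs
  proof (induction bs)
    case (Cons b bs)
    then show ?case using X Y L_gen[of bs c] by simp
  qed (use X Y in auto)
  have L_zero: "L c = zero_mor A X Y" if "\<forall>b\<in>set bs. c b = 0" for c
    unfolding L_def using bs that
    by (induction bs) (use X Y in auto)
  have "\<forall>k. \<exists>a. k \<le> length bs \<longrightarrow> x k = L a" using span x unfolding L_def by blast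
  then obtain a where a: "\<And>k. k \<le> length bs \<Longrightarrow> x k = L (a k)" by metis
  obtain c where c: "\<exists>k\<in>{..length bs}. c k \<noteq> 0"
    "\<forall>b\<in>set bs. (\<Sum>k\<in>{..length bs}. c k * a k b) = 0"
    using linear_dependency[of "set bs" "{..length bs}" a] card_length[of bs] by auto
  have "mor_sum A X Y (\<lambda>k. c k \<odot> x k) n = L (\<lambda>b. \<Sum>k<n. c k * a k b)" if "n \<le> Suc (length bs)" for n
    using that
  proof (induction n)
    case 0
    then show ?case using L_zero[of "\<lambda>b. 0"] by simp
  next
    case (Suc n)
    then show ?case using a[of n] by (simp add: L_add L_scale)
  qed
  from this[of "Suc (length bs)"] have "mor_sum A X Y (\<lambda>k. c k \<odot> x k) (Suc (length bs)) = zero_mor A X Y"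
    using L_zero c(2) by (simp add: lessThan_Suc_atMost)
  then show ?thesis using c(1) by auto
qed

end

context finitary_category
begin

lemma mor_sum_dependency:
  assumes "X \<in> Ob A" "Y \<in> Ob A"
  obtains N where "\<And>x. (\<And>k. k < N \<Longrightarrow> x k \<in> hom A X Y) \<Longrightarrow>
    \<exists>c. (\<exists>k<N. c k \<noteq> 0) \<and> mor_sum A X Y (\<lambda>k. c k \<odot> x k) N = zero_mor A X Y"
proof -
  obtain bs where bs: "set bs \<subseteq> hom A X Y"
    "\<forall>f\<in>hom A X Y. \<exists>c. f = foldr (\<lambda>b g. c b \<odot> b \<boxplus> g) bs (zero_mor A X Y)"
    using hom_finite_dim[OF assms] by blast
  show ?thesis
    by (rule that[of "Suc (length bs)"])
      (use spanned_mor_sum_dependency[OF assms bs] in \<open>simp add: less_Suc_eq_le del: mor_sum.simps\<close>)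
qed

end

section \<open>Endomorphisms of indecomposable objects\<close>

text \<open>
  The value of a polynomial at the endomorphism \<open>f\<close>, computed by Horner's scheme.
\<close>

definition mor_poly :: "('o, 'm, 'k::comm_ring_1) lincat \<Rightarrow> 'm \<Rightarrow> 'k poly \<Rightarrow> 'm" where
  "mor_poly A f p = fold_coeffs (\<lambda>a g. a \<odot>\<^bsub>A\<^esub> idm A (src A f) \<boxplus>\<^bsub>A\<^esub> (f \<cdot>\<^bsub>A\<^esub> g)) p (zero_mor A (src A f) (src A f))"

context linear_category
begin

context
  fixes f :: 'm and X :: 'o
  assumes f: "f \<in> arrows A" "src A f = X" "tgt A f = X"
begin

lemma X_in_Ob: "X \<in> Ob A"
  using f by auto

lemma mor_poly_0 [simp]: "mor_poly A f 0 = zero_mor A X X"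
  using f by (simp add: mor_poly_def)

lemma mor_poly_pCons [simp]: "mor_poly A f (pCons a p) = a \<odot> idm A X \<boxplus> f \<cdot> mor_poly A f p"
proof (cases "a = 0 \<and> p = 0")
  case True
  then show ?thesis using f X_in_Ob by simp
next
  case False
  then show ?thesis
    unfolding mor_poly_def using f
    by (cases "p = 0") (auto simp: fold_coeffs_pCons_coeff_not_0_eq fold_coeffs_pCons_not_0_0_eq)
qed

lemma mor_poly_arr [simp]:
  "mor_poly A f p \<in> arrows A \<and> src A (mor_poly A f p) = X \<and> tgt A (mor_poly A f p) = X"
  using f X_in_Ob by (induction p) auto

lemma mor_poly_add: "mor_poly A f (p + q) = mor_poly A f p \<boxplus> mor_poly A f q"
proof (induction p q rule: poly_induct2)
  case (pCons a p b q)
  then show ?case using f X_in_Ob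
    by (simp add: plus_scale' plus_left_comm[of "b \<odot> idm A X"])
qed (use X_in_Ob in simp)

lemma mor_poly_smult: "mor_poly A f (smult c p) = c \<odot> mor_poly A f p"
  using f X_in_Ob by (induction p) auto

lemma mor_poly_mult: "mor_poly A f (p * q) = mor_poly A f p \<cdot> mor_poly A f q"
  using f X_in_Ob by (induction p) (auto simp: mor_poly_add mor_poly_smult)

lemma mor_poly_1: "mor_poly A f 1 = idm A X"
  using f X_in_Ob by (simp add: one_pCons)

lemma mor_poly_X: "mor_poly A f [:0, 1:] = f"
  using f X_in_Ob by simp

lemma mor_poly_inverse:
  assumes "mor_poly A f (p * q) = idm A X"
  shows "is_iso A X X (mor_poly A f p)"
  by (rule is_isoI[of _ "mor_poly A f q"])
    (use assms mor_poly_mult[of p q] mor_poly_mult[of q p] in \<open>simp_all add: mult.commute\<close>)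

end

lemma idempotent_complement:
  assumes "e \<in> arrows A" "src A e = X" "tgt A e = X" "e \<cdot> e = e"
  shows "(idm A X \<boxplus> (-1) \<odot> e) \<cdot> (idm A X \<boxplus> (-1) \<odot> e) = idm A X \<boxplus> (-1) \<odot> e"
proof -
  have "X \<in> Ob A" using assms by auto
  then show ?thesis using assms by simp
qed

end

text \<open>
  A constant multiple of \<open>q\<close> is congruent to \<open>1\<close> modulo \<open>x\<close>. Inserting this into a Bezout identity
  for \<open>x\<^sup>n\<close> and \<open>q\<close> gives one for the next power of \<open>x\<close>.
\<close>

lemma power_X_bezout:
  fixes q :: "'k::field poly"
  assumes "poly q 0 \<noteq> 0"
  shows "\<exists>a b. a * [:0, 1:] ^ n + b * q = 1"
proof (induction n)
  case 0
  show ?case by (intro exI[of _ 1] exI[of _ 0]) simp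
next
  case (Suc n)
  then obtain a b where ab: "a * [:0, 1:] ^ n + b * q = 1" by blast
  let ?c = "[:inverse (poly q 0):]"
  have "poly (1 - ?c * q) 0 = 0" using assms by simp
  then obtain r where r: "1 - ?c * q = [:0, 1:] * r"
    unfolding poly_eq_0_iff_dvd minus_zero by (rule dvdE)
  have eq: "1 = (a * r) * (x * y) + (a * y * c + b) * q"
    if "a * y + b * q = 1" "1 - c * q = x * r" for x y c :: "'k poly"
  proof -
    have "(a * r) * (x * y) + (a * y * c + b) * q = a * y * (x * r + c * q) + b * q"
      by (simp add: algebra_simps)
    also have "x * r + c * q = 1" using that(2) by (simp add: algebra_simps)
    finally show ?thesis using that(1) by simp
  qed
  show ?case using eq[OF ab r] by (metis power_Suc)
qed

context finitary_category
begin

lemma split_idempotent: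
  assumes "e \<in> arrows A" "src A e = X" "tgt A e = X" "e \<cdot> e = e"
  obtains Y r s where "r \<in> arrows A" "s \<in> arrows A" "src A r = X" "tgt A r = Y" "src A s = Y"
    "tgt A s = X" "s \<cdot> r = e" "r \<cdot> s = idm A Y"
proof -
  have "X \<in> Ob A" using assms by auto
  moreover have "e \<in> hom A X X" using assms \<open>X \<in> Ob A\<close> by simp
  ultimately obtain Y r s where "Y \<in> Ob A" "r \<in> hom A X Y" "s \<in> hom A Y X" "s \<cdot> r = e" "r \<cdot> s = idm A Y"
    using idempotents_split assms(4) by blast
  then show ?thesis using \<open>X \<in> Ob A\<close> by (intro that[of r s Y]) auto
qed

text \<open>
  The complement of a retract \<open>Y\<close> is cut out by the idempotent \<open>1 - s r\<close>.
\<close>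

lemma split_idempotent_biproduct:
  assumes "s \<in> arrows A" "r \<in> arrows A" "src A s = Y" "tgt A s = X" "src A r = X" "tgt A r = Y"
    and rs: "r \<cdot> s = idm A Y"
  obtains Z r' s' where "r' \<in> arrows A" "s' \<in> arrows A" "src A r' = X" "tgt A r' = Z" "src A s' = Z"
    "tgt A s' = X" "r' \<cdot> s' = idm A Z" "s' \<cdot> r' = idm A X \<boxplus> (-1) \<odot> (s \<cdot> r)" "biproduct A X Y Z"
proof -
  have X: "X \<in> Ob A" "Y \<in> Ob A" using assms by auto
  have e: "(s \<cdot> r) \<cdot> (s \<cdot> r) = s \<cdot> r" using assms by (simp add: cmp_reassoc[OF rs])
  obtain Z r' s' where Z: "r' \<in> arrows A" "s' \<in> arrows A" "src A r' = X" "tgt A r' = Z" "src A s' = Z"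
    "tgt A s' = X" "s' \<cdot> r' = idm A X \<boxplus> (-1) \<odot> (s \<cdot> r)" "r' \<cdot> s' = idm A Z"
  proof (rule split_idempotent)
    show "(idm A X \<boxplus> (-1) \<odot> (s \<cdot> r)) \<cdot> (idm A X \<boxplus> (-1) \<odot> (s \<cdot> r)) = idm A X \<boxplus> (-1) \<odot> (s \<cdot> r)"
      by (rule idempotent_complement[OF _ _ _ e]) (use assms in auto)
  qed (use assms X in auto)
  have Z': "Z \<in> Ob A" using Z by auto
  have "r \<cdot> s' = r \<cdot> ((s' \<cdot> r') \<cdot> s')" using Z(1-6,8) Z' assms by simp
  also have "\<dots> = zero_mor A Z Y"
    unfolding Z(7) using Z(1-6) Z' X assms by (simp add: cmp_reassoc[OF rs])
  finally have 1: "r \<cdot> s' = zero_mor A Z Y" .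
  have "r' \<cdot> s = r' \<cdot> ((s' \<cdot> r') \<cdot> s)" using Z(1-6) Z' assms by (simp add: cmp_reassoc[OF Z(8)])
  also have "\<dots> = zero_mor A Y Z"
    unfolding Z(7) using Z(1-6) Z' X assms by simp
  finally have 2: "r' \<cdot> s = zero_mor A Y Z" .
  have "biproduct A X Y Z"
    by (rule biproductI[of s s' r r']) (use Z assms 1 2 X in \<open>simp_all\<close>)
  then show ?thesis using that Z by blast
qed

lemma direct_summand_iff_retract: "direct_summand A X W \<longleftrightarrow> retract A X W"
proof
  show "direct_summand A X W \<Longrightarrow> retract A X W"
    unfolding direct_summand_def using biproduct_retract by blast
  assume "retract A X W"
  then obtain s r where "s \<in> arrows A" "r \<in> arrows A" "src A s = X" "tgt A s = W"
    "src A r = W" "tgt A r = X" "r \<cdot> s = idm A X" by (rule retractE)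
  then obtain Y where "biproduct A W X Y" by (rule split_idempotent_biproduct)
  then show "direct_summand A X W" unfolding direct_summand_def by blast
qed

text \<open>
  Splitting both \<open>e\<close> and \<open>1 - e\<close> decomposes \<open>Z\<close> into two summands, one of which has to vanish.
\<close>

lemma indecomposable_idempotent:
  assumes Z: "indecomposable A Z" and e: "e \<in> arrows A" "src A e = Z" "tgt A e = Z" "e \<cdot> e = e"
  shows "e = zero_mor A Z Z \<or> e = idm A Z"
proof -
  have ZO: "Z \<in> Ob A" using e by auto
  obtain Y r s where Y: "r \<in> arrows A" "s \<in> arrows A" "src A r = Z" "tgt A r = Y" "src A s = Y"
    "tgt A s = Z" "s \<cdot> r = e" "r \<cdot> s = idm A Y"
    using split_idempotent[OF e] by metis
  obtain Y' r' s' where Y': "r' \<in> arrows A" "s' \<in> arrows A" "src A r' = Z" "tgt A r' = Y'" "src A s' = Y'"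
    "tgt A s' = Z" "r' \<cdot> s' = idm A Y'" "s' \<cdot> r' = idm A Z \<boxplus> (-1) \<odot> (s \<cdot> r)" "biproduct A Z Y Y'"
    using split_idempotent_biproduct[of s r Y Z] Y by metis
  have "zero_object A Y \<or> zero_object A Y'"
    using Z Y'(9) unfolding indecomposable_def by blast
  then show ?thesis
  proof
    assume "zero_object A Y"
    then have "r = zero_mor A Z Y" using zero_object_arrow[of Y r] Y by auto
    then show ?thesis using Y ZO by simp
  next
    assume "zero_object A Y'"
    then have "r' = zero_mor A Z Y'" using zero_object_arrow[of Y' r'] Y' by auto
    then have "zero_mor A Z Z = idm A Z \<boxplus> (-1) \<odot> e" using Y' Y(7) ZO by simp
    then show ?thesis using diff_zero_iff[of "idm A Z" e] e ZO by auto
  qed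
qed

text \<open>
  The powers of \<open>f\<close> lie in a finite-dimensional space and so satisfy a linear relation.
\<close>

lemma annihilating_poly:
  assumes f: "f \<in> arrows A" "src A f = X" "tgt A f = X"
  shows "\<exists>p. p \<noteq> 0 \<and> mor_poly A f p = zero_mor A X X"
proof -
  have X: "X \<in> Ob A" using f by auto
  obtain N where N: "\<And>x. (\<And>k. k < N \<Longrightarrow> x k \<in> hom A X X) \<Longrightarrow>
    \<exists>c. (\<exists>k<N. c k \<noteq> 0) \<and> mor_sum A X X (\<lambda>k. c k \<odot> x k) N = zero_mor A X X"
    using mor_sum_dependency[OF X X] by blast
  obtain c where c: "\<exists>k<N. c k \<noteq> 0"
    "mor_sum A X X (\<lambda>k. c k \<odot> mor_poly A f (monom 1 k)) N = zero_mor A X X"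
    using N[of "\<lambda>k. mor_poly A f (monom 1 k)"] mor_poly_arr[OF f] X by auto
  have "mor_sum A X X (\<lambda>k. c k \<odot> mor_poly A f (monom 1 k)) n = mor_poly A f (\<Sum>k<n. monom (c k) k)" for n
    by (induction n) (simp_all add: mor_poly_0[OF f] mor_poly_add[OF f] mor_poly_smult[OF f, symmetric] smult_monom)
  moreover have "(\<Sum>k<N. monom (c k) k) \<noteq> 0"
  proof
    assume eq: "(\<Sum>k<N. monom (c k) k) = 0"
    obtain k where k: "k < N" "c k \<noteq> 0" using c(1) by blast
    have "coeff (\<Sum>k<N. monom (c k) k) k = c k" using k(1) by (simp add: coeff_sum if_distrib sum.delta)
    then show False using eq k by simp
  qed
  ultimately show ?thesis using c(2) by metis
qed

text \<open>
  This says that the endomorphism ring of \<open>Z\<close> is local. Some polynomial \<open>x\<^sup>n q\<close>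
  with \<open>n > 0\<close> and \<open>q(0) \<noteq> 0\<close> annihilates \<open>f\<close>. By the Chinese remainder theorem some multiple of \<open>q\<close> becomes an idempotent
  at \<open>f\<close>. If the idempotent is \<open>0\<close>, then \<open>f\<^sup>n\<close> is invertible; if it is \<open>1\<close>, then \<open>f\<^sup>n = 0\<close>, and
  \<open>1 - f\<close> is invertible since \<open>1 - x\<close> is prime to \<open>x\<^sup>n\<close>.
\<close>

lemma indecomposable_iso_or_complement_iso:
  assumes Z: "indecomposable A Z" and f: "f \<in> arrows A" "src A f = Z" "tgt A f = Z"
  shows "is_iso A Z Z f \<or> is_iso A Z Z (idm A Z \<boxplus> (-1) \<odot> f)"
proof -
  have ZO: "Z \<in> Ob A" using f by auto
  let ?x = "[:0, 1:] :: 'c poly" and ?ev = "mor_poly A f"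
  note ev = mor_poly_mult[OF f] mor_poly_add[OF f]
  obtain p where p: "p \<noteq> 0" "?ev p = zero_mor A Z Z" using annihilating_poly[OF f] by blast
  obtain n q where q: "p = ?x ^ n * q" "poly q 0 \<noteq> 0"
    using order_decomp[OF p(1), of 0] by (auto simp: poly_eq_0_iff_dvd)
  (* One factor x more than p has makes the exponent positive. *)
  have zero: "?ev (r * (?x ^ Suc n * q)) = zero_mor A Z Z" for r
  proof -
    have "r * (?x ^ Suc n * q) = (r * ?x) * p" using q(1) by (simp only: power_Suc mult_ac)
    then have "?ev (r * (?x ^ Suc n * q)) = ?ev (r * ?x) \<cdot> ?ev p" by (simp only: ev)
    then show ?thesis using p(2) mor_poly_arr[OF f, of "r * ?x"] ZO by simp
  qed
  obtain a b where ab: "a * ?x ^ Suc n + b * q = 1" using power_X_bezout[OF q(2)] by blast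
  have "b * q = 1 - a * ?x ^ Suc n" using ab by (metis add_diff_cancel_left')
  then have "(b * q) * (b * q) = b * q * (1 - a * ?x ^ Suc n)" by (rule arg_cong)
  also have "b * q * (1 - a * y) = b * q + (- (a * b)) * (y * q)" for y by (simp add: algebra_simps)
  finally have "?ev (b * q) \<cdot> ?ev (b * q) = ?ev (b * q)"
    using zero[of "- (a * b)"] ev mor_poly_arr[OF f] by (metis plus_zero_right)
  then have "?ev (b * q) = zero_mor A Z Z \<or> ?ev (b * q) = idm A Z"
    using indecomposable_idempotent[OF Z] mor_poly_arr[OF f] by blast
  then show ?thesis
  proof
    assume "?ev (b * q) = zero_mor A Z Z"
    then have "?ev (a * ?x ^ Suc n) = idm A Z"
      using ab ev(2)[of "a * ?x ^ Suc n" "b * q"] mor_poly_1[OF f] mor_poly_arr[OF f]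
      by (metis plus_zero_right)
    moreover have "a * ?x ^ Suc n = ?x * (a * ?x ^ n)" by (simp only: power_Suc mult_ac)
    ultimately show ?thesis
      using mor_poly_inverse[OF f, of ?x "a * ?x ^ n"] mor_poly_X[OF f] by metis
  next
    assume one: "?ev (b * q) = idm A Z"
    obtain c d where cd: "c * ?x ^ Suc n + d * (1 - ?x) = 1"
      using power_X_bezout[of "1 - ?x" "Suc n"] by auto
    have "(1 - ?x) * (d * (b * q)) + (c * b) * (?x ^ Suc n * q) = (c * ?x ^ Suc n + d * (1 - ?x)) * (b * q)"
      by (simp only: algebra_simps)
    then have "(1 - ?x) * (d * (b * q)) + (c * b) * (?x ^ Suc n * q) = b * q" using cd by simp
    then have "?ev ((1 - ?x) * (d * (b * q))) = idm A Z"
      using one zero[of "c * b"] ev(2) mor_poly_arr[OF f] by (metis plus_zero_right)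
    then have "is_iso A Z Z (?ev (1 - ?x))" by (rule mor_poly_inverse[OF f])
    moreover have "?ev (1 - ?x) = idm A Z \<boxplus> (-1) \<odot> f"
    proof -
      have "1 - ?x = 1 + smult (-1) ?x" by simp
      then show ?thesis by (simp only: ev mor_poly_smult[OF f] mor_poly_1[OF f] mor_poly_X[OF f])
    qed
    ultimately show ?thesis by simp
  qed
qed

text \<open>
  Multiplication by the inverse of \<open>f + g\<close> reduces this to two summands with sum \<open>1\<close>.
\<close>

lemma indecomposable_sum_iso:
  assumes Z: "indecomposable A Z"
    and fg: "f \<in> arrows A" "src A f = Z" "tgt A f = Z" "g \<in> arrows A" "src A g = Z" "tgt A g = Z"
    and iso: "is_iso A Z Z (f \<boxplus> g)"
  shows "is_iso A Z Z f \<or> is_iso A Z Z g"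
proof -
  have ZO: "Z \<in> Ob A" using fg by auto
  obtain w where w: "w \<in> arrows A" "src A w = Z" "tgt A w = Z" "w \<cdot> (f \<boxplus> g) = idm A Z"
    "(f \<boxplus> g) \<cdot> w = idm A Z" using is_isoE[OF iso ZO ZO] by metis
  have "w \<cdot> g = idm A Z \<boxplus> (-1) \<odot> (w \<cdot> f)"
  proof -
    have "w \<cdot> g = (w \<cdot> f \<boxplus> w \<cdot> g) \<boxplus> (-1) \<odot> (w \<cdot> f)" using w(1-3) fg by simp
    also have "w \<cdot> f \<boxplus> w \<cdot> g = idm A Z" using w fg by simp
    finally show ?thesis .
  qed
  then have "is_iso A Z Z (w \<cdot> f) \<or> is_iso A Z Z (w \<cdot> g)"
    using indecomposable_iso_or_complement_iso[OF Z, of "w \<cdot> f"] w fg by auto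
  moreover have "is_iso A Z Z h" if "is_iso A Z Z (w \<cdot> h)" "h \<in> arrows A" "src A h = Z" "tgt A h = Z" for h
  proof -
    have "is_iso A Z Z ((f \<boxplus> g) \<cdot> (w \<cdot> h))" using is_iso_cmp[OF that(1) iso] ZO by simp
    moreover have "(f \<boxplus> g) \<cdot> (w \<cdot> h) = h"
      using cmp_reassoc[OF w(5), of h] that w fg by (simp del: cmp_plus_l)
    ultimately show ?thesis by simp
  qed
  ultimately show ?thesis using fg by blast
qed

section \<open>Decomposition into indecomposable objects\<close>

lemma retract_if_iso_factors:
  assumes "is_iso A Z Z (h \<cdot> g)" "g \<in> arrows A" "h \<in> arrows A" "src A g = Z" "tgt A g = W"
    "src A h = W" "tgt A h = Z"
  shows "retract A Z W"
proof -
  have ZO: "Z \<in> Ob A" using assms by auto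
  obtain w where w: "w \<in> arrows A" "src A w = Z" "tgt A w = Z" "w \<cdot> (h \<cdot> g) = idm A Z"
    using is_isoE[OF assms(1) ZO ZO] by metis
  show ?thesis by (rule retractI[of g "w \<cdot> h"]) (use assms w in simp_all)
qed

text \<open>
  The identity of \<open>Z\<close> is a sum of one endomorphism through \<open>U\<close> and one through \<open>V\<close>. By locality one
  of them is invertible.
\<close>

lemma indecomposable_retract_biproduct:
  assumes Z: "indecomposable A Z" and ZW: "retract A Z W" and W: "biproduct A W U V"
  shows "retract A Z U \<or> retract A Z V"
proof -
  obtain s r where sr: "Z \<in> Ob A" "W \<in> Ob A" "s \<in> arrows A" "r \<in> arrows A" "src A s = Z" "tgt A s = W"
    "src A r = W" "tgt A r = Z" "r \<cdot> s = idm A Z" using ZW by (rule retractE)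
  obtain i1 i2 p1 p2 where *: "W \<in> Ob A" "U \<in> Ob A" "V \<in> Ob A"
    "i1 \<in> arrows A" "i2 \<in> arrows A" "p1 \<in> arrows A" "p2 \<in> arrows A"
    "src A i1 = U" "tgt A i1 = W" "src A i2 = V" "tgt A i2 = W"
    "src A p1 = W" "tgt A p1 = U" "src A p2 = W" "tgt A p2 = V"
    and sum: "(i1 \<cdot> p1) \<boxplus> (i2 \<cdot> p2) = idm A W"
    using W by (rule biproductE)
  have "r \<cdot> ((i1 \<cdot> p1 \<boxplus> i2 \<cdot> p2) \<cdot> s) = idm A Z" unfolding sum using sr by simp
  then have "(r \<cdot> i1) \<cdot> (p1 \<cdot> s) \<boxplus> (r \<cdot> i2) \<cdot> (p2 \<cdot> s) = idm A Z" using * sr(1-8) by simp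
  moreover have "is_iso A Z Z (idm A Z)" using is_isoI[of "idm A Z" "idm A Z"] sr(1) by simp
  ultimately have "is_iso A Z Z ((r \<cdot> i1) \<cdot> (p1 \<cdot> s)) \<or> is_iso A Z Z ((r \<cdot> i2) \<cdot> (p2 \<cdot> s))"
    using indecomposable_sum_iso[OF Z, of "(r \<cdot> i1) \<cdot> (p1 \<cdot> s)" "(r \<cdot> i2) \<cdot> (p2 \<cdot> s)"] * sr(1-8)
    by (simp del: assoc)
  then show ?thesis
    using retract_if_iso_factors[of Z "r \<cdot> i1" "p1 \<cdot> s" U] retract_if_iso_factors[of Z "r \<cdot> i2" "p2 \<cdot> s" V]
      * sr by auto
qed

text \<open>
  The largest \<open>n\<close> that occurs here measures the size of \<open>X\<close> in place of the number of its
  indecomposable summands.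
\<close>

definition orthogonal_idempotents :: "'a \<Rightarrow> nat \<Rightarrow> (nat \<Rightarrow> 'b) \<Rightarrow> bool" where
  "orthogonal_idempotents X n e \<longleftrightarrow> (\<forall>k<n. e k \<in> hom A X X \<and> e k \<noteq> zero_mor A X X \<and>
    (\<forall>l<n. e k \<cdot> e l = (if k = l then e k else zero_mor A X X)))"

text \<open>
  Orthogonal nonzero idempotents are linearly independent: multiplication by \<open>e l\<close> isolates the
  \<open>l\<close>-th term of a relation.
\<close>

lemma orthogonal_idempotents_bounded:
  assumes X: "X \<in> Ob A"
  obtains N where "\<And>n e. orthogonal_idempotents X n e \<Longrightarrow> n \<le> N"
proof -
  obtain N where N: "\<And>x. (\<And>k. k < N \<Longrightarrow> x k \<in> hom A X X) \<Longrightarrow>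
    \<exists>c. (\<exists>k<N. c k \<noteq> 0) \<and> mor_sum A X X (\<lambda>k. c k \<odot> x k) N = zero_mor A X X"
    using mor_sum_dependency[OF X X] by blast
  have "n \<le> N" if e: "orthogonal_idempotents X n e" for n e
  proof (rule ccontr)
    assume "\<not> n \<le> N"
    then have n: "N < n" by simp
    have eX: "e k \<in> arrows A" "src A (e k) = X" "tgt A (e k) = X" "e k \<noteq> zero_mor A X X" if "k < n" for k
      using e that X unfolding orthogonal_idempotents_def by auto
    have ee: "e k \<cdot> e l = (if k = l then e k else zero_mor A X X)" if "k < n" "l < n" for k l
      using e that unfolding orthogonal_idempotents_def by blast
    obtain c where c: "\<exists>k<N. c k \<noteq> 0" "mor_sum A X X (\<lambda>k. c k \<odot> e k) N = zero_mor A X X"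
      using N[of e] eX n X by auto
    obtain l where l: "l < N" "c l \<noteq> 0" using c(1) by blast
    have sum: "mor_sum A X X (\<lambda>k. c k \<odot> e k) m \<in> hom A X X" if "m \<le> N" for m
      using mor_sum_arr[of X X m] X eX n that by auto
    have "mor_sum A X X (\<lambda>k. c k \<odot> e k) m \<cdot> e l = (if l < m then c l \<odot> e l else zero_mor A X X)"
      if "m \<le> N" for m
      using that
    proof (induction m)
      case (Suc m)
      then show ?case using X eX[of m] eX[of l] ee[of m l] sum[of m] n l
        by (auto simp: less_Suc_eq)
    qed (use X eX[of l] l n in simp)
    from this[of N] have "c l \<odot> e l = zero_mor A X X" using c(2) X l n eX[of l] by simp
    then have "inverse (c l) \<odot> (c l \<odot> e l) = zero_mor A X X" using X by simp
    then show False using l n eX[of l] by simp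
  qed
  then show ?thesis using that by blast
qed

text \<open>
  The projection onto \<open>Z\<close> is orthogonal to the idempotents that come from \<open>Y\<close>.
\<close>

lemma orthogonal_idempotents_biproduct:
  assumes e: "orthogonal_idempotents Y n e" and W: "biproduct A W Y Z" and Z: "\<not> zero_object A Z"
  obtains e' where "orthogonal_idempotents W (Suc n) e'"
proof -
  obtain i1 i2 p1 p2 where *: "W \<in> Ob A" "Y \<in> Ob A" "Z \<in> Ob A"
    "i1 \<in> arrows A" "i2 \<in> arrows A" "p1 \<in> arrows A" "p2 \<in> arrows A"
    "src A i1 = Y" "tgt A i1 = W" "src A i2 = Z" "tgt A i2 = W"
    "src A p1 = W" "tgt A p1 = Y" "src A p2 = W" "tgt A p2 = Z"
    and pi: "p1 \<cdot> i1 = idm A Y" "p2 \<cdot> i2 = idm A Z" "p1 \<cdot> i2 = zero_mor A Z Y" "p2 \<cdot> i1 = zero_mor A Y Z"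
    using W by (rule biproductE)
  note re = pi[THEN cmp_reassoc]
  have eY: "e k \<in> arrows A" "src A (e k) = Y" "tgt A (e k) = Y" "e k \<noteq> zero_mor A Y Y" if "k < n" for k
    using e that * unfolding orthogonal_idempotents_def by auto
  have ee: "e k \<cdot> e l = (if k = l then e k else zero_mor A Y Y)" if "k < n" "l < n" for k l
    using e that unfolding orthogonal_idempotents_def by blast
  have ee': "e k \<cdot> (e l \<cdot> p1) = (if k = l then e k \<cdot> p1 else zero_mor A W Y)" if "k < n" "l < n" for k l
    using cmp_reassoc[OF ee[OF that], of p1] eY[OF that(1)] eY[OF that(2)] * by auto
  define e' where "e' = (\<lambda>k. if k < n then i1 \<cdot> (e k \<cdot> p1) else i2 \<cdot> p2)"
  have "e' k \<noteq> zero_mor A W W" if "k < Suc n" for k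
  proof (cases "k < n")
    case True
    have "p1 \<cdot> (e' k \<cdot> i1) = e k" unfolding e'_def using True eY[OF True] * by (simp add: re pi)
    moreover have "p1 \<cdot> (zero_mor A W W \<cdot> i1) = zero_mor A Y Y" using * by simp
    ultimately show ?thesis using eY(4)[OF True] by metis
  next
    case False
    have "p2 \<cdot> (e' k \<cdot> i2) = idm A Z" unfolding e'_def using False * by (simp add: re pi)
    moreover have "p2 \<cdot> (zero_mor A W W \<cdot> i2) = zero_mor A Z Z" using * by simp
    ultimately show ?thesis using Z *(3) unfolding zero_object_iff by metis
  qed
  then have "orthogonal_idempotents W (Suc n) e'"
    unfolding orthogonal_idempotents_def e'_def using * eY ee' by (auto simp: re)
  then show ?thesis using that by blast
qed

text \<open>
  A proper direct summand admits fewer orthogonal nonzero idempotents, and the number of these is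
  bounded by the dimension of the endomorphism ring. So splitting off summands terminates.
\<close>

lemma finite_direct_sum_indecomposables:
  assumes "X \<in> Ob A"
  shows "\<exists>Xs. finite_direct_sum A X Xs \<and> (\<forall>Y\<in>set Xs. indecomposable A Y)"
proof -
  define bounded where "bounded = (\<lambda>N X. \<forall>n e. orthogonal_idempotents X n e \<longrightarrow> n \<le> N)"
  have smaller: "bounded N Y" if "bounded (Suc N) W" "biproduct A W Y Z" "\<not> zero_object A Z" for N W Y Z
    using that orthogonal_idempotents_biproduct unfolding bounded_def by (metis Suc_le_mono)
  have zero: "zero_object A X" if "bounded 0 X" "X \<in> Ob A" for X
  proof (rule ccontr)
    assume "\<not> zero_object A X"
    then have "orthogonal_idempotents X 1 (\<lambda>_. idm A X)"
      using that(2) unfolding orthogonal_idempotents_def by (simp add: zero_object_iff)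
    then show False using that(1) unfolding bounded_def by force
  qed
  have swap: "biproduct A W Z Y" if "biproduct A W Y Z" for W Y Z
    using that unfolding biproduct_def by (metis plus_commute cmp_in_hom)
  have indec: "\<exists>Y. indecomposable A Y \<and> retract A Y X"
    if "bounded N X" "X \<in> Ob A" "\<not> zero_object A X" for N X
    using that
  proof (induction N arbitrary: X)
    case 0 then show ?case using zero by blast
  next
    case (Suc N)
    show ?case
    proof (cases "indecomposable A X")
      case True then show ?thesis using retract_refl Suc.prems by blast
    next
      case False
      then obtain Y Z where YZ: "biproduct A X Y Z" "\<not> zero_object A Y" "\<not> zero_object A Z"
        using Suc.prems unfolding indecomposable_def by blast
      then have "bounded N Y" "Y \<in> Ob A" using smaller Suc.prems unfolding biproduct_def by blast+
      then show ?thesis using Suc.IH YZ biproduct_retract retract_trans by blast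
    qed
  qed
  have "\<exists>Xs. finite_direct_sum A X Xs \<and> (\<forall>Y\<in>set Xs. indecomposable A Y)"
    if "bounded N X" "X \<in> Ob A" for N X
    using that
  proof (induction N arbitrary: X)
    case 0 then show ?case using zero by (intro exI[of _ "[]"]) auto
  next
    case (Suc N)
    show ?case
    proof (cases "zero_object A X")
      case True then show ?thesis by (intro exI[of _ "[]"]) auto
    next
      case False
      then obtain Y Z where Y: "indecomposable A Y" "biproduct A X Y Z"
        using indec Suc.prems direct_summand_iff_retract unfolding direct_summand_def by metis
      then have "bounded N Z" "Z \<in> Ob A"
        using smaller[OF Suc.prems(1) swap] unfolding indecomposable_def biproduct_def by blast+
      then obtain Xs where "finite_direct_sum A Z Xs" "\<forall>Y\<in>set Xs. indecomposable A Y"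
        using Suc.IH by blast
      then show ?thesis using Y by (intro exI[of _ "Y # Xs"]) auto
    qed
  qed
  then show ?thesis using orthogonal_idempotents_bounded[OF assms] assms unfolding bounded_def by metis
qed

lemma finite_direct_sum_exists: "set Xs \<subseteq> Ob A \<Longrightarrow> \<exists>W. finite_direct_sum A W Xs"
proof (induction Xs)
  case Nil then show ?case using zero_object_exists by simp
next
  case (Cons X Xs)
  then obtain V where V: "finite_direct_sum A V Xs" by auto
  then show ?case using biproduct_exists[of X V] Cons.prems finite_direct_sum_Ob[OF V] by auto
qed

end

text \<open>
  A functor preserves direct sums, so an indecomposable summand of the image of a sum can be traced
  to one of the terms.
\<close>

lemma (in linear_functor_between) indecomposable_retract_image_sum:
  assumes B: "finitary_category B" and Y: "indecomposable B Y"
  shows "finite_direct_sum A X Xs \<Longrightarrow> retract B Y (Fo X) \<Longrightarrow> \<exists>Z\<in>set Xs. retract B Y (Fo Z)"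
proof (induction Xs arbitrary: X)
  case Nil
  then have "zero_object B (Fo X)" using pres_zero_object by simp
  moreover obtain s r where sr: "Y \<in> Ob B" "Fo X \<in> Ob B" "s \<in> arrows B" "r \<in> arrows B" "src B s = Y"
    "tgt B s = Fo X" "src B r = Fo X" "tgt B r = Y" "r \<cdot>\<^bsub>B\<^esub> s = idm B Y"
    using Nil.prems(2) by (rule B.retractE)
  ultimately have "r = zero_mor B (Fo X) Y" using B.zero_object_arrow[of "Fo X" r] by auto
  then have "zero_object B Y" using sr by (simp add: B.zero_object_iff)
  then show ?case using Y unfolding indecomposable_def by blast
next
  case (Cons Z Xs)
  then obtain V where V: "biproduct A X Z V" "finite_direct_sum A V Xs" by auto
  then have "retract B Y (Fo Z) \<or> retract B Y (Fo V)"
    using finitary_category.indecomposable_retract_biproduct[OF B Y Cons.prems(2) pres_biproduct] by blast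
  then show ?case using Cons.IH V by auto
qed

section \<open>Full subcategories up to isomorphism of objects\<close>

text \<open>
  Up to the inclusion \<open>\<iota>\<close> of morphisms, \<open>L\<close> is a full subcategory of \<open>B\<close>. The inclusion is kept
  explicit because the morphisms of the two categories are sets of different types in the
  application, namely classes of classes and classes.
\<close>

locale full_embedding = linear_functor_between L B id \<iota>
  for L :: "('o, 'n, 'k::field) lincat" and B :: "('o, 'm, 'k) lincat" and \<iota> +
  assumes fully_faithful: "\<lbrakk>X \<in> Ob L; Y \<in> Ob L\<rbrakk> \<Longrightarrow> bij_betw \<iota> (hom L X Y) (hom B X Y)"
begin

definition lift :: "'m \<Rightarrow> 'n" where
  "lift b = the_inv_into (hom L (src B b) (tgt B b)) \<iota> b"

lemma Ob_sub [simp]: "X \<in> Ob L \<Longrightarrow> X \<in> Ob B"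
  using obj by simp

lemma lift [simp]:
  assumes "b \<in> arrows B" "src B b \<in> Ob L" "tgt B b \<in> Ob L"
  shows "\<iota> (lift b) = b" "lift b \<in> arrows L" "src L (lift b) = src B b" "tgt L (lift b) = tgt B b"
proof -
  have bij: "bij_betw \<iota> (hom L (src B b) (tgt B b)) (hom B (src B b) (tgt B b))"
    using fully_faithful assms by blast
  have b: "b \<in> hom B (src B b) (tgt B b)" using assms by simp
  show "\<iota> (lift b) = b" unfolding lift_def using f_the_inv_into_f_bij_betw[OF bij] b by blast
  have "lift b \<in> hom L (src B b) (tgt B b)"
    unfolding lift_def using bij_betwE[OF bij_betw_the_inv_into[OF bij]] b by blast
  then show "lift b \<in> arrows L" "src L (lift b) = src B b" "tgt L (lift b) = tgt B b"
    using assms by auto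
qed

lemma faithful:
  assumes "f \<in> arrows L" "g \<in> arrows L" "src L f = src L g" "tgt L f = tgt L g" "\<iota> f = \<iota> g"
  shows "f = g"
  using fully_faithful[of "src L g" "tgt L g"] assms by (auto simp: bij_betw_def inj_on_def)

lemma lift_iso:
  assumes "is_iso B X Y b" "X \<in> Ob L" "Y \<in> Ob L"
  shows "is_iso L X Y (lift b)"
proof -
  obtain c where c: "b \<in> arrows B" "src B b = X" "tgt B b = Y" "c \<in> arrows B" "src B c = Y"
    "tgt B c = X" "c \<cdot>\<^bsub>B\<^esub> b = idm B X" "b \<cdot>\<^bsub>B\<^esub> c = idm B Y"
    using B.is_isoE[OF assms(1)] assms(2,3) Ob_sub by metis
  show ?thesis
    by (rule A.is_isoI[of _ "lift c"]) (use c assms in \<open>auto intro!: faithful\<close>)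
qed

end

text \<open>
  Two categories \<open>L\<close> and \<open>L'\<close> that are full subcategories of \<open>B\<close>, and for each object of \<open>L\<close> an
  isomorphism in \<open>B\<close> to an object of \<open>L'\<close>. Conjugation with these isomorphisms is a functor.
\<close>

locale transfer =
  L: full_embedding L B \<iota> + L': full_embedding L' B \<iota>'
  for L :: "('o, 'n, 'k::field) lincat" and B :: "('o, 'm, 'k) lincat" and \<iota>
    and L' :: "('o, 'p, 'k::field) lincat" and \<iota>' +
  fixes T :: "'o \<Rightarrow> 'o" and u v :: "'o \<Rightarrow> 'm"
  assumes T [simp]: "X \<in> Ob L \<Longrightarrow> T X \<in> Ob L'"
    and u [simp]: "X \<in> Ob L \<Longrightarrow> u X \<in> arrows B" "X \<in> Ob L \<Longrightarrow> src B (u X) = X"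
      "X \<in> Ob L \<Longrightarrow> tgt B (u X) = T X"
    and v [simp]: "X \<in> Ob L \<Longrightarrow> v X \<in> arrows B" "X \<in> Ob L \<Longrightarrow> src B (v X) = T X"
      "X \<in> Ob L \<Longrightarrow> tgt B (v X) = X"
    and uv [simp]: "X \<in> Ob L \<Longrightarrow> u X \<cdot>\<^bsub>B\<^esub> v X = idm B (T X)"
    and vu [simp]: "X \<in> Ob L \<Longrightarrow> v X \<cdot>\<^bsub>B\<^esub> u X = idm B X"
begin

definition conj :: "'n \<Rightarrow> 'p" where
  "conj f = L'.lift (u (tgt L f) \<cdot>\<^bsub>B\<^esub> (\<iota> f \<cdot>\<^bsub>B\<^esub> v (src L f)))"

lemma uv_reassoc [simp]:
  assumes "X \<in> Ob L" "f \<in> arrows B"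
  shows "tgt B f = T X \<Longrightarrow> u X \<cdot>\<^bsub>B\<^esub> (v X \<cdot>\<^bsub>B\<^esub> f) = f" "tgt B f = X \<Longrightarrow> v X \<cdot>\<^bsub>B\<^esub> (u X \<cdot>\<^bsub>B\<^esub> f) = f"
  using L.B.cmp_reassoc[OF uv, of X f] L.B.cmp_reassoc[OF vu, of X f] assms by simp_all

lemma conj_arr [simp]:
  assumes "f \<in> arrows L"
  shows "\<iota>' (conj f) = u (tgt L f) \<cdot>\<^bsub>B\<^esub> (\<iota> f \<cdot>\<^bsub>B\<^esub> v (src L f))"
    "conj f \<in> arrows L'" "src L' (conj f) = T (src L f)" "tgt L' (conj f) = T (tgt L f)"
  using assms by (simp_all add: conj_def)

lemma linear_conj: "linear_functor L L' T conj"
  unfolding linear_functor_def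
  by (auto intro!: L'.faithful)

text \<open>
  Going to \<open>L'\<close> and back moves \<open>X\<close> along \<open>u\<close> and then along \<open>u'\<close>. The inverses of these isomorphisms
  compose to the component at \<open>X\<close>.
\<close>

lemma transfer_square:
  assumes "transfer L' B \<iota>' L \<iota> T' u' v'"
  shows "nat_isomorphism L L (T' \<circ> T) (transfer.conj L' B \<iota>' L \<iota> u' v' \<circ> conj) id id
    (\<lambda>X. L.lift (v X \<cdot>\<^bsub>B\<^esub> v' (T X)))"
proof -
  interpret R: transfer L' B \<iota>' L \<iota> T' u' v' by (rule assms)
  have "is_iso B (T' (T X)) X (v X \<cdot>\<^bsub>B\<^esub> v' (T X))" if "X \<in> Ob L" for X
    by (rule L.B.is_isoI[of _ "u' (T X) \<cdot>\<^bsub>B\<^esub> u X"]) (use that in auto)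
  then have "is_iso L (T' (T X)) X (L.lift (v X \<cdot>\<^bsub>B\<^esub> v' (T X)))" if "X \<in> Ob L" for X
    using that L.lift_iso by simp
  moreover have "L.lift (v Y \<cdot>\<^bsub>B\<^esub> v' (T Y)) \<cdot>\<^bsub>L\<^esub> R.conj (conj f) = f \<cdot>\<^bsub>L\<^esub> L.lift (v X \<cdot>\<^bsub>B\<^esub> v' (T X))"
    if "f \<in> arrows L" "src L f = X" "tgt L f = Y" for f X Y
  proof -
    have "X \<in> Ob L" "Y \<in> Ob L" using that by auto
    then show ?thesis using that by (intro L.faithful) simp_all
  qed
  ultimately show ?thesis
    unfolding nat_isomorphism_def nat_transformation_def by simp
qed

end

lemma transfer_equivalence:
  assumes "transfer L B \<iota> L' \<iota>' T u v" "transfer L' B \<iota>' L \<iota> T' u' v'"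
  shows "category_equivalence L L' T (transfer.conj L B \<iota> L' \<iota>' u v)"
  unfolding category_equivalence_def
  using transfer.linear_conj[OF assms(1)] transfer.linear_conj[OF assms(2)]
    transfer.transfer_square[OF assms] transfer.transfer_square[OF assms(2,1)] by blast

section \<open>Iterated quotients of a full subcategory\<close>

text \<open>
  The subquotient at a step of a filtration: \<open>G\<close> is an ideal of the full subcategory on \<open>S\<close>, and \<open>I\<close>
  is an ideal of the whole category that contains it. The set \<open>K\<close> is the ideal \<open>I/G\<close> of the quotient.
\<close>

locale subquotient_category = category_with_ideal +
  fixes S :: "'a set" and G :: "'b set"
  assumes ideal_G: "cat_ideal (full_subcat A S) G" and G_sub: "G \<subseteq> I"
begin

abbreviation "AS \<equiv> full_subcat A S"
abbreviation "N \<equiv> quotient_cat AS G"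
definition "K = coset AS G ` (I \<inter> arrows AS)"

sublocale AS: linear_category AS
  by (rule linear_full_subcat)

sublocale AS: category_with_ideal AS G
  by unfold_locales (rule ideal_G)

lemma arr_AS: "f \<in> arrows AS \<longleftrightarrow> f \<in> arrows A \<and> src A f \<in> S \<and> tgt A f \<in> S"
  by (rule arr_full_subcat)

lemmas coset_AS [simp] =
  AS.quotient.pres_plus[unfolded plus_full_subcat] AS.quotient.pres_scale[unfolded scale_full_subcat]
  AS.quotient.pres_cmp[unfolded cmp_full_subcat]

lemma coset_in_K_iff:
  assumes "f \<in> arrows AS"
  shows "coset AS G f \<in> K \<longleftrightarrow> f \<in> I"
proof
  assume "coset AS G f \<in> K"
  then obtain g where g: "g \<in> I" "g \<in> arrows AS" "coset AS G f = coset AS G g" unfolding K_def by blast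
  then have fg: "src AS f = src AS g" "tgt AS f = tgt AS g" "f \<boxplus> (-1) \<odot> g \<in> I"
    using AS.coset_eq_iff[OF g(2) assms] G_sub by auto
  then have "(f \<boxplus> (-1) \<odot> g) \<boxplus> g \<in> I"
    using ideal_plus[OF fg(3) g(1)] assms g(2) by (simp add: arr_AS del: plus_assoc')
  then show "f \<in> I" using fg assms g(2) by (simp add: arr_AS)
qed (use assms in \<open>auto simp: K_def\<close>)

lemma ideal_K: "cat_ideal N K"
proof -
  have 1: "K \<subseteq> arrows N" unfolding K_def using AS.quotient.arr(1) by blast
  have 2: "zero_mor N X Y \<in> K" if "X \<in> Ob N" "Y \<in> Ob N" for X Y
    using that coset_in_K_iff[of "zero_mor A X Y"] AS.zero_quotient[of X Y] AS.zero_arr[of X Y] by simp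
  have 3: "f \<boxplus>\<^bsub>N\<^esub> g \<in> K" if fg: "f \<in> K" "g \<in> K" "src N f = src N g" "tgt N f = tgt N g" for f g
  proof -
    obtain f' g' where *: "f = coset AS G f'" "g = coset AS G g'" "f' \<in> arrows AS" "g' \<in> arrows AS"
      "f' \<in> I" "g' \<in> I" using fg(1,2) unfolding K_def by blast
    have "src AS f' = src AS g'" "tgt AS f' = tgt AS g'" using fg(3,4) * by simp_all
    then show ?thesis
      using * coset_in_K_iff[of "f' \<boxplus> g'"] AS.plus_arr(1)[of f' g'] ideal_plus[of f' g']
      by simp
  qed
  have 4: "c \<odot>\<^bsub>N\<^esub> f \<in> K" if f: "f \<in> K" for f c
  proof -
    obtain f' where *: "f = coset AS G f'" "f' \<in> arrows AS" "f' \<in> I" using f unfolding K_def by blast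
    then show ?thesis
      using coset_in_K_iff[of "c \<odot> f'"] AS.scale_arr(1)[of f' c] ideal_scale[of f' c]
      by simp
  qed
  have 5: "g \<cdot>\<^bsub>N\<^esub> f \<in> K" if fg: "f \<in> arrows N" "g \<in> arrows N" "src N g = tgt N f" "f \<in> K \<or> g \<in> K" for f g
  proof -
    obtain f' where f': "f = coset AS G f'" "f' \<in> arrows AS" using fg(1) by (rule AS.arr_quotientE)
    obtain g' where g': "g = coset AS G g'" "g' \<in> arrows AS" using fg(2) by (rule AS.arr_quotientE)
    have "src AS g' = tgt AS f'" using fg(3) f' g' by simp
    moreover have "f' \<in> I \<or> g' \<in> I" using fg(4) f' g' coset_in_K_iff by simp
    ultimately show ?thesis
      using f' g' coset_in_K_iff[of "g' \<cdot> f'"] AS.cmp_arr(1)[of f' g']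
        ideal_cmp[of f' g']
      by (simp add: arr_AS)
  qed
  show ?thesis unfolding cat_ideal_def using 1 2 3 4 5 by auto
qed

sublocale N: category_with_ideal N K
  by unfold_locales (rule ideal_K)

text \<open>
  The third isomorphism theorem. A morphism of the iterated quotient is a set of residue classes
  modulo \<open>G\<close>; their union is the residue class modulo \<open>I\<close>.
\<close>

lemma Union_coset_coset:
  assumes f: "f \<in> arrows AS"
  shows "\<Union>(coset N K (coset AS G f)) = coset A I f"
proof -
  have fA: "f \<in> arrows A" using f by (simp add: arr_AS)
  have st: "src N (coset AS G g) = src A g" "tgt N (coset AS G g) = tgt A g" "coset AS G g \<in> arrows N"
    if "g \<in> arrows AS" for g using that by simp_all
  have cosets: "coset AS G h \<in> coset N K (coset AS G f) \<longleftrightarrow> h \<in> coset A I f" if h: "h \<in> arrows AS" for h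
  proof -
    have hA: "h \<in> arrows A" using h by (simp add: arr_AS)
    have "coset AS G h \<boxplus>\<^bsub>N\<^esub> (-1) \<odot>\<^bsub>N\<^esub> coset AS G f \<in> K \<longleftrightarrow> h \<boxplus> (-1) \<odot> f \<in> I"
      if "src A h = src A f" "tgt A h = tgt A f"
    proof -
      have "h \<boxplus> (-1) \<odot> f \<in> arrows AS" using f h that by (simp add: arr_AS)
      moreover have "coset AS G h \<boxplus>\<^bsub>N\<^esub> (-1) \<odot>\<^bsub>N\<^esub> coset AS G f = coset AS G (h \<boxplus> (-1) \<odot> f)"
        using f h that by (simp add: arr_AS)
      ultimately show ?thesis using coset_in_K_iff by (simp only:)
    qed
    then show ?thesis
      unfolding N.mem_coset_iff[OF st(3)[OF f]] mem_coset_iff[OF fA] st(1,2)[OF f] st(1,2)[OF h]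
      using hA st(3)[OF h] by blast
  qed
  show ?thesis
  proof (intro equalityI subsetI)
    fix h assume "h \<in> \<Union>(coset N K (coset AS G f))"
    then obtain m where m: "m \<in> coset N K (coset AS G f)" "h \<in> m" by blast
    then have "m \<in> arrows N" using N.mem_coset_iff[of "coset AS G f" m] f by simp
    then obtain g where g: "m = coset AS G g" "g \<in> arrows AS" by (rule AS.arr_quotientE)
    then have "h \<in> arrows AS" "coset AS G h = m"
      using m(2) AS.coset_eqI[of g h] AS.mem_coset_iff[of g h] by auto
    then show "h \<in> coset A I f" using cosets m(1) by blast
  next
    fix h assume h: "h \<in> coset A I f"
    then have "h \<in> arrows AS" using f by (simp add: mem_coset_iff arr_AS)
    then show "h \<in> \<Union>(coset N K (coset AS G f))"
      using cosets h AS.self_mem_coset by blast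
  qed
qed

abbreviation "L \<equiv> quotient_cat N K"

lemma arr_LE:
  assumes "m \<in> arrows L"
  obtains f where "m = coset N K (coset AS G f)" "f \<in> arrows AS"
  using assms by (elim N.arr_quotientE AS.arr_quotientE) blast

lemma full_embedding_Union: "full_embedding L AI Union"
proof -
  have U: "\<Union>(coset N K (coset AS G f)) = coset A I f" if "f \<in> arrows AS" for f
    using Union_coset_coset[OF that] .
  have homE: "\<exists>f. m = coset N K (coset AS G f) \<and> f \<in> arrows AS \<and> src A f = X \<and> tgt A f = Y"
    if m: "m \<in> hom L X Y" "X \<in> Ob L" "Y \<in> Ob L" for m X Y
  proof -
    obtain n where n: "m = coset N K n" "n \<in> arrows N" "src N n = X" "tgt N n = Y"
      using N.hom_quotientE[OF m(1)] m(2,3) by auto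
    obtain f where "n = coset AS G f" "f \<in> arrows AS" using n(2) by (rule AS.arr_quotientE)
    then show ?thesis using n by auto
  qed
  have "linear_functor L AI id Union"
    unfolding linear_functor_def
  proof (intro conjI ballI allI)
    fix X assume X: "X \<in> Ob L"
    then show "id X \<in> Ob AI" by simp
    have "idm L X = coset N K (coset AS G (idm A X))" by (simp only: N.idm_quotient AS.idm_quotient idm_full_subcat)
    then show "\<Union>(idm L X) = idm AI (id X)"
      using U[of "idm A X"] X AS.idm_arr(1)[of X] by (simp add: idm_quotient del: quotient.pres_idm)
  next
    fix X Y f assume XY: "X \<in> Ob L" "Y \<in> Ob L" "f \<in> hom L X Y"
    obtain f' where f': "f = coset N K (coset AS G f')" "f' \<in> arrows AS" "src A f' = X" "tgt A f' = Y"
      using homE XY by blast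
    then show "\<Union>f \<in> hom AI (id X) (id Y)" using U[of f'] XY by (simp add: arr_AS)
    fix c
    have "c \<odot>\<^bsub>L\<^esub> f = coset N K (coset AS G (c \<odot> f'))" using f' by (simp add: arr_AS)
    then show "\<Union>(c \<odot>\<^bsub>L\<^esub> f) = c \<odot>\<^bsub>AI\<^esub> \<Union>f"
      using U[of f'] U[of "c \<odot> f'"] f' by (simp add: arr_AS)
  next
    fix X Y f g assume XY: "X \<in> Ob L" "Y \<in> Ob L" "f \<in> hom L X Y" "g \<in> hom L X Y"
    obtain f' where f': "f = coset N K (coset AS G f')" "f' \<in> arrows AS" "src A f' = X" "tgt A f' = Y"
      using homE XY by blast
    obtain g' where g': "g = coset N K (coset AS G g')" "g' \<in> arrows AS" "src A g' = X" "tgt A g' = Y"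
      using homE XY by blast
    have "f \<boxplus>\<^bsub>L\<^esub> g = coset N K (coset AS G (f' \<boxplus> g'))" using f' g' by (simp add: arr_AS)
    moreover have "f' \<boxplus> g' \<in> arrows AS" using f' g' by (simp add: arr_AS)
    ultimately show "\<Union>(f \<boxplus>\<^bsub>L\<^esub> g) = \<Union>f \<boxplus>\<^bsub>AI\<^esub> \<Union>g"
      using U[of f'] U[of g'] U[of "f' \<boxplus> g'"] f' g' by (simp add: arr_AS)
  next
    fix X Y Z f g assume XY: "X \<in> Ob L" "Y \<in> Ob L" "Z \<in> Ob L" "f \<in> hom L X Y" "g \<in> hom L Y Z"
    obtain f' where f': "f = coset N K (coset AS G f')" "f' \<in> arrows AS" "src A f' = X" "tgt A f' = Y"
      using homE XY by blast
    obtain g' where g': "g = coset N K (coset AS G g')" "g' \<in> arrows AS" "src A g' = Y" "tgt A g' = Z"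
      using homE XY by blast
    have "g \<cdot>\<^bsub>L\<^esub> f = coset N K (coset AS G (g' \<cdot> f'))" using f' g' by (simp add: arr_AS)
    moreover have "g' \<cdot> f' \<in> arrows AS" using f' g' by (simp add: arr_AS)
    ultimately show "\<Union>(g \<cdot>\<^bsub>L\<^esub> f) = \<Union>g \<cdot>\<^bsub>AI\<^esub> \<Union>f"
      using U[of f'] U[of g'] U[of "g' \<cdot> f'"] f' g' by (simp add: arr_AS)
  qed
  moreover have "bij_betw Union (hom L X Y) (hom AI X Y)" if XY: "X \<in> Ob L" "Y \<in> Ob L" for X Y
    unfolding bij_betw_def
  proof
    show "inj_on Union (hom L X Y)"
    proof
      fix m m' assume "m \<in> hom L X Y" "m' \<in> hom L X Y" and eq: "\<Union>m = \<Union>m'"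
      then obtain f f' where f: "m = coset N K (coset AS G f)" "f \<in> arrows AS" "src A f = X" "tgt A f = Y"
        and f': "m' = coset N K (coset AS G f')" "f' \<in> arrows AS" "src A f' = X" "tgt A f' = Y"
        using homE XY by meson
      have fA: "f \<in> arrows A" "f' \<in> arrows A" "f \<boxplus> (-1) \<odot> f' \<in> arrows AS" using f f' by (simp_all add: arr_AS)
      have "f \<boxplus> (-1) \<odot> f' \<in> I"
        using eq U[OF f(2)] U[OF f'(2)] coset_eq_iff[OF fA(2,1)] f(1) f'(1) by simp
      then have "coset AS G (f \<boxplus> (-1) \<odot> f') \<in> K" using coset_in_K_iff fA by simp
      then show "m = m'"
        using f f' N.coset_eq_iff[of "coset AS G f'" "coset AS G f"] by (simp add: arr_AS)
    qed
    show "Union ` hom L X Y = hom AI X Y"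
    proof
      have "Union m \<in> hom AI X Y" if m: "m \<in> hom L X Y" for m
      proof -
        obtain f where f: "m = coset N K (coset AS G f)" "f \<in> arrows AS" "src A f = X" "tgt A f = Y"
          using homE XY m by blast
        then have "f \<in> arrows A" by (simp add: arr_AS)
        then show ?thesis unfolding f(1) U[OF f(2)] by (rule hom_quotientI) (use f in auto)
      qed
      then show "Union ` hom L X Y \<subseteq> hom AI X Y" by blast
      show "hom AI X Y \<subseteq> Union ` hom L X Y"
      proof
        fix m assume "m \<in> hom AI X Y"
        then obtain f where f: "m = coset A I f" "f \<in> arrows A" "src A f = X" "tgt A f = Y"
          using XY hom_quotientE[of m X Y] by auto
        then have fS: "f \<in> arrows AS" using XY by (simp add: arr_AS)
        then have "coset N K (coset AS G f) \<in> hom L X Y" using f XY by simp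
        then show "m \<in> Union ` hom L X Y" using U[OF fS] f(1) by blast
      qed
    qed
  qed
  ultimately show ?thesis
    by (intro full_embedding.intro linear_functor_between.intro linear_functor_between_axioms.intro
        full_embedding_axioms.intro N.linear_quotient linear_quotient)
qed

end

lemma transfer_exists:
  assumes L: "full_embedding L B \<iota>" and L': "full_embedding L' B \<iota>'"
    and iso: "\<forall>X\<in>Ob L. \<exists>X'\<in>Ob L'. isomorphic B X X'"
  shows "\<exists>T u v. transfer L B \<iota> L' \<iota>' T u v"
proof -
  interpret L: full_embedding L B \<iota> by (rule L)
  interpret L': full_embedding L' B \<iota>' by (rule L')
  have "\<forall>X. \<exists>X' u v. X \<in> Ob L \<longrightarrow> X' \<in> Ob L' \<and> u \<in> arrows B \<and> src B u = X \<and> tgt B u = X' \<and>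
    v \<in> arrows B \<and> src B v = X' \<and> tgt B v = X \<and> u \<cdot>\<^bsub>B\<^esub> v = idm B X' \<and> v \<cdot>\<^bsub>B\<^esub> u = idm B X"
    using iso L.B.is_isoE unfolding isomorphic_def by metis
  then obtain T u v where "\<forall>X\<in>Ob L. T X \<in> Ob L' \<and> u X \<in> arrows B \<and> src B (u X) = X \<and>
    tgt B (u X) = T X \<and> v X \<in> arrows B \<and> src B (v X) = T X \<and> tgt B (v X) = X \<and>
    u X \<cdot>\<^bsub>B\<^esub> v X = idm B (T X) \<and> v X \<cdot>\<^bsub>B\<^esub> u X = idm B X" by metis
  then have "transfer L B \<iota> L' \<iota>' T u v" by unfold_locales auto
  then show ?thesis by blast
qed

section \<open>Linear 2-representations\<close>

definition src1 :: "('i, 'f, 'a, 'k) two_cat \<Rightarrow> 'f \<Rightarrow> 'i" where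
  "src1 C F = (THE i. i \<in> Obj C \<and> (\<exists>j\<in>Obj C. F \<in> mor1 C i j))"

context finitary_2category
begin

lemma src1_eq: "\<lbrakk>i \<in> Obj C; j \<in> Obj C; F \<in> mor1 C i j\<rbrakk> \<Longrightarrow> src1 C F = i"
  unfolding src1_def by (rule the_equality) (use mor1_disjoint in blast)+

lemma tgt1_eq: "\<lbrakk>i \<in> Obj C; j \<in> Obj C; F \<in> mor1 C i j\<rbrakk> \<Longrightarrow> tgt1 C F = j"
  unfolding tgt1_def by (rule the_equality) (use mor1_disjoint in blast)+

lemma tgt2_eq:
  assumes "i \<in> Obj C" "j \<in> Obj C" "F \<in> mor1 C i j" "G \<in> mor1 C i j" "a \<in> mor2 C i j F G"
  shows "tgt2 C a = j"
proof -
  have "a \<in> arrows (Hom C i j)" using assms unfolding arrows_def mor1_def mor2_def by blast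
  then show ?thesis
    unfolding tgt2_def using assms mor2_disjoint by (intro the_equality) blast+
qed

end

text \<open>
  The part of the structure of a 2-representation that passes to subrepresentations and quotients
  and that equivalences refer to.
\<close>

locale linear_2representation = finitary_2category C
  for C :: "('i, 'f, 'a, 'k::field) two_cat" +
  fixes M :: "('i, 'f, 'a, 'o, 'm, 'k) two_rep"
  assumes linear_rcat: "i \<in> Obj C \<Longrightarrow> linear_category (rcat M i)"
    and functor_rep:
      "\<lbrakk>i \<in> Obj C; j \<in> Obj C; F \<in> mor1 C i j\<rbrakk>
        \<Longrightarrow> linear_functor (rcat M i) (rcat M j) (robj M F) (rmor M F)"
    and nat_rep:
      "\<lbrakk>i \<in> Obj C; j \<in> Obj C; F \<in> mor1 C i j; G \<in> mor1 C i j; a \<in> mor2 C i j F G\<rbrakk>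
        \<Longrightarrow> nat_transformation (rcat M i) (rcat M j)
              (robj M F) (rmor M F) (robj M G) (rmor M G) (rnat M a)"
    and robj_comp1:
      "\<lbrakk>i \<in> Obj C; j \<in> Obj C; k \<in> Obj C; F \<in> mor1 C i j; G \<in> mor1 C j k; X \<in> Ob (rcat M i)\<rbrakk>
        \<Longrightarrow> robj M (comp1 C G F) X = robj M G (robj M F X)"
    and rmor_comp1:
      "\<lbrakk>i \<in> Obj C; j \<in> Obj C; k \<in> Obj C; F \<in> mor1 C i j; G \<in> mor1 C j k; f \<in> arrows (rcat M i)\<rbrakk>
        \<Longrightarrow> rmor M (comp1 C G F) f = rmor M G (rmor M F f)"

lemma (in finitary_2representation) linear: "linear_2representation C M"
proof (intro linear_2representation.intro linear_2representation_axioms.intro)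
  show "finitary_2category C" by unfold_locales
  show "linear_category (rcat M i)" if "i \<in> Obj C" for i
    using finitary_rcat[OF that] finitary_category.axioms(1) by blast
qed (simp_all add: functor_rep nat_rep robj_comp1 rmor_comp1)

text \<open>
  In contrast to \<open>rep_ideal\<close>, nothing is demanded of the values at indices outside \<open>Obj C\<close>: the
  generated ideals by which a subquotient is formed are not empty there in general.
\<close>

definition stable_ideal ::
  "('i, 'f, 'a, 'k) two_cat \<Rightarrow> ('i, 'f, 'a, 'o, 'm, 'k) two_rep \<Rightarrow> ('i \<Rightarrow> 'm set) \<Rightarrow> bool" where
  "stable_ideal C M I \<longleftrightarrow>
    (\<forall>i\<in>Obj C. cat_ideal (rcat M i) (I i)) \<and>
    (\<forall>i\<in>Obj C. \<forall>j\<in>Obj C. \<forall>F\<in>mor1 C i j. \<forall>f\<in>I i. rmor M F f \<in> I j)"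

definition restrict_rep ::
  "('i, 'f, 'a, 'o, 'm, 'k) two_rep \<Rightarrow> ('i \<Rightarrow> 'o set) \<Rightarrow> ('i, 'f, 'a, 'o, 'm, 'k) two_rep" where
  "restrict_rep M S = M\<lparr>rcat := \<lambda>i. full_subcat (rcat M i) (S i)\<rparr>"

lemma restrict_rep_simps [simp]:
  "rcat (restrict_rep M S) i = full_subcat (rcat M i) (S i)" "robj (restrict_rep M S) = robj M"
  "rmor (restrict_rep M S) = rmor M" "rnat (restrict_rep M S) = rnat M"
  by (simp_all add: restrict_rep_def)

lemma quotient_rep_simps [simp]:
  "rcat (quotient_rep C M I) i = quotient_cat (rcat M i) (I i)" "robj (quotient_rep C M I) = robj M"
  by (simp_all add: quotient_rep_def)

context linear_2representation
begin

lemma functor_between: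
  "\<lbrakk>i \<in> Obj C; j \<in> Obj C; F \<in> mor1 C i j\<rbrakk>
    \<Longrightarrow> linear_functor_between (rcat M i) (rcat M j) (robj M F) (rmor M F)"
  by (intro linear_functor_between.intro linear_functor_between_axioms.intro linear_rcat functor_rep)

lemma rnat_arr:
  assumes "i \<in> Obj C" "j \<in> Obj C" "F \<in> mor1 C i j" "G \<in> mor1 C i j" "a \<in> mor2 C i j F G"
    "X \<in> Ob (rcat M i)"
  shows "rnat M a X \<in> arrows (rcat M j)" "src (rcat M j) (rnat M a X) = robj M F X"
    "tgt (rcat M j) (rnat M a X) = robj M G X"
proof -
  interpret F: linear_functor_between "rcat M i" "rcat M j" "robj M F" "rmor M F"
    using functor_between assms by blast
  interpret G: linear_functor_between "rcat M i" "rcat M j" "robj M G" "rmor M G"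
    using functor_between assms by blast
  have "rnat M a X \<in> hom (rcat M j) (robj M F X) (robj M G X)"
    using nat_rep assms unfolding nat_transformation_def by blast
  then show "rnat M a X \<in> arrows (rcat M j)" "src (rcat M j) (rnat M a X) = robj M F X"
    "tgt (rcat M j) (rnat M a X) = robj M G X" using assms by simp_all
qed

lemma rnat_natural:
  assumes "i \<in> Obj C" "j \<in> Obj C" "F \<in> mor1 C i j" "G \<in> mor1 C i j" "a \<in> mor2 C i j F G"
    "f \<in> arrows (rcat M i)"
  shows "rnat M a (tgt (rcat M i) f) \<cdot>\<^bsub>rcat M j\<^esub> rmor M F f = rmor M G f \<cdot>\<^bsub>rcat M j\<^esub> rnat M a (src (rcat M i) f)"
proof -
  interpret linear_category "rcat M i" using linear_rcat assms by blast
  show ?thesis using nat_rep[OF assms(1-5)] arr_src_tgt[OF assms(6)]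
    unfolding nat_transformation_def by blast
qed

lemma restrict:
  assumes S: "\<And>i j F X. \<lbrakk>i \<in> Obj C; j \<in> Obj C; F \<in> mor1 C i j; X \<in> Ob (rcat M i); X \<in> S i\<rbrakk> \<Longrightarrow> robj M F X \<in> S j"
  shows "linear_2representation C (restrict_rep M S)"
proof (intro linear_2representation.intro linear_2representation_axioms.intro)
  show "finitary_2category C" by unfold_locales
  show "linear_category (rcat (restrict_rep M S) i)" if "i \<in> Obj C" for i
    using linear_category.linear_full_subcat linear_rcat that by simp blast
next
  fix i j F assume ij: "i \<in> Obj C" "j \<in> Obj C" "F \<in> mor1 C i j"
  interpret F: linear_functor_between "rcat M i" "rcat M j" "robj M F" "rmor M F"
    using functor_between ij by blast
  show "linear_functor (rcat (restrict_rep M S) i) (rcat (restrict_rep M S) j)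
    (robj (restrict_rep M S) F) (rmor (restrict_rep M S) F)"
    using S[OF ij] unfolding linear_functor_def by simp
  fix G a assume "G \<in> mor1 C i j" "a \<in> mor2 C i j F G"
  then show "nat_transformation (rcat (restrict_rep M S) i) (rcat (restrict_rep M S) j)
     (robj (restrict_rep M S) F) (rmor (restrict_rep M S) F) (robj (restrict_rep M S) G)
     (rmor (restrict_rep M S) G) (rnat (restrict_rep M S) a)"
    using nat_rep[OF ij] unfolding nat_transformation_def by simp
next
  fix i j k F G f assume "i \<in> Obj C" "j \<in> Obj C" "k \<in> Obj C" "F \<in> mor1 C i j" "G \<in> mor1 C j k"
    "f \<in> arrows (rcat (restrict_rep M S) i)"
  then show "rmor (restrict_rep M S) (comp1 C G F) f = rmor (restrict_rep M S) G (rmor (restrict_rep M S) F f)"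
    using rmor_comp1 linear_category.arr_full_subcat[OF linear_rcat] by simp
qed (simp add: robj_comp1)

context
  fixes I
  assumes I: "stable_ideal C M I"
begin

lemma category_with_ideal_rcat: "i \<in> Obj C \<Longrightarrow> category_with_ideal (rcat M i) (I i)"
  using I linear_rcat unfolding stable_ideal_def
  by (simp add: category_with_ideal.intro category_with_ideal_axioms.intro)

lemma rmor_quotient:
  assumes ij: "i \<in> Obj C" "j \<in> Obj C" "F \<in> mor1 C i j" and f: "f \<in> arrows (rcat M i)"
  shows "rmor (quotient_rep C M I) F (coset (rcat M i) (I i) f) = coset (rcat M j) (I j) (rmor M F f)"
proof -
  interpret i: category_with_ideal "rcat M i" "I i" using category_with_ideal_rcat ij by blast
  interpret j: category_with_ideal "rcat M j" "I j" using category_with_ideal_rcat ij by blast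
  interpret F: linear_functor_between "rcat M i" "rcat M j" "robj M F" "rmor M F"
    using functor_between ij by blast
  have "coset (rcat M j) (I j) (rmor M F g) = coset (rcat M j) (I j) (rmor M F f)"
    if "g \<in> coset (rcat M i) (I i) f" for g
  proof -
    have g: "g \<in> arrows (rcat M i)" "src (rcat M i) g = src (rcat M i) f" "tgt (rcat M i) g = tgt (rcat M i) f"
      "g \<boxplus>\<^bsub>rcat M i\<^esub> (-1) \<odot>\<^bsub>rcat M i\<^esub> f \<in> I i" using that f by (simp_all add: i.mem_coset_iff)
    then have "rmor M F (g \<boxplus>\<^bsub>rcat M i\<^esub> (-1) \<odot>\<^bsub>rcat M i\<^esub> f) \<in> I j"
      using I ij unfolding stable_ideal_def by blast
    then show ?thesis using f g(1-3) j.coset_eq_iff[of "rmor M F f" "rmor M F g"] by simp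
  qed
  then show ?thesis
    unfolding quotient_rep_def two_rep.simps tgt1_eq[OF ij]
    by (rule UN_constant_on[OF i.self_mem_coset[OF f]])
qed

lemma rnat_quotient:
  assumes "i \<in> Obj C" "j \<in> Obj C" "F \<in> mor1 C i j" "G \<in> mor1 C i j" "a \<in> mor2 C i j F G"
  shows "rnat (quotient_rep C M I) a X = coset (rcat M j) (I j) (rnat M a X)"
  unfolding quotient_rep_def two_rep.simps tgt2_eq[OF assms] ..

lemma linear_quotient: "linear_2representation C (quotient_rep C M I)"
proof (intro linear_2representation.intro linear_2representation_axioms.intro)
  show "finitary_2category C" by unfold_locales
  show "linear_category (rcat (quotient_rep C M I) i)" if "i \<in> Obj C" for i
    using category_with_ideal.linear_quotient[OF category_with_ideal_rcat[OF that]] by simp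
next
  fix i j F assume ij: "i \<in> Obj C" "j \<in> Obj C" "F \<in> mor1 C i j"
  interpret i: category_with_ideal "rcat M i" "I i" using category_with_ideal_rcat ij by blast
  interpret j: category_with_ideal "rcat M j" "I j" using category_with_ideal_rcat ij by blast
  interpret F: linear_functor_between "rcat M i" "rcat M j" "robj M F" "rmor M F"
    using functor_between ij by blast
  note r = rmor_quotient[OF ij]
  have rj: "coset (rcat M j) (I j) (rmor M F f) \<in> hom j.AI X' Y'"
    if "f \<in> arrows (rcat M i)" "robj M F (src (rcat M i) f) = X'" "robj M F (tgt (rcat M i) f) = Y'" for f X' Y'
    by (rule j.hom_quotientI) (use that in simp_all)
  show "linear_functor (rcat (quotient_rep C M I) i) (rcat (quotient_rep C M I) j)
    (robj (quotient_rep C M I) F) (rmor (quotient_rep C M I) F)"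
    unfolding linear_functor_def quotient_rep_simps i.Ob_quotient
    by (auto elim!: i.hom_quotientE simp: r rj i.idm_quotient j.idm_quotient
        i.cmp_quotient i.plus_quotient i.scale_quotient j.cmp_quotient j.plus_quotient j.scale_quotient
        simp del: i.quotient.pres_idm i.quotient.pres_cmp i.quotient.pres_plus i.quotient.pres_scale
          j.quotient.pres_idm j.quotient.pres_cmp j.quotient.pres_plus j.quotient.pres_scale)
  fix G a assume a: "G \<in> mor1 C i j" "a \<in> mor2 C i j F G"
  interpret G: linear_functor_between "rcat M i" "rcat M j" "robj M G" "rmor M G"
    using functor_between ij a by blast
  note r' = rmor_quotient[OF ij(1,2) a(1)]
  note n = rnat_quotient[OF ij a] rnat_arr[OF ij a]
  show "nat_transformation (rcat (quotient_rep C M I) i) (rcat (quotient_rep C M I) j)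
    (robj (quotient_rep C M I) F) (rmor (quotient_rep C M I) F) (robj (quotient_rep C M I) G)
    (rmor (quotient_rep C M I) G) (rnat (quotient_rep C M I) a)"
    unfolding nat_transformation_def quotient_rep_simps i.Ob_quotient
  proof (intro conjI ballI)
    fix X assume "X \<in> Ob (rcat M i)"
    then show "rnat (quotient_rep C M I) a X \<in> hom j.AI (robj M F X) (robj M G X)"
      unfolding n(1) by (intro j.hom_quotientI) (simp_all add: n)
  next
    fix X Y m assume X: "X \<in> Ob (rcat M i)" "Y \<in> Ob (rcat M i)" "m \<in> hom i.AI X Y"
    then obtain f where f: "m = coset (rcat M i) (I i) f" "f \<in> arrows (rcat M i)"
      "src (rcat M i) f = X" "tgt (rcat M i) f = Y" by (metis i.hom_quotientE)
    then show "rnat (quotient_rep C M I) a Y \<cdot>\<^bsub>j.AI\<^esub> rmor (quotient_rep C M I) F m =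
      rmor (quotient_rep C M I) G m \<cdot>\<^bsub>j.AI\<^esub> rnat (quotient_rep C M I) a X"
      using rnat_natural[OF ij a f(2)] X
      by (simp add: r r' n j.cmp_quotient del: j.quotient.pres_cmp)
  qed
next
  fix i j k F G X assume "i \<in> Obj C" "j \<in> Obj C" "k \<in> Obj C" "F \<in> mor1 C i j" "G \<in> mor1 C j k"
    "X \<in> Ob (rcat (quotient_rep C M I) i)"
  then show "robj (quotient_rep C M I) (comp1 C G F) X = robj (quotient_rep C M I) G (robj (quotient_rep C M I) F X)"
    using category_with_ideal.Ob_quotient[OF category_with_ideal_rcat] by (simp add: robj_comp1)
next
  fix i j k F G m assume ijk: "i \<in> Obj C" "j \<in> Obj C" "k \<in> Obj C" "F \<in> mor1 C i j" "G \<in> mor1 C j k"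
    and m: "m \<in> arrows (rcat (quotient_rep C M I) i)"
  interpret i: category_with_ideal "rcat M i" "I i" using category_with_ideal_rcat ijk by blast
  interpret F: linear_functor_between "rcat M i" "rcat M j" "robj M F" "rmor M F"
    using functor_between ijk by blast
  obtain f where "m = coset (rcat M i) (I i) f" "f \<in> arrows (rcat M i)"
    using m i.arr_quotientE by (metis quotient_rep_simps(1))
  then show "rmor (quotient_rep C M I) (comp1 C G F) m = rmor (quotient_rep C M I) G (rmor (quotient_rep C M I) F m)"
    using ijk by (simp add: rmor_quotient[of i j F] rmor_quotient[of j k G] rmor_quotient[of i k] comp1_in[of i j k] rmor_comp1[of i j k])
qed

end

end

section \<open>Full subrepresentations with the same essential image\<close>

definition full_2embedding ::
  "('i, 'f, 'a, 'k::field) two_cat \<Rightarrow> ('i, 'f, 'a, 'o, 'n, 'k) two_rep \<Rightarrow> ('i, 'f, 'a, 'o, 'm, 'k) two_rep \<Rightarrow>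
    ('i \<Rightarrow> 'n \<Rightarrow> 'm) \<Rightarrow> bool" where
  "full_2embedding C L B \<iota> \<longleftrightarrow>
    (\<forall>i\<in>Obj C. full_embedding (rcat L i) (rcat B i) (\<iota> i)) \<and>
    (\<forall>i\<in>Obj C. \<forall>j\<in>Obj C. \<forall>F\<in>mor1 C i j.
      (\<forall>X\<in>Ob (rcat L i). robj L F X = robj B F X) \<and>
      (\<forall>f\<in>arrows (rcat L i). \<iota> j (rmor L F f) = rmor B F (\<iota> i f)) \<and>
      (\<forall>G\<in>mor1 C i j. \<forall>a\<in>mor2 C i j F G. \<forall>X\<in>Ob (rcat L i). \<iota> j (rnat L a X) = rnat B a X))"

text \<open>
  Let \<open>u X : X \<rightarrow> T X\<close> be the isomorphisms that define the transfer. The coherence isomorphisms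
  \<open>T (F X) \<rightarrow> F X \<rightarrow> F (T X)\<close> are composed of the inverse of \<open>u (F X)\<close> and of \<open>F (u X)\<close>.
\<close>

theorem equivalent_full_subrepresentations:
  fixes L :: "('i, 'f, 'a, 'o, 'n, 'k::field) two_rep" and L' :: "('i, 'f, 'a, 'o, 'p, 'k) two_rep"
    and B :: "('i, 'f, 'a, 'o, 'm, 'k) two_rep"
  assumes L: "linear_2representation C L" and L': "linear_2representation C L'"
    and B: "linear_2representation C B"
    and emb: "full_2embedding C L B \<iota>" and emb': "full_2embedding C L' B \<iota>'"
    and iso: "\<forall>i\<in>Obj C. \<forall>X\<in>Ob (rcat L i). \<exists>X'\<in>Ob (rcat L' i). isomorphic (rcat B i) X X'"
    and iso': "\<forall>i\<in>Obj C. \<forall>X\<in>Ob (rcat L' i). \<exists>X'\<in>Ob (rcat L i). isomorphic (rcat B i) X X'"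
  shows "equivalent_2rep C L L'"
proof -
  interpret L: linear_2representation C L by (rule L)
  interpret L': linear_2representation C L' by (rule L')
  interpret B: linear_2representation C B by (rule B)
  have emb1: "full_embedding (rcat L i) (rcat B i) (\<iota> i)" "full_embedding (rcat L' i) (rcat B i) (\<iota>' i)"
    if "i \<in> Obj C" for i
    using emb emb' that unfolding full_2embedding_def by blast+
  have emb2: "X \<in> Ob (rcat L i) \<Longrightarrow> robj L F X = robj B F X"
    "X' \<in> Ob (rcat L' i) \<Longrightarrow> robj L' F X' = robj B F X'"
    "f \<in> arrows (rcat L i) \<Longrightarrow> \<iota> j (rmor L F f) = rmor B F (\<iota> i f)"
    "f' \<in> arrows (rcat L' i) \<Longrightarrow> \<iota>' j (rmor L' F f') = rmor B F (\<iota>' i f')"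
    if "i \<in> Obj C" "j \<in> Obj C" "F \<in> mor1 C i j" for i j F X X' f f'
    using emb emb' that unfolding full_2embedding_def by blast+
  have emb3: "X \<in> Ob (rcat L i) \<Longrightarrow> \<iota> j (rnat L a X) = rnat B a X"
    "X' \<in> Ob (rcat L' i) \<Longrightarrow> \<iota>' j (rnat L' a X') = rnat B a X'"
    if "i \<in> Obj C" "j \<in> Obj C" "F \<in> mor1 C i j" "G \<in> mor1 C i j" "a \<in> mor2 C i j F G" for i j F G a X X'
    using emb emb' that unfolding full_2embedding_def by blast+
  have "\<forall>i. \<exists>T u v. i \<in> Obj C \<longrightarrow> transfer (rcat L i) (rcat B i) (\<iota> i) (rcat L' i) (\<iota>' i) T u v"
    using transfer_exists emb1 iso by metis
  then obtain T u v where tr: "\<And>i. i \<in> Obj C \<Longrightarrow>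
    transfer (rcat L i) (rcat B i) (\<iota> i) (rcat L' i) (\<iota>' i) (T i) (u i) (v i)" by metis
  have tr': "\<exists>T' u' v'. transfer (rcat L' i) (rcat B i) (\<iota>' i) (rcat L i) (\<iota> i) T' u' v'"
    if "i \<in> Obj C" for i
    using transfer_exists emb1[OF that] iso' that by metis
  define \<Phi> where "\<Phi> = (\<lambda>i. transfer.conj (rcat L i) (rcat B i) (\<iota> i) (rcat L' i) (\<iota>' i) (u i) (v i))"
  have "category_equivalence (rcat L i) (rcat L' i) (T i) (\<Phi> i)" if "i \<in> Obj C" for i
    unfolding \<Phi>_def using transfer_equivalence tr[OF that] tr'[OF that] by metis
  define w where "w = (\<lambda>i j F X. rmor B F (u i X) \<cdot>\<^bsub>rcat B j\<^esub> v j (robj B F X))"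
  define e where "e = (\<lambda>F X. full_embedding.lift (rcat L' (tgt1 C F)) (rcat B (tgt1 C F)) (\<iota>' (tgt1 C F))
    (w (src1 C F) (tgt1 C F) F X))"
  have robj_in: "robj B F X \<in> Ob (rcat L j)" "robj B F X' \<in> Ob (rcat L' j)"
    if "i \<in> Obj C" "j \<in> Obj C" "F \<in> mor1 C i j" "X \<in> Ob (rcat L i)" "X' \<in> Ob (rcat L' i)" for i j F X X'
    using emb2(1,2)[OF that(1-3)] that(4,5) linear_functor_between.obj[OF L.functor_between[OF that(1-3)]]
      linear_functor_between.obj[OF L'.functor_between[OF that(1-3)]] by metis+
  have w: "w i j F X \<in> arrows (rcat B j)" "src (rcat B j) (w i j F X) = T j (robj B F X)"
    "tgt (rcat B j) (w i j F X) = robj B F (T i X)"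
    "is_iso (rcat B j) (T j (robj B F X)) (robj B F (T i X)) (w i j F X)"
    and e: "\<iota>' j (e F X) = w i j F X" "e F X \<in> arrows (rcat L' j)"
    "src (rcat L' j) (e F X) = T j (robj B F X)" "tgt (rcat L' j) (e F X) = robj B F (T i X)"
    "is_iso (rcat L' j) (T j (robj B F X)) (robj B F (T i X)) (e F X)"
    if ij: "i \<in> Obj C" "j \<in> Obj C" "F \<in> mor1 C i j" and X: "X \<in> Ob (rcat L i)" for i j F X
  proof -
    interpret i: transfer "rcat L i" "rcat B i" "\<iota> i" "rcat L' i" "\<iota>' i" "T i" "u i" "v i" by (rule tr[OF ij(1)])
    interpret j: transfer "rcat L j" "rcat B j" "\<iota> j" "rcat L' j" "\<iota>' j" "T j" "u j" "v j" by (rule tr[OF ij(2)])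
    interpret F: linear_functor_between "rcat B i" "rcat B j" "robj B F" "rmor B F"
      by (rule B.functor_between[OF ij])
    have FX: "robj B F X \<in> Ob (rcat L j)" "robj B F (T i X) \<in> Ob (rcat L' j)"
      using robj_in[OF ij X, of "T i X"] X by simp_all
    have F: "rmor B F (u i X) \<cdot>\<^bsub>rcat B j\<^esub> rmor B F (v i X) = idm (rcat B j) (robj B F (T i X))"
      "rmor B F (v i X) \<cdot>\<^bsub>rcat B j\<^esub> rmor B F (u i X) = idm (rcat B j) (robj B F X)"
      using F.pres_cmp[of "v i X" "u i X"] F.pres_cmp[of "u i X" "v i X"] X by simp_all
    note re = F[THEN j.L.B.cmp_reassoc]
    show 1: "w i j F X \<in> arrows (rcat B j)" "src (rcat B j) (w i j F X) = T j (robj B F X)"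
      "tgt (rcat B j) (w i j F X) = robj B F (T i X)"
      using X FX by (simp_all add: w_def)
    show 2: "is_iso (rcat B j) (T j (robj B F X)) (robj B F (T i X)) (w i j F X)"
      unfolding w_def
      by (rule j.L.B.is_isoI[of _ "u j (robj B F X) \<cdot>\<^bsub>rcat B j\<^esub> rmor B F (v i X)"])
        (use X FX F in \<open>simp_all add: re\<close>)
    have eq: "e F X = j.L'.lift (w i j F X)"
      unfolding e_def L.src1_eq[OF ij] L.tgt1_eq[OF ij] ..
    show "\<iota>' j (e F X) = w i j F X" "e F X \<in> arrows (rcat L' j)"
      "src (rcat L' j) (e F X) = T j (robj B F X)" "tgt (rcat L' j) (e F X) = robj B F (T i X)"
      unfolding eq using 1 FX by simp_all
    show "is_iso (rcat L' j) (T j (robj B F X)) (robj B F (T i X)) (e F X)"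
      unfolding eq by (rule j.L'.lift_iso[OF 2]) (use FX in simp_all)
  qed
  have "two_nat_transformation C L L' T \<Phi> e"
    unfolding two_nat_transformation_def
  proof (intro conjI ballI)
    fix i assume "i \<in> Obj C"
    then show "linear_functor (rcat L i) (rcat L' i) (T i) (\<Phi> i)"
      unfolding \<Phi>_def using transfer.linear_conj[OF tr] by blast
  next
    fix i j F assume ij: "i \<in> Obj C" "j \<in> Obj C" "F \<in> mor1 C i j"
    interpret i: transfer "rcat L i" "rcat B i" "\<iota> i" "rcat L' i" "\<iota>' i" "T i" "u i" "v i" by (rule tr[OF ij(1)])
    interpret j: transfer "rcat L j" "rcat B j" "\<iota> j" "rcat L' j" "\<iota>' j" "T j" "u j" "v j" by (rule tr[OF ij(2)])
    interpret F: linear_functor_between "rcat B i" "rcat B j" "robj B F" "rmor B F"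
      by (rule B.functor_between[OF ij])
    interpret LF: linear_functor_between "rcat L i" "rcat L j" "robj L F" "rmor L F"
      by (rule L.functor_between[OF ij])
    interpret LF': linear_functor_between "rcat L' i" "rcat L' j" "robj L' F" "rmor L' F"
      by (rule L'.functor_between[OF ij])
    note eF = e[OF ij] w(1-3)[OF ij] and FX = emb2[OF ij]
    have Fvu: "rmor B F (v i X) \<cdot>\<^bsub>rcat B j\<^esub> (rmor B F (u i X) \<cdot>\<^bsub>rcat B j\<^esub> b) = b"
      if "X \<in> Ob (rcat L i)" "b \<in> arrows (rcat B j)" "tgt (rcat B j) b = robj B F X" for X b
      using j.L.B.cmp_reassoc[of "rmor B F (v i X)" "rmor B F (u i X)" "idm (rcat B j) (robj B F X)" b]
        F.pres_cmp[of "u i X" "v i X"] that by simp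
    have "e F Y \<cdot>\<^bsub>rcat L' j\<^esub> \<Phi> j (rmor L F f) = rmor L' F (\<Phi> i f) \<cdot>\<^bsub>rcat L' j\<^esub> e F X"
      if f: "f \<in> arrows (rcat L i)" "src (rcat L i) f = X" "tgt (rcat L i) f = Y" for X Y f
    proof -
      have XY: "X \<in> Ob (rcat L i)" "Y \<in> Ob (rcat L i)" using f by auto
      have FXY: "robj B F X \<in> Ob (rcat L j)" "robj B F Y \<in> Ob (rcat L j)"
        "robj B F (T i X) \<in> Ob (rcat L' j)" "robj B F (T i Y) \<in> Ob (rcat L' j)"
        using robj_in[OF ij XY(1), of "T i X"] robj_in[OF ij XY(2), of "T i Y"] XY by simp_all
      show ?thesis
      proof (rule j.L'.faithful)
        show "\<iota>' j (e F Y \<cdot>\<^bsub>rcat L' j\<^esub> \<Phi> j (rmor L F f)) = \<iota>' j (rmor L' F (\<Phi> i f) \<cdot>\<^bsub>rcat L' j\<^esub> e F X)"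
          unfolding \<Phi>_def using f XY FXY by (simp add: eF FX w_def Fvu)
      qed (use f XY FXY in \<open>simp_all add: \<Phi>_def eF FX\<close>)
    qed
    moreover have "robj B F X \<in> Ob (rcat L j)" "robj B F (T i X) \<in> Ob (rcat L' j)"
      if "X \<in> Ob (rcat L i)" for X
      using robj_in[OF ij, of X "T i X"] that by simp_all
    ultimately show "nat_isomorphism (rcat L i) (rcat L' j) (T j \<circ> robj L F) (\<Phi> j \<circ> rmor L F)
      (robj L' F \<circ> T i) (rmor L' F \<circ> \<Phi> i) (e F)"
      unfolding nat_isomorphism_def nat_transformation_def
      using eF FX by simp
  next
    fix i j F G a X assume ij: "i \<in> Obj C" "j \<in> Obj C" "F \<in> mor1 C i j" and G: "G \<in> mor1 C i j"
      and a: "a \<in> mor2 C i j F G" and X: "X \<in> Ob (rcat L i)"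
    interpret i: transfer "rcat L i" "rcat B i" "\<iota> i" "rcat L' i" "\<iota>' i" "T i" "u i" "v i" by (rule tr[OF ij(1)])
    interpret j: transfer "rcat L j" "rcat B j" "\<iota> j" "rcat L' j" "\<iota>' j" "T j" "u j" "v j" by (rule tr[OF ij(2)])
    interpret F: linear_functor_between "rcat B i" "rcat B j" "robj B F" "rmor B F"
      by (rule B.functor_between[OF ij])
    interpret G: linear_functor_between "rcat B i" "rcat B j" "robj B G" "rmor B G"
      by (rule B.functor_between[OF ij(1,2) G])
    have TX: "T i X \<in> Ob (rcat L' i)" using X by simp
    have FX: "robj B F X \<in> Ob (rcat L j)" "robj B F (T i X) \<in> Ob (rcat L' j)"
        "robj B G X \<in> Ob (rcat L j)" "robj B G (T i X) \<in> Ob (rcat L' j)"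
      using robj_in[OF ij X TX] robj_in[OF ij(1,2) G X TX] by simp_all
    note n = L.rnat_arr[OF ij G a X] L'.rnat_arr[OF ij G a TX] emb2(1)[OF ij X] emb2(1)[OF ij(1,2) G X]
      emb2(2)[OF ij TX] emb2(2)[OF ij(1,2) G TX]
      emb3(1)[OF ij G a X] emb3(2)[OF ij G a TX]
      e(1-4)[OF ij X] e(1-4)[OF ij(1,2) G X]
    have nB: "rnat B a X \<in> arrows (rcat B j)" "src (rcat B j) (rnat B a X) = robj B F X"
      "tgt (rcat B j) (rnat B a X) = robj B G X" 
      "rnat B a (T i X) \<in> arrows (rcat B j)" "src (rcat B j) (rnat B a (T i X)) = robj B F (T i X)"
      "tgt (rcat B j) (rnat B a (T i X)) = robj B G (T i X)" 
      using B.rnat_arr[OF ij G a] X TX by simp_all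
    have nat: "rnat B a (T i X) \<cdot>\<^bsub>rcat B j\<^esub> rmor B F (u i X) = rmor B G (u i X) \<cdot>\<^bsub>rcat B j\<^esub> rnat B a X"
      using B.rnat_natural[OF ij G a, of "u i X"] X by simp
    show "rnat L' a (T i X) \<cdot>\<^bsub>rcat L' j\<^esub> e F X = e G X \<cdot>\<^bsub>rcat L' j\<^esub> \<Phi> j (rnat L a X)"
    proof (rule j.L'.faithful)
      show "\<iota>' j (rnat L' a (T i X) \<cdot>\<^bsub>rcat L' j\<^esub> e F X) = \<iota>' j (e G X \<cdot>\<^bsub>rcat L' j\<^esub> \<Phi> j (rnat L a X))"
        unfolding \<Phi>_def using X FX by (simp add: n nB w_def j.L.B.cmp_reassoc[OF nat])
    qed (use X FX in \<open>simp_all add: \<Phi>_def n\<close>)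
  next
    fix i j k F G X assume ij: "i \<in> Obj C" "j \<in> Obj C" and k: "k \<in> Obj C"
      and F: "F \<in> mor1 C i j" and G: "G \<in> mor1 C j k" and X: "X \<in> Ob (rcat L i)"
    interpret i: transfer "rcat L i" "rcat B i" "\<iota> i" "rcat L' i" "\<iota>' i" "T i" "u i" "v i" by (rule tr[OF ij(1)])
    interpret j: transfer "rcat L j" "rcat B j" "\<iota> j" "rcat L' j" "\<iota>' j" "T j" "u j" "v j" by (rule tr[OF ij(2)])
    interpret k: transfer "rcat L k" "rcat B k" "\<iota> k" "rcat L' k" "\<iota>' k" "T k" "u k" "v k" by (rule tr[OF k])
    interpret F: linear_functor_between "rcat B i" "rcat B j" "robj B F" "rmor B F"
      by (rule B.functor_between[OF ij F])
    interpret G: linear_functor_between "rcat B j" "rcat B k" "robj B G" "rmor B G"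
      by (rule B.functor_between[OF ij(2) k G])
    interpret G': linear_functor_between "rcat L' j" "rcat L' k" "robj L' G" "rmor L' G"
      by (rule L'.functor_between[OF ij(2) k G])
    have GF: "comp1 C G F \<in> mor1 C i k" using L.comp1_in ij k F G by blast
    have TX: "T i X \<in> Ob (rcat L' i)" using X by simp
    have FX: "robj B F X \<in> Ob (rcat L j)" "robj B F (T i X) \<in> Ob (rcat L' j)"
      using robj_in[OF ij F X TX] by simp_all
    then have TFX: "T j (robj B F X) \<in> Ob (rcat L' j)" by simp
    have GFX: "robj B G (robj B F X) \<in> Ob (rcat L k)" "robj B G (robj B F (T i X)) \<in> Ob (rcat L' k)"
      "robj B G (T j (robj B F X)) \<in> Ob (rcat L' k)"
      using robj_in[OF ij(2) k G FX] robj_in[OF ij(2) k G FX(1) TFX] by simp_all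
    have comp: "robj B (comp1 C G F) X = robj B G (robj B F X)"
      "robj B (comp1 C G F) (T i X) = robj B G (robj B F (T i X))"
      "rmor B (comp1 C G F) (u i X) = rmor B G (rmor B F (u i X))"
      using B.robj_comp1[OF ij k F G] B.rmor_comp1[OF ij k F G] X TX by simp_all
    have Gvu: "rmor B G (v j (robj B F X)) \<cdot>\<^bsub>rcat B k\<^esub> (rmor B G (u j (robj B F X)) \<cdot>\<^bsub>rcat B k\<^esub> b) = b"
      if "b \<in> arrows (rcat B k)" "tgt (rcat B k) b = robj B G (robj B F X)" for b
      using k.L.B.cmp_reassoc[of "rmor B G (v j (robj B F X))" "rmor B G (u j (robj B F X))"
          "idm (rcat B k) (robj B G (robj B F X))" b]
        G.pres_cmp[of "u j (robj B F X)" "v j (robj B F X)"] FX that by simp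
    note n = e(1-4)[OF ij F X] e(1-4)[OF ij(2) k G FX(1)] e(1-4)[OF ij(1) k GF X]
       emb2(1)[OF ij F X] emb2(2,4)[OF ij(2) k G] comp
    show "e (comp1 C G F) X = rmor L' G (e F X) \<cdot>\<^bsub>rcat L' k\<^esub> e G (robj L F X)"
    proof (rule k.L'.faithful)
      show "\<iota>' k (e (comp1 C G F) X) = \<iota>' k (rmor L' G (e F X) \<cdot>\<^bsub>rcat L' k\<^esub> e G (robj L F X))"
        using X FX GFX TFX by (simp add: n w_def Gvu)
    qed (use X FX GFX TFX in \<open>simp_all add: n\<close>)
  qed
  then show ?thesis
    unfolding equivalent_2rep_def
    using \<open>\<And>i. i \<in> Obj C \<Longrightarrow> category_equivalence (rcat L i) (rcat L' i) (T i) (\<Phi> i)\<close> by blast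
qed

section \<open>Coideals and the objects they span\<close>

text \<open>
  Summands whose identity lies in the ideal become zero in the quotient and can be omitted.
\<close>

lemma (in category_with_ideal) isomorphic_quotient_filter:
  assumes "\<forall>Z\<in>set Xs. P Z \<or> idm A Z \<in> I" "finite_direct_sum A X Xs" "finite_direct_sum A V (filter P Xs)"
  shows "isomorphic AI X V"
  using assms
proof (induction Xs arbitrary: X V)
  case Nil
  then have "zero_object A X" "zero_object A V" by simp_all
  then show ?case
    using quotient.pres_zero_object quotient.B.zero_object_isomorphic by (metis id_apply)
next
  case (Cons Z Xs)
  obtain X' where X': "biproduct A X Z X'" "finite_direct_sum A X' Xs" using Cons.prems by auto
  have bp: "biproduct AI X Z X'" using quotient.pres_biproduct[OF X'(1)] by simp
  show ?case
  proof (cases "P Z")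
    case True
    then obtain V' where V': "biproduct A V Z V'" "finite_direct_sum A V' (filter P Xs)"
      using Cons.prems by auto
    then show ?thesis
      using quotient.B.biproduct_isomorphic[OF bp] quotient.pres_biproduct[OF V'(1)] Cons.IH X' Cons.prems
      by simp
  next
    case False
    then have "zero_object AI Z" using zero_object_quotient_iff X'(1) Cons.prems(1) unfolding biproduct_def by simp
    then have "isomorphic AI X X'" using quotient.B.biproduct_zero_isomorphic[OF bp] by blast
    moreover have "isomorphic AI X' V" using Cons.IH X' Cons.prems False by simp
    ultimately show ?thesis using quotient.B.isomorphic_trans by blast
  qed
qed

text \<open>
  An element of \<open>Q\<close> is a set of isomorphism classes, which are in turn sets of pairs.
\<close>

definition members :: "('i \<times> 'o) set set set \<Rightarrow> 'i \<Rightarrow> 'o set" where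
  "members Q i = {X. (i, X) \<in> \<Union>(\<Union>Q)}"

lemma members_Un: "members (P \<union> Q) i = members P i \<union> members Q i"
  unfolding members_def by blast

text \<open>
  The objects of \<open>M\<^bsub>Q\<^esub>(i)\<close>.
\<close>

definition (in finitary_2representation) objects :: "('i \<times> 'o) set set set \<Rightarrow> 'i \<Rightarrow> 'o set" where
  "objects Q i = additive_closure (rcat M i) (members Q i)"

context finitary_2representation
begin

sublocale linear: linear_2representation C M
  by (rule linear)

lemma sub_rep_eq: "sub_rep M Q = restrict_rep M (objects Q)"
  unfolding sub_rep_def restrict_rep_def objects_def members_def ..

lemma rcat_linear: "i \<in> Obj C \<Longrightarrow> linear_category (rcat M i)"
  by (rule linear.linear_rcat)

lemma members_indecomposable:
  assumes "Q \<subseteq> Ind_classes C M" "X \<in> members Q i"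
  shows "i \<in> Obj C" "indecomposable (rcat M i) X" "X \<in> Ob (rcat M i)"
proof -
  obtain q x where q: "q \<in> Ind_classes C M" "x \<in> q" "(i, X) \<in> x"
    using assms unfolding members_def by blast
  then have "x \<in> Ind C M" unfolding Ind_classes_def action_equiv_def quotient_def by blast
  then have "(i, X) \<in> indec_objects C M"
    using q(3) unfolding Ind_def iso_rel_def quotient_def by blast
  then show "i \<in> Obj C" "indecomposable (rcat M i) X" "X \<in> Ob (rcat M i)"
    unfolding indec_objects_def indecomposable_def by auto
qed

lemma action_geI:
  assumes "i \<in> Obj C" "(i, X) \<in> x" "(j, Y) \<in> y" "F \<in> mor1 C j i" "retract (rcat M i) X (robj M F Y)"
  shows "action_ge C M x y"
  using assms finitary_category.direct_summand_iff_retract[OF finitary_rcat[OF assms(1)]]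
  unfolding action_ge_def by blast

lemma action_ge_common:
  assumes "i \<in> Obj C" "X \<in> Ob (rcat M i)" "(i, X) \<in> x" "(i, X) \<in> y"
  shows "action_ge C M x y"
  by (rule action_geI[OF assms(1,3,4) Id1_in[OF assms(1)]])
    (use robj_Id1 assms linear_category.retract_refl[OF rcat_linear] in simp)

text \<open>
  The class of \<open>Y\<close> is above the class of \<open>X\<close> in the action preorder.
\<close>

lemma members_closed:
  assumes Q: "coideal C M Q" and ij: "i \<in> Obj C" "j \<in> Obj C" "F \<in> mor1 C i j"
    and X: "X \<in> members Q i" and Y: "indecomposable (rcat M j) Y" "retract (rcat M j) Y (robj M F X)"
  shows "Y \<in> members Q j"
proof -
  obtain q x where q: "q \<in> Q" "x \<in> q" "(i, X) \<in> x"
    using X unfolding members_def by blast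
  have YO: "Y \<in> Ob (rcat M j)" using Y unfolding indecomposable_def by blast
  define y where "y = iso_rel C M `` {(j, Y)}"
  have jY: "(j, Y) \<in> indec_objects C M" using Y ij unfolding indec_objects_def by simp
  then have y: "(j, Y) \<in> y" "y \<in> Ind C M"
    using linear_category.isomorphic_refl[OF rcat_linear[OF ij(2)] YO]
    unfolding y_def Ind_def by (simp add: iso_rel_def, intro quotientI)
  define q' where "q' = action_equiv C M `` {y}"
  have q': "y \<in> q'" "q' \<in> Ind_classes C M"
    using y action_ge_common[OF ij(2) YO y(1) y(1)]
    unfolding q'_def Ind_classes_def by (simp add: action_equiv_def, intro quotientI)
  have "action_ge C M y x" using action_geI[OF ij(2) y(1) q(3) ij(3) Y(2)] .
  then have "class_ge C M q' q" using q' q unfolding class_ge_def by blast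
  then have "q' \<in> Q" using Q q q' unfolding coideal_def by blast
  then show ?thesis using q' y unfolding members_def by blast
qed

text \<open>
  If \<open>X\<close> lay in \<open>p\<close> and in some \<open>q \<in> Q\<close>, the identity 1-morphism would show \<open>p \<ge> q\<close>.
\<close>

lemma members_disjoint:
  assumes Q: "coideal C M Q" and p: "p \<in> Ind_classes C M" "p \<notin> Q" and X: "X \<in> members {p} i"
  shows "X \<notin> members Q i"
proof
  assume "X \<in> members Q i"
  then obtain q y where q: "q \<in> Q" "y \<in> q" "(i, X) \<in> y" unfolding members_def by blast
  obtain x where x: "x \<in> p" "(i, X) \<in> x" using X unfolding members_def by blast
  have "action_ge C M x y"
    using action_ge_common x q members_indecomposable[of "{p}" X i] p X by blast
  then have "class_ge C M p q" using x q unfolding class_ge_def by blast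
  then show False using Q q p unfolding coideal_def by blast
qed

lemma direct_sum_objects:
  assumes "i \<in> Obj C" "finite_direct_sum (rcat M i) X Xs" "set Xs \<subseteq> members Q i"
  shows "X \<in> objects Q i"
proof -
  interpret finitary_category "rcat M i" using finitary_rcat assms by blast
  have "X \<in> Ob (rcat M i)" using finite_direct_sum_Ob assms by blast
  then have "direct_summand (rcat M i) X X" using retract_refl direct_summand_iff_retract by blast
  then show ?thesis unfolding objects_def additive_closure_def using assms by blast
qed

lemma members_objects:
  assumes "Q \<subseteq> Ind_classes C M" "Z \<in> members Q i"
  shows "Z \<in> objects Q i"
proof -
  have Z: "i \<in> Obj C" "Z \<in> Ob (rcat M i)" using members_indecomposable[OF assms] by blast+
  interpret finitary_category "rcat M i" using finitary_rcat Z by blast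
  obtain W where "zero_object (rcat M i) W" using zero_object_exists by blast
  then have "finite_direct_sum (rcat M i) Z [Z]" using biproduct_zero Z(2) by auto
  then show ?thesis by (rule direct_sum_objects[OF Z(1)]) (use assms(2) in simp)
qed

text \<open>
  An object of \<open>M\<^bsub>Q\<^esub>(i)\<close> is a summand of a sum of members of \<open>Q\<close>, so its indecomposable summands are
  summands of these members. In the other direction, an object is the sum of its indecomposable
  summands.
\<close>

lemma objects_iff:
  assumes Q: "coideal C M Q" and i: "i \<in> Obj C"
  shows "X \<in> objects Q i \<longleftrightarrow> X \<in> Ob (rcat M i) \<and>
    (\<forall>Y. indecomposable (rcat M i) Y \<and> retract (rcat M i) Y X \<longrightarrow> Y \<in> members Q i)"
proof -
  interpret i: finitary_category "rcat M i" using finitary_rcat i by blast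
  interpret F: linear_functor_between "rcat M i" "rcat M i" "robj M (Id1 C i)" "rmor M (Id1 C i)"
    using linear.functor_between Id1_in i by blast
  show ?thesis
  proof (intro iffI conjI allI impI)
    assume "X \<in> objects Q i"
    then obtain W Xs where W: "set Xs \<subseteq> members Q i" "finite_direct_sum (rcat M i) W Xs" "retract (rcat M i) X W"
      unfolding objects_def additive_closure_def i.direct_summand_iff_retract by blast
    then show "X \<in> Ob (rcat M i)" by (blast elim: i.retractE)
    fix Y assume Y: "indecomposable (rcat M i) Y \<and> retract (rcat M i) Y X"
    then have "retract (rcat M i) Y W" using W i.retract_trans by blast
    moreover have "robj M (Id1 C i) W = W" using robj_Id1 i i.finite_direct_sum_Ob[OF W(2)] by blast
    ultimately obtain Z where "Z \<in> set Xs" "retract (rcat M i) Y (robj M (Id1 C i) Z)"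
      using F.indecomposable_retract_image_sum[OF finitary_rcat[OF i] _ W(2)] Y by metis
    then show "Y \<in> members Q i" using members_closed[OF Q i i Id1_in[OF i]] Y W(1) by blast
  next
    assume X: "X \<in> Ob (rcat M i) \<and>
      (\<forall>Y. indecomposable (rcat M i) Y \<and> retract (rcat M i) Y X \<longrightarrow> Y \<in> members Q i)"
    then obtain Xs where Xs: "finite_direct_sum (rcat M i) X Xs" "\<forall>Y\<in>set Xs. indecomposable (rcat M i) Y"
      using i.finite_direct_sum_indecomposables by blast
    then have "set Xs \<subseteq> members Q i" using X i.finite_direct_sum_retract by blast
    then show "X \<in> objects Q i" using direct_sum_objects i Xs by blast
  qed
qed

lemma objects_decomposition:
  assumes Q: "coideal C M Q" and i: "i \<in> Obj C" and X: "X \<in> objects Q i"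
  obtains Xs where "finite_direct_sum (rcat M i) X Xs" "set Xs \<subseteq> members Q i"
proof -
  interpret i: finitary_category "rcat M i" using finitary_rcat i by blast
  obtain Xs where Xs: "finite_direct_sum (rcat M i) X Xs" "\<forall>Y\<in>set Xs. indecomposable (rcat M i) Y"
    using i.finite_direct_sum_indecomposables objects_iff[OF Q i] X by blast
  then have "set Xs \<subseteq> members Q i" using X i.finite_direct_sum_retract objects_iff[OF Q i] by blast
  then show ?thesis using that Xs by blast
qed

text \<open>
  An indecomposable summand of \<open>F X\<close> is a summand of \<open>F Z\<close> for an indecomposable summand \<open>Z\<close> of \<open>X\<close>.
\<close>

lemma objects_stable:
  assumes Q: "coideal C M Q" and ij: "i \<in> Obj C" "j \<in> Obj C" "F \<in> mor1 C i j"
    and X: "X \<in> objects Q i"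
  shows "robj M F X \<in> objects Q j"
proof -
  interpret F: linear_functor_between "rcat M i" "rcat M j" "robj M F" "rmor M F"
    using linear.functor_between ij by blast
  obtain Xs where Xs: "finite_direct_sum (rcat M i) X Xs" "set Xs \<subseteq> members Q i"
    using objects_decomposition[OF Q ij(1) X] .
  have "Y \<in> members Q j" if Y: "indecomposable (rcat M j) Y" "retract (rcat M j) Y (robj M F X)" for Y
    using F.indecomposable_retract_image_sum[OF finitary_rcat[OF ij(2)] Y(1) Xs(1) Y(2)]
      members_closed[OF Q ij _ Y(1)] Xs(2) by blast
  moreover have "robj M F X \<in> Ob (rcat M j)" using F.obj X objects_iff[OF Q ij(1)] by blast
  ultimately show ?thesis using objects_iff[OF Q ij(2)] by blast
qed

section \<open>The ideal of a class\<close>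

text \<open>
  Some 1-morphism \<open>F\<close> and some object \<open>Z\<close> of the class detect \<open>f\<close>: a composite
  \<open>Z \<rightarrow> F X \<rightarrow> F Y \<rightarrow> Z\<close> with middle arrow \<open>F f\<close> is an isomorphism.
\<close>

definition iso_on_class :: "('i \<times> 'o) set set \<Rightarrow> 'i \<Rightarrow> 'm \<Rightarrow> bool" where
  "iso_on_class p i f \<longleftrightarrow> (\<exists>j\<in>Obj C. \<exists>F\<in>mor1 C i j. \<exists>Z\<in>members {p} j.
    \<exists>g\<in>arrows (rcat M j). \<exists>h\<in>arrows (rcat M j).
      src (rcat M j) g = Z \<and> tgt (rcat M j) g = robj M F (src (rcat M i) f) \<and>
      src (rcat M j) h = robj M F (tgt (rcat M i) f) \<and> tgt (rcat M j) h = Z \<and>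
      is_iso (rcat M j) Z Z (h \<cdot>\<^bsub>rcat M j\<^esub> (rmor M F f \<cdot>\<^bsub>rcat M j\<^esub> g)))"

text \<open>
  The undetected morphisms. For a step \<open>Q \<subseteq> P\<close> that adds \<open>p\<close>, those of them that lie in \<open>M\<^bsub>P\<^esub>\<close> form
  the preimage of the maximal ideal of \<open>M\<^bsub>P/Q\<^esub>\<close>, by a condition in which \<open>P\<close> and \<open>Q\<close> do not occur.
\<close>

definition class_ideal :: "('i \<times> 'o) set set \<Rightarrow> 'i \<Rightarrow> 'm set" where
  "class_ideal p i = (if i \<in> Obj C then {f \<in> arrows (rcat M i). \<not> iso_on_class p i f} else {})"

lemma class_idealI:
  assumes "i \<in> Obj C" "f \<in> arrows (rcat M i)"
    "\<And>j F g h Z. \<lbrakk>j \<in> Obj C; F \<in> mor1 C i j; Z \<in> members {p} j; g \<in> arrows (rcat M j); h \<in> arrows (rcat M j);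
      src (rcat M j) g = Z; tgt (rcat M j) g = robj M F (src (rcat M i) f);
      src (rcat M j) h = robj M F (tgt (rcat M i) f); tgt (rcat M j) h = Z;
      is_iso (rcat M j) Z Z (h \<cdot>\<^bsub>rcat M j\<^esub> (rmor M F f \<cdot>\<^bsub>rcat M j\<^esub> g))\<rbrakk> \<Longrightarrow> False"
  shows "f \<in> class_ideal p i"
proof -
  have "\<not> iso_on_class p i f" unfolding iso_on_class_def using assms(3) by blast
  then show ?thesis unfolding class_ideal_def using assms(1,2) by simp
qed

lemma class_idealD:
  assumes "f \<in> class_ideal p i" "j \<in> Obj C" "F \<in> mor1 C i j" "Z \<in> members {p} j" "g \<in> arrows (rcat M j)"
    "h \<in> arrows (rcat M j)" "src (rcat M j) g = Z" "tgt (rcat M j) g = robj M F (src (rcat M i) f)"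
    "src (rcat M j) h = robj M F (tgt (rcat M i) f)" "tgt (rcat M j) h = Z"
  shows "\<not> is_iso (rcat M j) Z Z (h \<cdot>\<^bsub>rcat M j\<^esub> (rmor M F f \<cdot>\<^bsub>rcat M j\<^esub> g))"
proof -
  have "\<not> iso_on_class p i f" using assms(1) unfolding class_ideal_def by (simp split: if_splits)
  then show ?thesis unfolding iso_on_class_def using assms(2-) by blast
qed

lemma class_ideal_arr: "f \<in> class_ideal p i \<Longrightarrow> i \<in> Obj C \<and> f \<in> arrows (rcat M i)"
  unfolding class_ideal_def by (auto split: if_splits)

text \<open>
  If \<open>f + f'\<close> is detected by \<open>Z\<close>, a sum of two endomorphisms of \<open>Z\<close> is invertible, and by locality
  \<open>f\<close> or \<open>f'\<close> is detected as well. If \<open>F f\<close> is detected by \<open>G\<close>, then \<open>f\<close> is detected by \<open>G F\<close>.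
\<close>

lemma stable_class_ideal:
  assumes p: "p \<in> Ind_classes C M"
  shows "stable_ideal C M (class_ideal p)"
  unfolding stable_ideal_def
proof (intro conjI ballI)
  fix i assume i: "i \<in> Obj C"
  interpret i: finitary_category "rcat M i" using finitary_rcat i by blast
  have Z: "indecomposable (rcat M j) Z" "Z \<in> Ob (rcat M j)" if "Z \<in> members {p} j" for j Z
    using members_indecomposable[of "{p}"] p that by blast+
  have zero: "zero_mor (rcat M i) X Y \<in> class_ideal p i" if XY: "X \<in> Ob (rcat M i)" "Y \<in> Ob (rcat M i)" for X Y
  proof (rule class_idealI)
    fix j F g h Z
    assume j: "j \<in> Obj C" "F \<in> mor1 C i j" and ZZ: "Z \<in> members {p} j"
      and gh: "g \<in> arrows (rcat M j)" "h \<in> arrows (rcat M j)"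
      "src (rcat M j) g = Z" "tgt (rcat M j) g = robj M F (src (rcat M i) (zero_mor (rcat M i) X Y))"
      "src (rcat M j) h = robj M F (tgt (rcat M i) (zero_mor (rcat M i) X Y))" "tgt (rcat M j) h = Z"
      and iso: "is_iso (rcat M j) Z Z (h \<cdot>\<^bsub>rcat M j\<^esub> (rmor M F (zero_mor (rcat M i) X Y) \<cdot>\<^bsub>rcat M j\<^esub> g))"
    interpret F: linear_functor_between "rcat M i" "rcat M j" "robj M F" "rmor M F"
      using linear.functor_between i j by blast
    have "is_iso (rcat M j) Z Z (zero_mor (rcat M j) Z Z)" using iso gh XY Z(2)[OF ZZ] by simp
    then obtain g where "g \<in> arrows (rcat M j)" "src (rcat M j) g = Z" "tgt (rcat M j) g = Z"
      "g \<cdot>\<^bsub>rcat M j\<^esub> zero_mor (rcat M j) Z Z = idm (rcat M j) Z"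
      using F.B.is_isoE[OF _ Z(2)[OF ZZ] Z(2)[OF ZZ]] by metis
    then have "zero_object (rcat M j) Z" using Z(2)[OF ZZ] by (simp add: F.B.zero_object_iff)
    then show False using Z(1)[OF ZZ] unfolding indecomposable_def by blast
  qed (use i XY in simp_all)
  have plus: "f \<boxplus>\<^bsub>rcat M i\<^esub> f' \<in> class_ideal p i"
    if f: "f \<in> class_ideal p i" "f' \<in> class_ideal p i"
      "src (rcat M i) f = src (rcat M i) f'" "tgt (rcat M i) f = tgt (rcat M i) f'" for f f'
  proof (rule class_idealI)
    have fa: "f \<in> arrows (rcat M i)" "f' \<in> arrows (rcat M i)" using f class_ideal_arr by blast+
    show "f \<boxplus>\<^bsub>rcat M i\<^esub> f' \<in> arrows (rcat M i)" using f fa by simp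
    fix j F g h Z
    assume j: "j \<in> Obj C" "F \<in> mor1 C i j" and ZZ: "Z \<in> members {p} j"
      and gh: "g \<in> arrows (rcat M j)" "h \<in> arrows (rcat M j)"
      "src (rcat M j) g = Z" "tgt (rcat M j) g = robj M F (src (rcat M i) (f \<boxplus>\<^bsub>rcat M i\<^esub> f'))"
      "src (rcat M j) h = robj M F (tgt (rcat M i) (f \<boxplus>\<^bsub>rcat M i\<^esub> f'))" "tgt (rcat M j) h = Z"
      and iso: "is_iso (rcat M j) Z Z (h \<cdot>\<^bsub>rcat M j\<^esub> (rmor M F (f \<boxplus>\<^bsub>rcat M i\<^esub> f') \<cdot>\<^bsub>rcat M j\<^esub> g))"
    interpret F: linear_functor_between "rcat M i" "rcat M j" "robj M F" "rmor M F"
      using linear.functor_between i j by blast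
    interpret j: finitary_category "rcat M j" using finitary_rcat j by blast
    have "is_iso (rcat M j) Z Z ((h \<cdot>\<^bsub>rcat M j\<^esub> (rmor M F f \<cdot>\<^bsub>rcat M j\<^esub> g)) \<boxplus>\<^bsub>rcat M j\<^esub> (h \<cdot>\<^bsub>rcat M j\<^esub> (rmor M F f' \<cdot>\<^bsub>rcat M j\<^esub> g)))"
      using iso gh f fa by simp
    then have "is_iso (rcat M j) Z Z (h \<cdot>\<^bsub>rcat M j\<^esub> (rmor M F f \<cdot>\<^bsub>rcat M j\<^esub> g)) \<or>
      is_iso (rcat M j) Z Z (h \<cdot>\<^bsub>rcat M j\<^esub> (rmor M F f' \<cdot>\<^bsub>rcat M j\<^esub> g))"
      by (rule j.indecomposable_sum_iso[OF Z(1)[OF ZZ], rotated -1]) (use gh f fa in simp_all)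
    then show False
      using class_idealD[OF f(1) j ZZ gh(1-3)] class_idealD[OF f(2) j ZZ gh(1-3)] gh f fa by simp
  qed (use i in simp_all)
  have scale: "c \<odot>\<^bsub>rcat M i\<^esub> f \<in> class_ideal p i" if f: "f \<in> class_ideal p i" for f c
  proof (rule class_idealI)
    have fa: "f \<in> arrows (rcat M i)" using f class_ideal_arr by blast
    show "c \<odot>\<^bsub>rcat M i\<^esub> f \<in> arrows (rcat M i)" using fa by simp
    fix j F g h Z
    assume j: "j \<in> Obj C" "F \<in> mor1 C i j" and ZZ: "Z \<in> members {p} j"
      and gh: "g \<in> arrows (rcat M j)" "h \<in> arrows (rcat M j)"
      "src (rcat M j) g = Z" "tgt (rcat M j) g = robj M F (src (rcat M i) (c \<odot>\<^bsub>rcat M i\<^esub> f))"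
      "src (rcat M j) h = robj M F (tgt (rcat M i) (c \<odot>\<^bsub>rcat M i\<^esub> f))" "tgt (rcat M j) h = Z"
      and iso: "is_iso (rcat M j) Z Z (h \<cdot>\<^bsub>rcat M j\<^esub> (rmor M F (c \<odot>\<^bsub>rcat M i\<^esub> f) \<cdot>\<^bsub>rcat M j\<^esub> g))"
    interpret F: linear_functor_between "rcat M i" "rcat M j" "robj M F" "rmor M F"
      using linear.functor_between i j by blast
    show False
      using class_idealD[OF f j ZZ, of "c \<odot>\<^bsub>rcat M j\<^esub> g" h] gh fa iso by simp
  qed (use i in simp_all)
  have cmp: "f' \<cdot>\<^bsub>rcat M i\<^esub> f \<in> class_ideal p i"
    if f: "f \<in> arrows (rcat M i)" "f' \<in> arrows (rcat M i)" "src (rcat M i) f' = tgt (rcat M i) f"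
      "f \<in> class_ideal p i \<or> f' \<in> class_ideal p i" for f f'
  proof (rule class_idealI)
    fix j F g h Z
    assume j: "j \<in> Obj C" "F \<in> mor1 C i j" and ZZ: "Z \<in> members {p} j"
      and gh: "g \<in> arrows (rcat M j)" "h \<in> arrows (rcat M j)"
      "src (rcat M j) g = Z" "tgt (rcat M j) g = robj M F (src (rcat M i) (f' \<cdot>\<^bsub>rcat M i\<^esub> f))"
      "src (rcat M j) h = robj M F (tgt (rcat M i) (f' \<cdot>\<^bsub>rcat M i\<^esub> f))" "tgt (rcat M j) h = Z"
      and iso: "is_iso (rcat M j) Z Z (h \<cdot>\<^bsub>rcat M j\<^esub> (rmor M F (f' \<cdot>\<^bsub>rcat M i\<^esub> f) \<cdot>\<^bsub>rcat M j\<^esub> g))"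
    interpret F: linear_functor_between "rcat M i" "rcat M j" "robj M F" "rmor M F"
      using linear.functor_between i j by blast
    show False using f(4)
    proof
      assume "f \<in> class_ideal p i"
      from class_idealD[OF this j ZZ, of g "h \<cdot>\<^bsub>rcat M j\<^esub> rmor M F f'"] show False
        using gh f(1-3) iso by simp
    next
      assume "f' \<in> class_ideal p i"
      from class_idealD[OF this j ZZ, of "rmor M F f \<cdot>\<^bsub>rcat M j\<^esub> g" h] show False
        using gh f(1-3) iso by simp
    qed
  qed (use i f in simp_all)
  show "cat_ideal (rcat M i) (class_ideal p i)"
    unfolding cat_ideal_def using class_ideal_arr zero plus scale cmp by auto
next
  fix i j F f assume ij: "i \<in> Obj C" "j \<in> Obj C" "F \<in> mor1 C i j" and f: "f \<in> class_ideal p i"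
  interpret F: linear_functor_between "rcat M i" "rcat M j" "robj M F" "rmor M F"
    using linear.functor_between ij by blast
  have fa: "f \<in> arrows (rcat M i)" using f class_ideal_arr by blast
  show "rmor M F f \<in> class_ideal p j"
  proof (rule class_idealI)
    fix k G g h Z
    assume k: "k \<in> Obj C" "G \<in> mor1 C j k" and ZZ: "Z \<in> members {p} k"
      and gh: "g \<in> arrows (rcat M k)" "h \<in> arrows (rcat M k)"
      "src (rcat M k) g = Z" "tgt (rcat M k) g = robj M G (src (rcat M j) (rmor M F f))"
      "src (rcat M k) h = robj M G (tgt (rcat M j) (rmor M F f))" "tgt (rcat M k) h = Z"
      and iso: "is_iso (rcat M k) Z Z (h \<cdot>\<^bsub>rcat M k\<^esub> (rmor M G (rmor M F f) \<cdot>\<^bsub>rcat M k\<^esub> g))"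
    have GF: "comp1 C G F \<in> mor1 C i k" using comp1_in ij k by blast
    show False
      using class_idealD[OF f k(1) GF ZZ gh(1,2,3)] gh iso fa ij k
        robj_comp1[OF ij(1,2) k(1) ij(3) k(2)] rmor_comp1[OF ij(1,2) k(1) ij(3) k(2) fa] by simp
  qed (use ij fa in simp_all)
qed

text \<open>
  For an identity, the composites in question are those of the form \<open>Z \<rightarrow> F X \<rightarrow> Z\<close>.
\<close>

lemma idm_class_ideal_iff:
  assumes i: "i \<in> Obj C" and X: "X \<in> Ob (rcat M i)" and p: "p \<in> Ind_classes C M"
  shows "idm (rcat M i) X \<in> class_ideal p i \<longleftrightarrow>
    (\<forall>j\<in>Obj C. \<forall>F\<in>mor1 C i j. \<forall>Z\<in>members {p} j. \<not> retract (rcat M j) Z (robj M F X))"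
proof (intro iffI ballI notI)
  fix j F Z assume id: "idm (rcat M i) X \<in> class_ideal p i" and j: "j \<in> Obj C" "F \<in> mor1 C i j"
    and ZZ: "Z \<in> members {p} j" and r: "retract (rcat M j) Z (robj M F X)"
  interpret F: linear_functor_between "rcat M i" "rcat M j" "robj M F" "rmor M F"
    using linear.functor_between i j by blast
  obtain s r where *: "Z \<in> Ob (rcat M j)" "s \<in> arrows (rcat M j)" "r \<in> arrows (rcat M j)" "src (rcat M j) s = Z"
    "tgt (rcat M j) s = robj M F X" "src (rcat M j) r = robj M F X" "tgt (rcat M j) r = Z"
    "r \<cdot>\<^bsub>rcat M j\<^esub> s = idm (rcat M j) Z" using F.B.retractE[OF r] by metis
  have "is_iso (rcat M j) Z Z (idm (rcat M j) Z)"
    by (rule F.B.is_isoI[of _ "idm (rcat M j) Z"]) (use * in simp_all)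
  then show False using class_idealD[OF id j ZZ, of s r] * X by simp
next
  assume nr: "\<forall>j\<in>Obj C. \<forall>F\<in>mor1 C i j. \<forall>Z\<in>members {p} j. \<not> retract (rcat M j) Z (robj M F X)"
  interpret i: finitary_category "rcat M i" using finitary_rcat i by blast
  show "idm (rcat M i) X \<in> class_ideal p i"
  proof (rule class_idealI)
    fix j F g h Z
    assume j: "j \<in> Obj C" "F \<in> mor1 C i j" and ZZ: "Z \<in> members {p} j"
      and gh: "g \<in> arrows (rcat M j)" "h \<in> arrows (rcat M j)"
      "src (rcat M j) g = Z" "tgt (rcat M j) g = robj M F (src (rcat M i) (idm (rcat M i) X))"
      "src (rcat M j) h = robj M F (tgt (rcat M i) (idm (rcat M i) X))" "tgt (rcat M j) h = Z"
      and iso: "is_iso (rcat M j) Z Z (h \<cdot>\<^bsub>rcat M j\<^esub> (rmor M F (idm (rcat M i) X) \<cdot>\<^bsub>rcat M j\<^esub> g))"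
    interpret F: linear_functor_between "rcat M i" "rcat M j" "robj M F" "rmor M F"
      using linear.functor_between i j by blast
    have "is_iso (rcat M j) Z Z (h \<cdot>\<^bsub>rcat M j\<^esub> g)" using iso gh X by simp
    then have "retract (rcat M j) Z (robj M F X)"
      using finitary_category.retract_if_iso_factors[OF finitary_rcat[OF j(1)]] gh X by simp
    then show False using nr j ZZ by blast
  qed (use i X in simp_all)
qed

end

section \<open>The subquotient at one step of a filtration\<close>

text \<open>
  One step \<open>Q \<subseteq> P\<close> of a filtration, which adds the class \<open>p\<close>.
\<close>

locale filtration_step = finitary_2representation C M
  for C :: "('i, 'f, 'a, 'k::field) two_cat" and M :: "('i, 'f, 'a, 'o, 'm, 'k) two_rep" +
  fixes P Q :: "('i \<times> 'o) set set set" and p :: "('i \<times> 'o) set set"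
  assumes coideal_P: "coideal C M P" and coideal_Q: "coideal C M Q"
    and Q_sub: "Q \<subseteq> P" and step: "P - Q = {p}"
begin

lemma p_class: "p \<in> Ind_classes C M" "p \<in> P" "p \<notin> Q"
  using step coideal_P unfolding coideal_def by blast+

lemma members_step: "members P i = members Q i \<union> members {p} i"
proof -
  have "P = Q \<union> {p}" using step Q_sub by blast
  then show ?thesis using members_Un by metis
qed

lemma objects_Ob: "i \<in> Obj C \<Longrightarrow> X \<in> objects P i \<Longrightarrow> X \<in> Ob (rcat M i)"
  "i \<in> Obj C \<Longrightarrow> X \<in> objects Q i \<Longrightarrow> X \<in> Ob (rcat M i)"
  using objects_iff coideal_P coideal_Q by blast+

lemma objects_sub: "i \<in> Obj C \<Longrightarrow> objects Q i \<subseteq> objects P i"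
  using objects_iff[OF coideal_P] objects_iff[OF coideal_Q] members_step by blast

text \<open>
  If \<open>X\<close> lies in \<open>M\<^bsub>Q\<^esub>\<close>, then so does every \<open>F X\<close>, which therefore has no summand in \<open>p\<close>. If \<open>X\<close> does not lie
  in \<open>M\<^bsub>Q\<^esub>\<close>, then it has an indecomposable summand in \<open>p\<close>, and \<open>X = F X\<close> for the identity 1-morphism \<open>F\<close>.
\<close>

lemma idm_class_ideal_objects:
  assumes i: "i \<in> Obj C" and X: "X \<in> objects P i"
  shows "idm (rcat M i) X \<in> class_ideal p i \<longleftrightarrow> X \<in> objects Q i"
proof
  assume id: "idm (rcat M i) X \<in> class_ideal p i"
  have "Y \<in> members Q i" if Y: "indecomposable (rcat M i) Y" "retract (rcat M i) Y X" for Y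
  proof (rule ccontr)
    assume "Y \<notin> members Q i"
    moreover have "Y \<in> members P i" using X Y objects_iff[OF coideal_P i] by blast
    ultimately have "Y \<in> members {p} i" using members_step by blast
    moreover have "robj M (Id1 C i) X = X" using robj_Id1[OF i] objects_Ob[OF i] X by blast
    ultimately show False
      using id idm_class_ideal_iff[OF i _ p_class(1)] objects_Ob[OF i] X Id1_in[OF i] i Y(2) by metis
  qed
  then show "X \<in> objects Q i" using objects_iff[OF coideal_Q i] objects_Ob[OF i] X by blast
next
  assume XQ: "X \<in> objects Q i"
  have "\<not> retract (rcat M j) Z (robj M F X)"
    if j: "j \<in> Obj C" "F \<in> mor1 C i j" and Z: "Z \<in> members {p} j" for j F Z
  proof
    assume "retract (rcat M j) Z (robj M F X)"
    moreover have "indecomposable (rcat M j) Z" using members_indecomposable[of "{p}"] p_class Z by blast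
    ultimately have "Z \<in> members Q j"
      using objects_stable[OF coideal_Q i j XQ] objects_iff[OF coideal_Q j(1)] by blast
    then show False using members_disjoint[OF coideal_Q p_class(1,3) Z] by blast
  qed
  then show "idm (rcat M i) X \<in> class_ideal p i"
    using idm_class_ideal_iff[OF i objects_Ob(1)[OF i X] p_class(1)] by blast
qed

text \<open>
  The ideal with \<open>M\<^bsub>P/Q\<^esub> = M\<^bsub>P\<^esub>/G\<close>.
\<close>

definition G :: "'i \<Rightarrow> 'm set" where
  "G i = generated_ideal (rcat (sub_rep M P) i) (idm (rcat M i) ` Ob (rcat (sub_rep M Q) i))"

lemma G_eq: "i \<in> Obj C \<Longrightarrow>
  G i = generated_ideal (full_subcat (rcat M i) (objects P i)) (idm (rcat M i) ` objects Q i)"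
proof -
  assume "i \<in> Obj C"
  then have "Ob (rcat M i) \<inter> objects Q i = objects Q i" using objects_Ob(2) by blast
  then show ?thesis unfolding G_def sub_rep_eq by simp
qed

lemma sub_linear: "linear_2representation C (sub_rep M P)"
  unfolding sub_rep_eq by (rule linear.restrict) (rule objects_stable[OF coideal_P])

lemma ideal_class: "i \<in> Obj C \<Longrightarrow> category_with_ideal (rcat M i) (class_ideal p i)"
  by (rule linear.category_with_ideal_rcat[OF stable_class_ideal[OF p_class(1)]])

lemma cat_ideal_G: "i \<in> Obj C \<Longrightarrow> cat_ideal (full_subcat (rcat M i) (objects P i)) (G i)"
proof -
  assume i: "i \<in> Obj C"
  interpret linear_category "rcat M i" using rcat_linear i by blast
  have "idm (rcat M i) ` objects Q i \<subseteq> arrows (full_subcat (rcat M i) (objects P i))"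
    using objects_sub[OF i] objects_Ob[OF i] by (auto simp: arr_full_subcat)
  then show ?thesis
    unfolding G_eq[OF i] by (rule linear_category.cat_ideal_generated[OF linear_full_subcat])
qed

lemma subquotient_cat: "i \<in> Obj C \<Longrightarrow>
  subquotient_category (rcat M i) (class_ideal p i) (objects P i) (G i)"
proof -
  assume i: "i \<in> Obj C"
  interpret category_with_ideal "rcat M i" "class_ideal p i" by (rule ideal_class[OF i])
  interpret S: linear_category "full_subcat (rcat M i) (objects P i)" by (rule linear_full_subcat)
  have "cat_ideal (full_subcat (rcat M i) (objects P i))
    (class_ideal p i \<inter> arrows (full_subcat (rcat M i) (objects P i)))"
    unfolding cat_ideal_def
    by (auto simp: arr_full_subcat ideal_arr ideal_plus ideal_scale ideal_cmp)
  moreover have "idm (rcat M i) ` objects Q i \<subseteq> class_ideal p i \<inter> arrows (full_subcat (rcat M i) (objects P i))"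
    using idm_class_ideal_objects[OF i] objects_sub[OF i] objects_Ob[OF i] by (auto simp: arr_full_subcat)
  ultimately have "G i \<subseteq> class_ideal p i"
    unfolding G_eq[OF i] using generated_ideal_least by blast
  then show ?thesis
    by unfold_locales (use cat_ideal_G[OF i] in auto)
qed

text \<open>
  The morphisms that a 1-morphism \<open>F\<close> maps into the ideal form an ideal again. It contains the
  generators, since \<open>F\<close> preserves the objects of \<open>M\<^bsub>Q\<^esub>\<close>.
\<close>

lemma stable_G: "stable_ideal C (sub_rep M P) G"
  unfolding stable_ideal_def
proof (intro conjI ballI)
  fix i assume "i \<in> Obj C"
  then show "cat_ideal (rcat (sub_rep M P) i) (G i)" using cat_ideal_G unfolding sub_rep_eq by simp
next
  fix i j F f assume ij: "i \<in> Obj C" "j \<in> Obj C" "F \<in> mor1 C i j" and f: "f \<in> G i"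
  interpret S: linear_2representation C "sub_rep M P" by (rule sub_linear)
  interpret F: linear_functor_between "rcat (sub_rep M P) i" "rcat (sub_rep M P) j" "robj M F" "rmor M F"
    using S.functor_between[OF ij] unfolding sub_rep_eq by simp
  interpret j: category_with_ideal "rcat (sub_rep M P) j" "G j"
    by unfold_locales (use cat_ideal_G[OF ij(2)] in \<open>simp add: sub_rep_eq\<close>)
  have "cat_ideal (rcat (sub_rep M P) i) {f \<in> arrows (rcat (sub_rep M P) i). rmor M F f \<in> G j}"
    (is "cat_ideal ?A ?I")
  proof -
    have "zero_mor ?A X Y \<in> ?I" if "X \<in> Ob ?A" "Y \<in> Ob ?A" for X Y
      using that by simp
    moreover have "f \<boxplus>\<^bsub>?A\<^esub> g \<in> ?I" if "f \<in> ?I" "g \<in> ?I" "src ?A f = src ?A g" "tgt ?A f = tgt ?A g" for f g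
      using that j.ideal_plus[of "rmor M F f" "rmor M F g"] by simp
    moreover have "c \<odot>\<^bsub>?A\<^esub> f \<in> ?I" if "f \<in> ?I" for f c
      using that j.ideal_scale[of "rmor M F f" c] by simp
    moreover have "g \<cdot>\<^bsub>?A\<^esub> f \<in> ?I"
      if "f \<in> arrows ?A" "g \<in> arrows ?A" "src ?A g = tgt ?A f" "f \<in> ?I \<or> g \<in> ?I" for f g
      using that j.ideal_cmp[of "rmor M F f" "rmor M F g"] by auto
    ultimately show ?thesis unfolding cat_ideal_def by auto
  qed
  moreover have "idm (rcat M i) ` Ob (rcat (sub_rep M Q) i) \<subseteq> {f \<in> arrows (rcat (sub_rep M P) i). rmor M F f \<in> G j}"
  proof
    fix m assume "m \<in> idm (rcat M i) ` Ob (rcat (sub_rep M Q) i)"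
    then obtain X where X: "m = idm (rcat M i) X" "X \<in> Ob (rcat M i)" "X \<in> objects Q i"
      unfolding sub_rep_eq by auto
    have XP: "X \<in> Ob (rcat (sub_rep M P) i)" using X objects_sub[OF ij(1)] unfolding sub_rep_eq by auto
    have m: "m = idm (rcat (sub_rep M P) i) X" using X(1) unfolding sub_rep_eq by simp
    have "rmor M F m = idm (rcat (sub_rep M P) j) (robj M F X)" unfolding m by (rule F.pres_idm[OF XP])
    then have "rmor M F m = idm (rcat M j) (robj M F X)" unfolding sub_rep_eq by simp
    moreover have "robj M F X \<in> objects Q j" using objects_stable[OF coideal_Q ij X(3)] .
    ultimately have "rmor M F m \<in> idm (rcat M j) ` objects Q j" by (simp only: imageI)
    then have "rmor M F m \<in> G j"
      unfolding G_eq[OF ij(2)] by (rule generated_ideal_mem)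
    then show "m \<in> {f \<in> arrows (rcat (sub_rep M P) i). rmor M F f \<in> G j}"
      using F.A.idm_arr(1)[OF XP] m by (simp only: mem_Collect_eq)
  qed
  ultimately have "G i \<subseteq> {f \<in> arrows (rcat (sub_rep M P) i). rmor M F f \<in> G j}"
    unfolding G_def[of i] by (rule generated_ideal_least)
  then show "rmor (sub_rep M P) F f \<in> G j" using f unfolding sub_rep_eq by auto
qed

abbreviation "N \<equiv> subquotient C M P Q"

lemma N_eq: "N = quotient_rep C (sub_rep M P) G"
  unfolding subquotient_def G_def ..

lemma N_linear: "linear_2representation C N"
  unfolding N_eq by (rule linear_2representation.linear_quotient[OF sub_linear stable_G])

lemma rcat_N: "rcat N i = quotient_cat (full_subcat (rcat M i) (objects P i)) (G i)"
  unfolding N_eq sub_rep_eq by simp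

lemma robj_N: "robj N = robj M"
  unfolding N_eq sub_rep_eq by simp

lemma rmor_N:
  assumes "i \<in> Obj C" "j \<in> Obj C" "F \<in> mor1 C i j" "f \<in> arrows (full_subcat (rcat M i) (objects P i))"
  shows "rmor N F (coset (full_subcat (rcat M i) (objects P i)) (G i) f) =
    coset (full_subcat (rcat M j) (objects P j)) (G j) (rmor M F f)"
  using linear_2representation.rmor_quotient[OF sub_linear stable_G assms(1-3), of f] assms(4)
  unfolding N_eq sub_rep_eq by simp

text \<open>
  The ideal \<open>I/G\<close> of \<open>M\<^bsub>P/Q\<^esub>\<close>, where \<open>I\<close> is the ideal of the class \<open>p\<close>.
\<close>

definition K :: "'i \<Rightarrow> 'm set set" where
  "K i = (if i \<in> Obj C then coset (full_subcat (rcat M i) (objects P i)) (G i) `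
    (class_ideal p i \<inter> arrows (full_subcat (rcat M i) (objects P i))) else {})"

lemma rmor_arr_P:
  assumes "i \<in> Obj C" "j \<in> Obj C" "F \<in> mor1 C i j" "f \<in> arrows (full_subcat (rcat M i) (objects P i))"
  shows "rmor M F f \<in> arrows (full_subcat (rcat M j) (objects P j))"
  using linear_functor_between.arr(1)[OF linear_2representation.functor_between[OF sub_linear assms(1-3)]]
    assms(4) unfolding sub_rep_eq by simp

lemma rep_ideal_K: "rep_ideal C N K"
  unfolding rep_ideal_def
proof (intro conjI ballI allI impI)
  fix i assume i: "i \<in> Obj C"
  interpret i: subquotient_category "rcat M i" "class_ideal p i" "objects P i" "G i"
    by (rule subquotient_cat[OF i])
  show "cat_ideal (rcat N i) (K i)"
    using i.ideal_K i unfolding rcat_N K_def i.K_def by simp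
next
  fix i j F m assume ij: "i \<in> Obj C" "j \<in> Obj C" "F \<in> mor1 C i j" and m: "m \<in> K i"
  obtain f where f: "m = coset (full_subcat (rcat M i) (objects P i)) (G i) f" "f \<in> class_ideal p i"
    "f \<in> arrows (full_subcat (rcat M i) (objects P i))"
    using m ij unfolding K_def by auto
  have "rmor M F f \<in> class_ideal p j"
    using stable_class_ideal[OF p_class(1)] ij f(2) unfolding stable_ideal_def by blast
  then show "rmor N F m \<in> K j"
    using rmor_N[OF ij f(3)] rmor_arr_P[OF ij f(3)] ij unfolding f(1) K_def by auto
qed (simp add: K_def)

lemma zero_object_N_iff:
  assumes i: "i \<in> Obj C" and X: "X \<in> objects P i"
  shows "zero_object (rcat N i) X \<longleftrightarrow> X \<in> objects Q i"
proof -
  interpret i: subquotient_category "rcat M i" "class_ideal p i" "objects P i" "G i"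
    by (rule subquotient_cat[OF i])
  have "zero_object (rcat N i) X \<longleftrightarrow> idm (rcat M i) X \<in> G i"
    unfolding rcat_N using i.AS.zero_object_quotient_iff[of X] X objects_Ob[OF i] by simp
  also have "\<dots> \<longleftrightarrow> X \<in> objects Q i"
  proof
    show "X \<in> objects Q i" if "idm (rcat M i) X \<in> G i"
      using that i.G_sub idm_class_ideal_objects[OF i X] by blast
    show "idm (rcat M i) X \<in> G i" if "X \<in> objects Q i"
      unfolding G_eq[OF i] by (rule generated_ideal_mem) (use that in blast)
  qed
  finally show ?thesis .
qed

lemma identity_free_K: "identity_free C N K"
  unfolding identity_free_def
proof (intro ballI impI)
  fix i X assume i: "i \<in> Obj C" and X: "X \<in> Ob (rcat N i)" and id: "idm (rcat N i) X \<in> K i"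
  interpret i: subquotient_category "rcat M i" "class_ideal p i" "objects P i" "G i"
    by (rule subquotient_cat[OF i])
  have XP: "X \<in> Ob (rcat M i)" "X \<in> objects P i" using X unfolding rcat_N by simp_all
  have "coset i.AS (G i) (idm (rcat M i) X) \<in> i.K"
    using id i unfolding rcat_N K_def i.K_def i.AS.idm_quotient by simp
  then have "idm (rcat M i) X \<in> class_ideal p i"
    using i.coset_in_K_iff XP by (simp add: i.arr_AS)
  then show "zero_object (rcat N i) X"
    using zero_object_N_iff[OF i XP(2)] idm_class_ideal_objects[OF i XP(2)] by blast
qed

text \<open>
  Let \<open>J\<close> contain the class of a morphism \<open>f\<close> that is not in the ideal of \<open>p\<close>. Composing \<open>F f\<close> on both
  sides puts an automorphism of an object \<open>Z\<close> of \<open>p\<close> into \<open>J\<close>, hence also the identity of \<open>Z\<close>. Then \<open>Z\<close>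
  is zero in \<open>M\<^bsub>P/Q\<^esub>\<close> and lies in \<open>M\<^bsub>Q\<^esub>\<close>, which contradicts \<open>p \<notin> Q\<close>.
\<close>

lemma identity_free_sub_K:
  assumes J: "rep_ideal C N J" "identity_free C N J" and i: "i \<in> Obj C"
  shows "J i \<subseteq> K i"
proof
  fix m assume m: "m \<in> J i"
  interpret i: subquotient_category "rcat M i" "class_ideal p i" "objects P i" "G i"
    by (rule subquotient_cat[OF i])
  have "cat_ideal i.N (J i)"
    using J(1) i unfolding rep_ideal_def rcat_N by blast
  then have "m \<in> arrows i.N" using m unfolding cat_ideal_def by blast
  then obtain f where f: "m = coset i.AS (G i) f" "f \<in> arrows i.AS" by (rule i.AS.arr_quotientE)
  then have fA: "f \<in> arrows (rcat M i)" "src (rcat M i) f \<in> objects P i" "tgt (rcat M i) f \<in> objects P i"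
    by (simp_all add: i.arr_AS)
  have "f \<in> class_ideal p i"
  proof (rule class_idealI[OF i fA(1)])
    fix j F g h Z
    assume j: "j \<in> Obj C" "F \<in> mor1 C i j" and ZZ: "Z \<in> members {p} j"
      and gh: "g \<in> arrows (rcat M j)" "h \<in> arrows (rcat M j)"
      "src (rcat M j) g = Z" "tgt (rcat M j) g = robj M F (src (rcat M i) f)"
      "src (rcat M j) h = robj M F (tgt (rcat M i) f)" "tgt (rcat M j) h = Z"
      and iso: "is_iso (rcat M j) Z Z (h \<cdot>\<^bsub>rcat M j\<^esub> (rmor M F f \<cdot>\<^bsub>rcat M j\<^esub> g))"
    interpret F: linear_functor_between "rcat M i" "rcat M j" "robj M F" "rmor M F"
      using linear.functor_between i j by blast
    interpret j: subquotient_category "rcat M j" "class_ideal p j" "objects P j" "G j"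
      by (rule subquotient_cat[OF j(1)])
    have Z: "indecomposable (rcat M j) Z" "Z \<in> Ob (rcat M j)"
      using members_indecomposable[of "{p}"] p_class ZZ by blast+
    have ZP: "Z \<in> objects P j"
      using members_objects[of P] coideal_P ZZ members_step unfolding coideal_def by blast
    obtain w where w: "w \<in> arrows (rcat M j)" "src (rcat M j) w = Z" "tgt (rcat M j) w = Z"
      "w \<cdot>\<^bsub>rcat M j\<^esub> (h \<cdot>\<^bsub>rcat M j\<^esub> (rmor M F f \<cdot>\<^bsub>rcat M j\<^esub> g)) = idm (rcat M j) Z"
      using F.B.is_isoE[OF iso Z(2) Z(2)] by metis
    interpret J: category_with_ideal j.N "J j"
      by unfold_locales (use J(1) j in \<open>simp add: rep_ideal_def rcat_N[symmetric]\<close>)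
    let ?c = "coset j.AS (G j)"
    have FP: "robj M F (src (rcat M i) f) \<in> objects P j" "robj M F (tgt (rcat M i) f) \<in> objects P j"
      using objects_stable[OF coideal_P i j] fA by blast+
    have AS: "w \<cdot>\<^bsub>rcat M j\<^esub> h \<in> arrows j.AS" "rmor M F f \<in> arrows j.AS" "g \<in> arrows j.AS"
      using w(1-3) gh fA FP ZP by (simp_all add: j.arr_AS)
    have "rmor N F m \<in> J j" using J(1) i j m unfolding rep_ideal_def by blast
    then have "?c (rmor M F f) \<in> J j" using rmor_N[OF i j f(2)] f(1) by simp
    moreover have st: "src j.AS (rmor M F f) = tgt j.AS g" "src j.AS (w \<cdot>\<^bsub>rcat M j\<^esub> h) = tgt j.AS (rmor M F f)"
      using AS w(1-3) gh fA by simp_all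
    ultimately have "?c (w \<cdot>\<^bsub>rcat M j\<^esub> h) \<cdot>\<^bsub>j.N\<^esub> (?c (rmor M F f) \<cdot>\<^bsub>j.N\<^esub> ?c g) \<in> J j"
      using AS by (intro J.ideal_cmp disjI1 disjI2) simp_all
    moreover have "?c (w \<cdot>\<^bsub>rcat M j\<^esub> h) \<cdot>\<^bsub>j.N\<^esub> (?c (rmor M F f) \<cdot>\<^bsub>j.N\<^esub> ?c g) =
      ?c ((w \<cdot>\<^bsub>rcat M j\<^esub> h) \<cdot>\<^bsub>rcat M j\<^esub> (rmor M F f \<cdot>\<^bsub>rcat M j\<^esub> g))"
      using AS st j.AS.cmp_arr[OF AS(3,2) st(1)]
        j.AS.cmp_quotient[OF AS(3,2) st(1)] j.AS.cmp_quotient[OF _ AS(1), of "rmor M F f \<cdot>\<^bsub>rcat M j\<^esub> g"]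
      unfolding cmp_full_subcat by metis
    moreover have "(w \<cdot>\<^bsub>rcat M j\<^esub> h) \<cdot>\<^bsub>rcat M j\<^esub> (rmor M F f \<cdot>\<^bsub>rcat M j\<^esub> g) = idm (rcat M j) Z"
      using w gh fA by simp
    ultimately have "?c (idm (rcat M j) Z) \<in> J j" by (simp only:)
    then have "idm (rcat N j) Z \<in> J j" unfolding rcat_N j.AS.idm_quotient idm_full_subcat .
    then have "zero_object (rcat N j) Z"
      using J(2) j(1) Z(2) ZP unfolding identity_free_def rcat_N by simp
    then have "Z \<in> objects Q j" using zero_object_N_iff[OF j(1) ZP] by blast
    then have "Z \<in> members Q j"
      using objects_iff[OF coideal_Q j(1)] Z F.B.retract_refl by blast
    then show False using members_disjoint[OF coideal_Q p_class(1,3) ZZ] by blast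
  qed
  then show "m \<in> K i" using f i unfolding K_def by auto
qed

lemma maximal_ideal_N: "maximal_ideal C N = K"
  unfolding maximal_ideal_def
proof (rule the_equality)
  have eq: "J = K" if J: "rep_ideal C N J" "identity_free C N J" "\<forall>i\<in>Obj C. K i \<subseteq> J i" for J
  proof
    fix i show "J i = K i"
      using identity_free_sub_K[OF J(1,2)] J(3) J(1) rep_ideal_K
      unfolding rep_ideal_def by (cases "i \<in> Obj C") blast+
  qed
  then show "rep_ideal C N K \<and> identity_free C N K \<and>
    (\<forall>J. rep_ideal C N J \<and> identity_free C N J \<and> (\<forall>i\<in>Obj C. K i \<subseteq> J i) \<longrightarrow> J = K)"
    using rep_ideal_K identity_free_K by blast
  fix I assume "rep_ideal C N I \<and> identity_free C N I \<and>
    (\<forall>J. rep_ideal C N J \<and> identity_free C N J \<and> (\<forall>i\<in>Obj C. I i \<subseteq> J i) \<longrightarrow> J = I)"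
  then show "I = K" using rep_ideal_K identity_free_K identity_free_sub_K by metis
qed

abbreviation "L \<equiv> simple_transitive_quotient C N"
abbreviation "B \<equiv> quotient_rep C M (class_ideal p)"

lemma L_eq: "L = quotient_rep C N K"
  unfolding simple_transitive_quotient_def maximal_ideal_N ..

lemma stable_K: "stable_ideal C N K"
  using rep_ideal_K unfolding rep_ideal_def stable_ideal_def by blast

lemma L_linear: "linear_2representation C L"
  unfolding L_eq by (rule linear_2representation.linear_quotient[OF N_linear stable_K])

lemma B_linear: "linear_2representation C B"
  by (rule linear.linear_quotient[OF stable_class_ideal[OF p_class(1)]])

lemma rcat_L: "rcat L i = quotient_cat (quotient_cat (full_subcat (rcat M i) (objects P i)) (G i)) (K i)"
  unfolding L_eq by (simp add: rcat_N)

lemma Ob_L: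
  assumes "i \<in> Obj C"
  shows "Ob (rcat L i) = objects P i"
proof -
  have "Ob (rcat L i) = Ob (rcat M i) \<inter> objects P i"
    unfolding rcat_L quotient_cat_def by simp
  then show ?thesis using objects_Ob(1)[OF assms] by blast
qed

text \<open>
  The third isomorphism theorem, compatibly with the action: \<open>(M\<^bsub>P\<^esub>/G)/(I/G)\<close> is a full
  subrepresentation of \<open>M/I\<close>.
\<close>

lemma full_2embedding_L: "full_2embedding C L B (\<lambda>_. Union)"
  unfolding full_2embedding_def
proof (intro conjI ballI)
  fix i assume i: "i \<in> Obj C"
  interpret i: subquotient_category "rcat M i" "class_ideal p i" "objects P i" "G i"
    by (rule subquotient_cat[OF i])
  show "full_embedding (rcat L i) (rcat B i) Union"
    using i.full_embedding_Union i unfolding rcat_L K_def i.K_def by simp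
next
  fix i j F assume ij: "i \<in> Obj C" "j \<in> Obj C" "F \<in> mor1 C i j"
  interpret i: subquotient_category "rcat M i" "class_ideal p i" "objects P i" "G i"
    by (rule subquotient_cat[OF ij(1)])
  interpret j: subquotient_category "rcat M j" "class_ideal p j" "objects P j" "G j"
    by (rule subquotient_cat[OF ij(2)])
  have K: "K i = i.K" "K j = j.K" using ij unfolding K_def i.K_def j.K_def by simp_all
  show "robj L F X = robj B F X" for X by (simp add: L_eq robj_N)
  show "\<Union>(rmor L F m) = rmor B F (\<Union>m)" if m: "m \<in> arrows (rcat L i)" for m
  proof -
    obtain f where f: "m = coset i.N i.K (coset i.AS (G i) f)" "f \<in> arrows i.AS"
      using m unfolding rcat_L K by (rule i.arr_LE)
    have "rmor L F m = coset j.N j.K (rmor N F (coset i.AS (G i) f))"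
      using linear_2representation.rmor_quotient[OF N_linear stable_K ij, of "coset i.AS (G i) f"] f
      by (simp add: L_eq rcat_N K)
    then have "\<Union>(rmor L F m) = coset (rcat M j) (class_ideal p j) (rmor M F f)"
      using rmor_N[OF ij f(2)] j.Union_coset_coset rmor_arr_P[OF ij f(2)] by simp
    also have "\<dots> = rmor B F (\<Union>m)"
      using linear.rmor_quotient[OF stable_class_ideal[OF p_class(1)] ij, of f] f
        i.Union_coset_coset[OF f(2)] by (simp add: i.arr_AS)
    finally show ?thesis .
  qed
  fix G' a X assume a: "G' \<in> mor1 C i j" "a \<in> mor2 C i j F G'" and X: "X \<in> Ob (rcat L i)"
  have "rnat M a X \<in> arrows j.AS"
    using linear_2representation.rnat_arr(1)[OF sub_linear ij a, of X] X Ob_L[OF ij(1)] objects_Ob[OF ij(1)]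
    unfolding sub_rep_eq by simp
  moreover have "rnat L a X = coset j.N j.K (coset j.AS (G j) (rnat M a X))"
    using linear_2representation.rnat_quotient[OF N_linear stable_K ij a, of X]
      linear_2representation.rnat_quotient[OF sub_linear stable_G ij a, of X]
    by (simp add: L_eq rcat_N K) (simp add: N_eq sub_rep_eq)
  ultimately show "\<Union>(rnat L a X) = rnat B a X"
    using j.Union_coset_coset linear.rnat_quotient[OF stable_class_ideal[OF p_class(1)] ij a] by simp
qed

text \<open>
  The indecomposable summands of \<open>X\<close> outside \<open>p\<close> lie in \<open>M\<^bsub>Q\<^esub>\<close> and vanish in \<open>M/I\<close>. The remaining sum
  makes sense in every step that adds \<open>p\<close>.
\<close>

lemma isomorphic_to_sum_of_class:
  assumes i: "i \<in> Obj C" and X: "X \<in> objects P i"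
  shows "\<exists>V Xs. finite_direct_sum (rcat M i) V Xs \<and> set Xs \<subseteq> members {p} i \<and> isomorphic (rcat B i) X V"
proof -
  interpret i: category_with_ideal "rcat M i" "class_ideal p i" by (rule ideal_class[OF i])
  obtain Xs where Xs: "finite_direct_sum (rcat M i) X Xs" "set Xs \<subseteq> members P i"
    using objects_decomposition[OF coideal_P i X] .
  let ?Ys = "filter (\<lambda>Z. Z \<in> members {p} i) Xs"
  have "set ?Ys \<subseteq> Ob (rcat M i)" using i.finite_direct_sum_Ob[OF Xs(1)] by auto
  then obtain V where V: "finite_direct_sum (rcat M i) V ?Ys"
    using finitary_category.finite_direct_sum_exists[OF finitary_rcat[OF i]] by blast
  have "Z \<in> members {p} i \<or> idm (rcat M i) Z \<in> class_ideal p i" if Z: "Z \<in> set Xs" for Z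
  proof (cases "Z \<in> members {p} i")
    case False
    then have ZQ: "Z \<in> members Q i" using Z Xs(2) members_step by blast
    then have "Z \<in> objects Q i" using members_objects coideal_Q unfolding coideal_def by blast
    then show ?thesis using idm_class_ideal_objects[OF i] objects_sub[OF i] by blast
  qed simp
  then have "isomorphic i.AI X V"
    using i.isomorphic_quotient_filter[OF _ Xs(1) V] by blast
  then show ?thesis using V by (intro exI[of _ V] exI[of _ ?Ys]) auto
qed

end

text \<open>
  Both quotients are full subrepresentations of the same \<open>M/I\<close>, and both contain all direct sums of
  members of \<open>p\<close>, which represent every object of either one.
\<close>

theorem equivalent_simple_transitive_quotients:
  assumes "filtration_step C M P Q p" "filtration_step C M P' Q' p"
  shows "equivalent_2rep C (simple_transitive_quotient C (subquotient C M P Q))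
    (simple_transitive_quotient C (subquotient C M P' Q'))"
proof -
  have image: "\<exists>X'\<in>Ob (rcat (simple_transitive_quotient C (subquotient C M P' Q')) i).
      isomorphic (rcat (quotient_rep C M (finitary_2representation.class_ideal C M p)) i) X X'"
    if steps: "filtration_step C M P Q p" "filtration_step C M P' Q' p" and i: "i \<in> Obj C"
      and X: "X \<in> Ob (rcat (simple_transitive_quotient C (subquotient C M P Q)) i)" for P Q P' Q' i X
  proof -
    interpret s: filtration_step C M P Q p by (rule steps(1))
    interpret s': filtration_step C M P' Q' p by (rule steps(2))
    obtain V Xs where V: "finite_direct_sum (rcat M i) V Xs" "set Xs \<subseteq> members {p} i"
      "isomorphic (rcat s.B i) X V"
      using s.isomorphic_to_sum_of_class[OF i] X s.Ob_L[OF i] by blast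
    have "set Xs \<subseteq> members P' i" using V(2) s'.members_step by blast
    then have "V \<in> s.objects P' i" by (rule s.direct_sum_objects[OF i V(1)])
    then show ?thesis using V(3) s'.Ob_L[OF i] by blast
  qed
  interpret s: filtration_step C M P Q p by (rule assms(1))
  interpret s': filtration_step C M P' Q' p by (rule assms(2))
  show ?thesis
    by (rule equivalent_full_subrepresentations[OF s.L_linear s'.L_linear s.B_linear
          s.full_2embedding_L s'.full_2embedding_L])
      (use image[OF assms] image[OF assms(2,1)] in blast)+
qed

section \<open>Complete filtrations\<close>

text \<open>
  The steps of a complete filtration enumerate the classes of the action preorder without
  repetition.
\<close>

lemma complete_filtration_enumerates:
  assumes M: "finitary_2representation C M" and Q: "complete_filtration C M k Q"
  obtains p where "bij_betw p {1..k} (Ind_classes C M)"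
    "\<And>i. i \<in> {1..k} \<Longrightarrow> filtration_step C M (Q i) (Q (i - 1)) (p i)"
proof -
  have Q0: "Q 0 = {}" "Q k = Ind_classes C M" "\<forall>i\<le>k. coideal C M (Q i)"
    using Q unfolding complete_filtration_def by blast+
  have step: "Q (i - 1) \<subset> Q i \<and> card (Q i - Q (i - 1)) = 1" if "i \<in> {1..k}" for i
    using Q that unfolding complete_filtration_def by blast+
  have "\<forall>i. \<exists>c. i \<in> {1..k} \<longrightarrow> Q i - Q (i - 1) = {c}"
    using step by (metis card_1_singletonE)
  then obtain p where p: "\<And>i. i \<in> {1..k} \<Longrightarrow> Q i - Q (i - 1) = {p i}" by metis
  have Q_eq: "Q n = p ` {1..n}" if "n \<le> k" for n
    using that
  proof (induction n)
    case (Suc n)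
    then have "Q (Suc n) = insert (p (Suc n)) (Q n)" using p[of "Suc n"] step[of "Suc n"] by auto
    then show ?case using Suc by (simp add: atLeastAtMostSuc_conv)
  qed (simp add: Q0)
  have "inj_on p {1..k}"
  proof (rule linorder_inj_onI)
    fix i j assume ij: "i < j" "i \<in> {1..k}" "j \<in> {1..k}"
    then have "p i \<in> Q (j - 1)" using Q_eq[of "j - 1"] by auto
    then show "p i \<noteq> p j" using p[of j] ij by auto
  qed auto
  then have "bij_betw p {1..k} (Ind_classes C M)"
    using Q_eq[of k] Q0(2) unfolding bij_betw_def by simp
  moreover have "filtration_step C M (Q i) (Q (i - 1)) (p i)" if "i \<in> {1..k}" for i
    using M p[OF that] step[OF that] Q0(3) that
    by (auto intro!: filtration_step.intro filtration_step_axioms.intro)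
  ultimately show ?thesis using that by blast
qed

theorem theorem8:
  fixes C :: "('i, 'f, 'a, 'k::alg_closed_field) two_cat"
    and M :: "('i, 'f, 'a, 'o, 'm, 'k) two_rep"
    and Q R :: "nat \<Rightarrow> ('i \<times> 'o) set set set"
    and k l :: nat
  assumes "finitary_2category C"
    and "finitary_2representation C M"
    and "complete_filtration C M k Q"
    and "complete_filtration C M l R"
  shows "k = l \<and>
    (\<exists>\<sigma>. bij_betw \<sigma> {1..k} {1..k} \<and>
      (\<forall>i\<in>{1..k}. equivalent_2rep C
        (simple_transitive_subquotient C M Q i)
        (simple_transitive_subquotient C M R (\<sigma> i))))"
proof -
  obtain p where p: "bij_betw p {1..k} (Ind_classes C M)"
    "\<And>i. i \<in> {1..k} \<Longrightarrow> filtration_step C M (Q i) (Q (i - 1)) (p i)"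
    using complete_filtration_enumerates[OF assms(2,3)] by blast
  obtain q where q: "bij_betw q {1..l} (Ind_classes C M)"
    "\<And>i. i \<in> {1..l} \<Longrightarrow> filtration_step C M (R i) (R (i - 1)) (q i)"
    using complete_filtration_enumerates[OF assms(2,4)] by blast
  have kl: "k = l"
    using bij_betw_same_card[OF p(1)] bij_betw_same_card[OF q(1)] by simp
  define \<sigma> where "\<sigma> = the_inv_into {1..l} q \<circ> p"
  have \<sigma>: "bij_betw \<sigma> {1..k} {1..k}"
    unfolding \<sigma>_def using bij_betw_trans[OF p(1) bij_betw_the_inv_into[OF q(1)]] kl by simp
  have "equivalent_2rep C (simple_transitive_subquotient C M Q i) (simple_transitive_subquotient C M R (\<sigma> i))"
    if i: "i \<in> {1..k}" for i
  proof -
    have si: "\<sigma> i \<in> {1..l}" using bij_betwE[OF \<sigma>] i kl by blast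
    have "q (\<sigma> i) = p i"
      unfolding \<sigma>_def using f_the_inv_into_f_bij_betw[OF q(1)] bij_betwE[OF p(1)] i by simp
    then show ?thesis
      unfolding simple_transitive_subquotient_def
      using equivalent_simple_transitive_quotients[OF p(2)[OF i]] q(2)[OF si] by simp
  qed
  then show ?thesis using kl \<sigma> by blast
qed

end
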